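(* Let $M^{2n+s}(f,Q,\xi_i,\eta^i,g)$ be a weak $\beta f$-Kenmotsu manifold with $\beta=\mathrm{const}\neq 0$. Then the $\ast$-Ricci tensor $\mathrm{Ric}^\ast$ and the $\ast$-scalar curvature $r^\ast$ are related to the Ricci tensor by $$\mathrm{Ric}^\ast(X,Y)=\mathrm{Ric}(X,QY)+\beta^2\Big\{s(2n-1)\,g(QX,Y)+2n\,\bar\eta(X)\bar\eta(Y)-s(2n-1)\sum_{j}\eta^j(X)\eta^j(Y)\Big\}$$ for all vector fields $X,Y$ on $M$, and $$r^\ast=\mathrm{trace}(Q\,\mathrm{Ric}^\sharp)+\beta^2\{4s\,n^2+s(2n-1)\,\mathrm{trace}\,\widetilde Q\}.$$
   Context: A weak metric $f$-structure on a smooth manifold $M^{2n+s}$ ($n>0$, $s>1$) is a set $(f,Q,\xi_i,\eta^i,g)$, where $f$ is a skew-symmetric $(1,1)$-tensor of rank $2n$, $Q$ is a self-adjoint nonsingular $(1,1)$-tensor, $\xi_i$ ($1\le i\le s$) are orthonormal vector fields, $\eta^i$ are dual 1-forms, and $g$ is a Riemannian metric, such that $f^2=-Q+\sum_i\eta^i\otimes\xi_i$, $\eta^i(\xi_j)=\delta^i_j$, $Q\xi_i=\xi_i$, and $g(fX,fY)=g(X,QY)-\sum_i\eta^i(X)\eta^i(Y)$ for all vector fields $X,Y$. Put $\widetilde Q=Q-\mathrm{id}$, $\bar\xi=\sum_i\xi_i$, $\bar\eta=\sum_i\eta^i$. The structure is normal if $[f,f](X,Y)+2\sum_i d\eta^i(X,Y)\,\xi_i=0$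 for all $X,Y$, where $[f,f](X,Y)=f^2[X,Y]+[fX,fY]-f[fX,Y]-f[X,fY]$ and $d\omega(X,Y)=\tfrac12\{X(\omega(Y))-Y(\omega(X))-\omega([X,Y])\}$. A weak $\beta f$-Kenmotsu manifold is a weak metric $f$-manifold, normal (i.e. $[f,f](X,Y)+2\sum_i d\eta^i(X,Y)\,\xi_i=0$ for all vector fields $X,Y$), satisfying $(\nabla_Xf)Y=\beta\{g(fX,Y)\,\bar\xi-\bar\eta(Y)fX\}$ for all $X,Y$, where $\nabla$ is the Levi-Civita connection of $g$. Curvature conventions: $R_{X,Y}=[\nabla_X,\nabla_Y]-\nabla_{[X,Y]}$, $\mathrm{Ric}(X,Y)=\mathrm{trace}(Z\mapsto R_{Z,X}Y)$, and $\mathrm{Ric}^\sharp$ is the $(1,1)$-tensor with $g(\mathrm{Ric}^\sharp X,Y)=\mathrm{Ric}(X,Y)$. The $\ast$-Ricci tensor is $\mathrm{Ric}^\ast(X,Y)=\tfrac12\,\mathrm{trace}\{Z\mapsto R_{X,fY}fZ\}$ (equivalently $\tfrac12\,\mathrm{trace}\{Z\mapsto f R_{X,fY}Z\}$), and the $\ast$-scalar curvature is $r^\ast=\sum_i\mathrm{Ric}^\ast(e_i,e_i)$ for a local orthonormal basis $(e_i)$ of $TM$. *)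

theory Defs
  imports "HOL-Analysis.Analysis" "HOL-Library.Function_Algebras"
begin

text \<open>
  Real-valued functions, tangent vectors and vector fields are all elements of function spaces;
  with the pointwise operations these become real vector spaces, so that
  \<open>subspace\<close>, \<open>span\<close>, \<open>dim\<close> and \<open>representation\<close> apply to them.
\<close>

instantiation "fun" :: (type, real_vector) real_vector
begin

definition scaleR_fun :: "real \<Rightarrow> ('a \<Rightarrow> 'b) \<Rightarrow> 'a \<Rightarrow> 'b"
  where "scaleR_fun r f = (\<lambda>x. r *\<^sub>R f x)"

instance
  by standard (simp_all add: scaleR_fun_def fun_eq_iff scaleR_add_right scaleR_add_left)

end


section \<open>Smooth manifolds, tangent vectors and vector fields\<close>

text \<open>
  On an open subset of a Euclidean space, \<open>Ck_on k h S\<close> says that \<open>h\<close> is of class \<open>C^k\<close>: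
  it is differentiable and all its directional derivatives are of class \<open>C^(k-1)\<close>.
\<close>

primrec Ck_on :: "nat \<Rightarrow> ('e::euclidean_space \<Rightarrow> 'b::real_normed_vector) \<Rightarrow> 'e set \<Rightarrow> bool" where
  "Ck_on 0 h S \<longleftrightarrow> continuous_on S h"
| "Ck_on (Suc k) h S \<longleftrightarrow>
     h differentiable_on S \<and> (\<forall>v. Ck_on k (\<lambda>x. frechet_derivative h (at x) v) S)"

definition Cinf_on :: "('e::euclidean_space \<Rightarrow> 'b::real_normed_vector) \<Rightarrow> 'e set \<Rightarrow> bool"
  where "Cinf_on h S \<longleftrightarrow> (\<forall>k. Ck_on k h S)"

text \<open>
  A chart is a pair of a domain and a coordinate map. The manifold is the whole type \<open>'a\<close>, and
  its dimension is \<open>DIM('e)\<close>; the Hausdorff property and second countability are imposed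
  by the type classes.
\<close>

type_synonym ('a, 'e) chart = "'a set \<times> ('a \<Rightarrow> 'e)"

definition smooth_manifold ::
    "('a::{t2_space, second_countable_topology}, 'e::euclidean_space) chart set \<Rightarrow> bool" where
  "smooth_manifold A \<longleftrightarrow>
     (\<Union>(U, \<phi>)\<in>A. U) = UNIV \<and>
     (\<forall>(U, \<phi>)\<in>A. open U \<and> open (\<phi> ` U) \<and> homeomorphism U (\<phi> ` U) \<phi> (inv_into U \<phi>)) \<and>
     (\<forall>(U, \<phi>)\<in>A. \<forall>(V, \<psi>)\<in>A. Cinf_on (\<psi> \<circ> inv_into U \<phi>) (\<phi> ` (U \<inter> V)))"

definition smooth_functions :: "('a, 'e::euclidean_space) chart set \<Rightarrow> ('a \<Rightarrow> real) set" where
  "smooth_functions A = {h. \<forall>(U, \<phi>)\<in>A. Cinf_on (h \<circ> inv_into U \<phi>) (\<phi> ` U)}"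

text \<open>
  Tangent vectors at \<open>p\<close> are the derivations at \<open>p\<close> of the algebra of smooth functions, and
  vector fields are the derivations of that algebra. Both are required to vanish on functions
  that are not smooth, so that equality of functions is the intended equality.
\<close>

definition tangent_space ::
    "('a, 'e::euclidean_space) chart set \<Rightarrow> 'a \<Rightarrow> (('a \<Rightarrow> real) \<Rightarrow> real) set" where
  "tangent_space A p = {v.
     (\<forall>h. h \<notin> smooth_functions A \<longrightarrow> v h = 0) \<and>
     (\<forall>h\<in>smooth_functions A. \<forall>k\<in>smooth_functions A.
        v (h + k) = v h + v k \<and> v (h * k) = v h * k p + h p * v k) \<and>
     (\<forall>c. \<forall>h\<in>smooth_functions A. v (c *\<^sub>R h) = c * v h)}"

type_synonym 'a vfield = "('a \<Rightarrow> real) \<Rightarrow> 'a \<Rightarrow> real"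

definition vector_fields :: "('a, 'e::euclidean_space) chart set \<Rightarrow> 'a vfield set" where
  "vector_fields A = {X.
     (\<forall>h. h \<notin> smooth_functions A \<longrightarrow> X h = 0) \<and>
     (\<forall>h\<in>smooth_functions A. X h \<in> smooth_functions A) \<and>
     (\<forall>h\<in>smooth_functions A. \<forall>k\<in>smooth_functions A.
        X (h + k) = X h + X k \<and> X (h * k) = X h * k + h * X k) \<and>
     (\<forall>c. \<forall>h\<in>smooth_functions A. X (c *\<^sub>R h) = c *\<^sub>R X h)}"

definition value_at :: "'a vfield \<Rightarrow> 'a \<Rightarrow> ('a \<Rightarrow> real) \<Rightarrow> real"
  where "value_at X p = (\<lambda>h. X h p)"

definition fscale :: "('a \<Rightarrow> real) \<Rightarrow> 'a vfield \<Rightarrow> 'a vfield"  (infixr \<open>\<star>\<close> 75)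
  where "\<phi> \<star> X = (\<lambda>h. \<phi> * X h)"

definition lie_bracket :: "'a vfield \<Rightarrow> 'a vfield \<Rightarrow> 'a vfield"
  where "lie_bracket X Y = (\<lambda>h. X (Y h) - Y (X h))"


section \<open>Tensor fields\<close>

text \<open>
  Tensor fields are maps on the module of vector fields that are linear over the smooth functions.
\<close>

definition one_form ::
    "('a, 'e::euclidean_space) chart set \<Rightarrow> ('a vfield \<Rightarrow> 'a \<Rightarrow> real) \<Rightarrow> bool" where
  "one_form A \<omega> \<longleftrightarrow>
     (\<forall>X\<in>vector_fields A. \<omega> X \<in> smooth_functions A) \<and>
     (\<forall>X\<in>vector_fields A. \<forall>Y\<in>vector_fields A. \<omega> (X + Y) = \<omega> X + \<omega> Y) \<and>
     (\<forall>\<phi>\<in>smooth_functions A. \<forall>X\<in>vector_fields A. \<omega> (\<phi> \<star> X) = \<phi> * \<omega> X)"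

definition tensor11 ::
    "('a, 'e::euclidean_space) chart set \<Rightarrow> ('a vfield \<Rightarrow> 'a vfield) \<Rightarrow> bool" where
  "tensor11 A T \<longleftrightarrow>
     (\<forall>X\<in>vector_fields A. T X \<in> vector_fields A) \<and>
     (\<forall>X\<in>vector_fields A. \<forall>Y\<in>vector_fields A. T (X + Y) = T X + T Y) \<and>
     (\<forall>\<phi>\<in>smooth_functions A. \<forall>X\<in>vector_fields A. T (\<phi> \<star> X) = \<phi> \<star> T X)"

text \<open>
  The endomorphism of the tangent space at \<open>p\<close> induced by a (1,1)-tensor. By tensoriality the
  result does not depend on the vector field chosen to extend \<open>v\<close>.
\<close>

definition tensor_at ::
    "('a, 'e::euclidean_space) chart set \<Rightarrow> ('a vfield \<Rightarrow> 'a vfield) \<Rightarrow> 'a \<Rightarrow>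
     (('a \<Rightarrow> real) \<Rightarrow> real) \<Rightarrow> ('a \<Rightarrow> real) \<Rightarrow> real" where
  "tensor_at A T p v = value_at (T (SOME V. V \<in> vector_fields A \<and> value_at V p = v)) p"

text \<open>
  The trace of an endomorphism \<open>T\<close> of a finite-dimensional subspace \<open>S\<close>: the sum of the diagonal
  entries of its matrix in a basis of \<open>S\<close>, which does not depend on the basis.
\<close>

definition endo_trace :: "'v::real_vector set \<Rightarrow> ('v \<Rightarrow> 'v) \<Rightarrow> real" where
  "endo_trace S T =
     (let B = (SOME B. independent B \<and> span B = S) in \<Sum>b\<in>B. representation B (T b) b)"

definition tensor_trace ::
    "('a, 'e::euclidean_space) chart set \<Rightarrow> ('a vfield \<Rightarrow> 'a vfield) \<Rightarrow> 'a \<Rightarrow> real" where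
  "tensor_trace A T p = endo_trace (tangent_space A p) (tensor_at A T p)"

definition ext_deriv ::
    "('a vfield \<Rightarrow> 'a \<Rightarrow> real) \<Rightarrow> 'a vfield \<Rightarrow> 'a vfield \<Rightarrow> 'a \<Rightarrow> real" where
  "ext_deriv \<omega> X Y = (1/2) *\<^sub>R (X (\<omega> Y) - Y (\<omega> X) - \<omega> (lie_bracket X Y))"

definition nijenhuis :: "('a vfield \<Rightarrow> 'a vfield) \<Rightarrow> 'a vfield \<Rightarrow> 'a vfield \<Rightarrow> 'a vfield" where
  "nijenhuis f X Y =
     f (f (lie_bracket X Y)) + lie_bracket (f X) (f Y)
       - f (lie_bracket (f X) Y) - f (lie_bracket X (f Y))"


section \<open>Riemannian geometry\<close>

type_synonym 'a metric = "'a vfield \<Rightarrow> 'a vfield \<Rightarrow> 'a \<Rightarrow> real"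

definition riemannian_metric ::
    "('a, 'e::euclidean_space) chart set \<Rightarrow> 'a metric \<Rightarrow> bool" where
  "riemannian_metric A g \<longleftrightarrow>
     (\<forall>X\<in>vector_fields A. one_form A (g X)) \<and>
     (\<forall>X\<in>vector_fields A. \<forall>Y\<in>vector_fields A. g X Y = g Y X) \<and>
     (\<forall>X\<in>vector_fields A. \<forall>p. value_at X p \<noteq> 0 \<longrightarrow> g X X p > 0)"

definition levi_civita ::
    "('a, 'e::euclidean_space) chart set \<Rightarrow> 'a metric \<Rightarrow>
     ('a vfield \<Rightarrow> 'a vfield \<Rightarrow> 'a vfield) \<Rightarrow> bool" where
  "levi_civita A g N \<longleftrightarrow>
     (\<forall>Y\<in>vector_fields A. tensor11 A (\<lambda>X. N X Y)) \<and>
     (\<forall>X\<in>vector_fields A. \<forall>Y\<in>vector_fields A. \<forall>Z\<in>vector_fields A.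
        N X (Y + Z) = N X Y + N X Z) \<and>
     (\<forall>\<phi>\<in>smooth_functions A. \<forall>X\<in>vector_fields A. \<forall>Y\<in>vector_fields A.
        N X (\<phi> \<star> Y) = X \<phi> \<star> Y + \<phi> \<star> N X Y) \<and>
     (\<forall>X\<in>vector_fields A. \<forall>Y\<in>vector_fields A. N X Y - N Y X = lie_bracket X Y) \<and>
     (\<forall>X\<in>vector_fields A. \<forall>Y\<in>vector_fields A. \<forall>Z\<in>vector_fields A.
        X (g Y Z) = g (N X Y) Z + g Y (N X Z))"

definition curvature ::
    "('a vfield \<Rightarrow> 'a vfield \<Rightarrow> 'a vfield) \<Rightarrow>
     'a vfield \<Rightarrow> 'a vfield \<Rightarrow> 'a vfield \<Rightarrow> 'a vfield" where
  "curvature N X Y Z = N X (N Y Z) - N Y (N X Z) - N (lie_bracket X Y) Z"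

definition ricci ::
    "('a, 'e::euclidean_space) chart set \<Rightarrow> ('a vfield \<Rightarrow> 'a vfield \<Rightarrow> 'a vfield) \<Rightarrow>
     'a vfield \<Rightarrow> 'a vfield \<Rightarrow> 'a \<Rightarrow> real" where
  "ricci A N X Y = tensor_trace A (\<lambda>Z. curvature N Z X Y)"

definition ricci_operator ::
    "('a, 'e::euclidean_space) chart set \<Rightarrow> 'a metric \<Rightarrow>
     ('a vfield \<Rightarrow> 'a vfield \<Rightarrow> 'a vfield) \<Rightarrow> ('a vfield \<Rightarrow> 'a vfield) \<Rightarrow> bool" where
  "ricci_operator A g N S \<longleftrightarrow>
     tensor11 A S \<and>
     (\<forall>X\<in>vector_fields A. \<forall>Y\<in>vector_fields A. g (S X) Y = ricci A N X Y)"

definition star_ricci ::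
    "('a, 'e::euclidean_space) chart set \<Rightarrow> ('a vfield \<Rightarrow> 'a vfield \<Rightarrow> 'a vfield) \<Rightarrow>
     ('a vfield \<Rightarrow> 'a vfield) \<Rightarrow> 'a vfield \<Rightarrow> 'a vfield \<Rightarrow> 'a \<Rightarrow> real" where
  "star_ricci A N f X Y = (1/2) *\<^sub>R tensor_trace A (\<lambda>Z. curvature N X (f Y) (f Z))"

text \<open>
  A local orthonormal basis of the tangent bundle near \<open>p\<close>, each of its members being the
  restriction to a neighbourhood of \<open>p\<close> of a globally defined vector field. Every local
  orthonormal basis has this form after shrinking its domain.
\<close>

definition local_orthonormal_basis ::
    "('a::topological_space, 'e::euclidean_space) chart set \<Rightarrow> 'a metric \<Rightarrow> 'a \<Rightarrow>
     (nat \<Rightarrow> 'a vfield) \<Rightarrow> bool" where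
  "local_orthonormal_basis A g p E \<longleftrightarrow>
     (\<forall>i<DIM('e). E i \<in> vector_fields A) \<and>
     (\<exists>U. open U \<and> p \<in> U \<and>
        (\<forall>q\<in>U. \<forall>i<DIM('e). \<forall>j<DIM('e). g (E i) (E j) q = (if i = j then 1 else 0)))"

definition star_scalar_curvature ::
    "('a::topological_space, 'e::euclidean_space) chart set \<Rightarrow> 'a metric \<Rightarrow>
     ('a vfield \<Rightarrow> 'a vfield \<Rightarrow> 'a vfield) \<Rightarrow> ('a vfield \<Rightarrow> 'a vfield) \<Rightarrow> 'a \<Rightarrow> real" where
  "star_scalar_curvature A g N f p =
     (let E = (SOME E. local_orthonormal_basis A g p E)
      in \<Sum>i<DIM('e). star_ricci A N f (E i) (E i) p)"


section \<open>Weak metric \<open>f\<close>-structures\<close>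

definition weak_metric_f_structure ::
    "('a, 'e::euclidean_space) chart set \<Rightarrow> nat \<Rightarrow> nat \<Rightarrow>
     ('a vfield \<Rightarrow> 'a vfield) \<Rightarrow> ('a vfield \<Rightarrow> 'a vfield) \<Rightarrow>
     (nat \<Rightarrow> 'a vfield) \<Rightarrow> (nat \<Rightarrow> 'a vfield \<Rightarrow> 'a \<Rightarrow> real) \<Rightarrow> 'a metric \<Rightarrow> bool" where
  "weak_metric_f_structure A n s f Q \<xi> \<eta> g \<longleftrightarrow>
     DIM('e) = 2 * n + s \<and> n > 0 \<and> s > 1 \<and>
     riemannian_metric A g \<and>
     tensor11 A f \<and>
     (\<forall>X\<in>vector_fields A. \<forall>Y\<in>vector_fields A. g (f X) Y = - g X (f Y)) \<and>
     (\<forall>p. dim (tensor_at A f p ` tangent_space A p) = 2 * n) \<and>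
     tensor11 A Q \<and>
     (\<forall>X\<in>vector_fields A. \<forall>Y\<in>vector_fields A. g (Q X) Y = g X (Q Y)) \<and>
     (\<forall>p. bij_betw (tensor_at A Q p) (tangent_space A p) (tangent_space A p)) \<and>
     (\<forall>i\<in>{1..s}. \<xi> i \<in> vector_fields A \<and> one_form A (\<eta> i)) \<and>
     (\<forall>i\<in>{1..s}. \<forall>j\<in>{1..s}. g (\<xi> i) (\<xi> j) = (if i = j then 1 else 0)) \<and>
     (\<forall>X\<in>vector_fields A. f (f X) = - Q X + (\<Sum>i\<in>{1..s}. \<eta> i X \<star> \<xi> i)) \<and>
     (\<forall>i\<in>{1..s}. \<forall>j\<in>{1..s}. \<eta> i (\<xi> j) = (if i = j then 1 else 0)) \<and>
     (\<forall>i\<in>{1..s}. Q (\<xi> i) = \<xi> i) \<and>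
     (\<forall>X\<in>vector_fields A. \<forall>Y\<in>vector_fields A.
        g (f X) (f Y) = g X (Q Y) - (\<Sum>i\<in>{1..s}. \<eta> i X * \<eta> i Y))"

definition normal_f_structure ::
    "('a, 'e::euclidean_space) chart set \<Rightarrow> nat \<Rightarrow> ('a vfield \<Rightarrow> 'a vfield) \<Rightarrow>
     (nat \<Rightarrow> 'a vfield) \<Rightarrow> (nat \<Rightarrow> 'a vfield \<Rightarrow> 'a \<Rightarrow> real) \<Rightarrow> bool" where
  "normal_f_structure A s f \<xi> \<eta> \<longleftrightarrow>
     (\<forall>X\<in>vector_fields A. \<forall>Y\<in>vector_fields A.
        nijenhuis f X Y + 2 *\<^sub>R (\<Sum>i\<in>{1..s}. ext_deriv (\<eta> i) X Y \<star> \<xi> i) = 0)"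

definition xi_bar :: "nat \<Rightarrow> (nat \<Rightarrow> 'a vfield) \<Rightarrow> 'a vfield"
  where "xi_bar s \<xi> = (\<Sum>i\<in>{1..s}. \<xi> i)"

definition eta_bar :: "nat \<Rightarrow> (nat \<Rightarrow> 'a vfield \<Rightarrow> 'a \<Rightarrow> real) \<Rightarrow> 'a vfield \<Rightarrow> 'a \<Rightarrow> real"
  where "eta_bar s \<eta> = (\<Sum>i\<in>{1..s}. \<eta> i)"

text \<open>The function \<open>\<beta>\<close> is taken to be constant; \<open>N\<close> stands for the Levi-Civita connection.\<close>

definition weak_beta_f_Kenmotsu ::
    "('a, 'e::euclidean_space) chart set \<Rightarrow> nat \<Rightarrow> nat \<Rightarrow> real \<Rightarrow>
     ('a vfield \<Rightarrow> 'a vfield) \<Rightarrow> ('a vfield \<Rightarrow> 'a vfield) \<Rightarrow>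
     (nat \<Rightarrow> 'a vfield) \<Rightarrow> (nat \<Rightarrow> 'a vfield \<Rightarrow> 'a \<Rightarrow> real) \<Rightarrow> 'a metric \<Rightarrow>
     ('a vfield \<Rightarrow> 'a vfield \<Rightarrow> 'a vfield) \<Rightarrow> bool" where
  "weak_beta_f_Kenmotsu A n s \<beta> f Q \<xi> \<eta> g N \<longleftrightarrow>
     weak_metric_f_structure A n s f Q \<xi> \<eta> g \<and>
     normal_f_structure A s f \<xi> \<eta> \<and>
     levi_civita A g N \<and>
     (\<forall>X\<in>vector_fields A. \<forall>Y\<in>vector_fields A.
        N X (f Y) - f (N X Y) =
          \<beta> *\<^sub>R (g (f X) Y \<star> xi_bar s \<xi> - eta_bar s \<eta> Y \<star> f X))"

end

theory Submission
  imports Defs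
begin

text \<open>
  Writing the \<open>*\<close>-Ricci trace in an orthonormal frame, the first Bianchi identity and the pair symmetry of
  \<open>R\<close> turn it into \<open>Ric\<^sup>*(X,Y) = - trace (Z \<mapsto> f R\<^bsub>Z,X\<^esub> f Y)\<close>. The Ricci identity for \<open>f\<close> moves the
  outer \<open>f\<close> inside, where \<open>f\<^sup>2 = - Q + \<Sum> \<eta>\<^sup>i \<otimes> \<xi>\<^sub>i\<close> produces \<open>Ric(X, QY)\<close>, the terms \<open>Ric(X, \<xi>\<^sub>i)\<close> and the
  trace of the commutator. Both extra terms are explicit: the Kenmotsu equation gives
  \<open>\<nabla>\<^sub>X \<xi>\<^sub>i = \<beta> (X - \<Sum> \<eta>\<^sup>j(X) \<xi>\<^sub>j)\<close>, where normality enters through \<open>d\<eta>\<^sup>i = 0\<close>, which kills the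
  components \<open>g(\<nabla>\<^sub>X \<xi>\<^sub>i, \<xi>\<^sub>j)\<close>.

  Since vector fields are global derivations and traces are taken pointwise, one also needs that
  \<open>C\<^sup>\<infinity>\<close>-linear maps act pointwise, that the derivations at a point form a space of dimension
  \<open>DIM('e)\<close>, and that local orthonormal frames exist. These rest on Hadamard's lemma and bump
  functions.
\<close>

section \<open>Smooth functions on Euclidean spaces\<close>

text \<open>The factor one half in the star-Ricci tensor is absorbed because the first Bianchi
  identity splits its integrand into two terms of equal trace. Let P be the orthogonal projection
  onto the span of the fields \<open>\<xi> i\<close> and G = g(fX, fY) = g(QX, Y) - g(PX, Y). The
  commutator term then traces to \<beta>^2 G (s + s (2n - 2)): the first s is the squared length of
  the sum of the \<open>\<xi> i\<close>, 2n is the trace of id - P, and -2 comes from two terms that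
  contract to -G each. The summand 2n of the formula comes from Ric(X, \<xi>_j), which is -2n
  \<beta>^2 times the sum of the \<eta>^i(X).

  The obstacle is that nothing is known about the covariant derivative of Q. It is therefore never
  differentiated: Q enters only algebraically, through f^2 = P - Q, its self-adjointness, its
  invertibility and its fixed vectors \<open>\<xi> i\<close>.\<close>

lemma Ck_on_SucD:
  assumes "Ck_on (Suc k) h S" "open S" "x \<in> S"
  shows "(h has_derivative frechet_derivative h (at x)) (at x)"
  using assms by (auto simp: differentiable_on_eq_differentiable_at frechet_derivative_works)

text \<open>On an open set equal functions have equal derivatives, so the induction can pass to the
  directional derivatives.\<close>

lemma Ck_on_cong:
  assumes "Ck_on k f S" "open S" "\<And>x. x \<in> S \<Longrightarrow> f x = g x"
  shows "Ck_on k g S"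
  using assms
proof (induction k arbitrary: f g)
  case 0
  then show ?case by (auto cong: continuous_on_cong)
next
  case (Suc k)
  have D: "(g has_derivative frechet_derivative f (at x)) (at x)" if "x \<in> S" for x
    using Suc.prems(3)
    by (rule has_derivative_transform_within_open[OF Ck_on_SucD[OF Suc.prems(1,2) that] Suc.prems(2) that])
  have "Ck_on k (\<lambda>x. frechet_derivative g (at x) v) S" for v
  proof (rule Suc.IH[OF _ Suc.prems(2)])
    show "Ck_on k (\<lambda>x. frechet_derivative f (at x) v) S"
      using Suc.prems(1) by simp
    show "frechet_derivative f (at x) v = frechet_derivative g (at x) v" if "x \<in> S" for x
      using frechet_derivative_at[OF D[OF that]] by simp
  qed
  then show ?case
    using D Suc.prems by (auto simp: differentiable_on_eq_differentiable_at differentiable_def)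
qed

text \<open>Uniqueness of derivatives on an open set lets an explicit family \<open>h'\<close> stand
  in for \<open>frechet_derivative\<close>. Most inductions on the order of smoothness rely on this
  rule.\<close>

lemma Ck_on_SucI:
  assumes "open S" "\<And>x. x \<in> S \<Longrightarrow> (h has_derivative h' x) (at x)" "\<And>v. Ck_on k (\<lambda>x. h' x v) S"
  shows "Ck_on (Suc k) h S"
proof -
  have "frechet_derivative h (at x) = h' x" if "x \<in> S" for x
    using frechet_derivative_at[OF assms(2)[OF that]] by simp
  then have "Ck_on k (\<lambda>x. frechet_derivative h (at x) v) S" for v
    using assms(1) by (intro Ck_on_cong[OF assms(3)]) auto
  then show ?thesis
    using assms(1,2) by (auto simp: differentiable_on_eq_differentiable_at differentiable_def)
qed

lemma Ck_on_subset:
  assumes "Ck_on k h S" "T \<subseteq> S"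
  shows "Ck_on k h T"
  using assms
  by (induction k arbitrary: h) (auto intro: continuous_on_subset differentiable_on_subset)

lemma Ck_on_Suc_imp:
  assumes "Ck_on (Suc k) h S"
  shows "Ck_on k h S"
  using assms
proof (induction k arbitrary: h)
  case 0
  then show ?case by (auto simp: differentiable_imp_continuous_on)
next
  case (Suc k)
  from Suc.prems have "h differentiable_on S"
    and "\<And>v. Ck_on (Suc k) (\<lambda>x. frechet_derivative h (at x) v) S" by auto
  with Suc.IH show ?case by auto
qed

lemma Ck_on_const: "open S \<Longrightarrow> Ck_on k (\<lambda>x. c) S"
proof (induction k arbitrary: c)
  case (Suc k)
  then show ?case by (intro Ck_on_SucI[where h'="\<lambda>x v. 0"]) auto
qed simp

lemma Ck_on_bounded_linear:
  assumes "bounded_linear L" "open S" "Ck_on k h S"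
  shows "Ck_on k (\<lambda>x. L (h x)) S"
  using assms(3)
proof (induction k arbitrary: h)
  case 0
  then show ?case using assms(1) by (auto intro: bounded_linear.continuous_on)
next
  case (Suc k)
  then have "\<And>v. Ck_on k (\<lambda>x. frechet_derivative h (at x) v) S" by auto
  with Suc.IH show ?case
    using assms Suc.prems
    by (intro Ck_on_SucI[where h'="\<lambda>x v. L (frechet_derivative h (at x) v)"])
       (auto intro!: bounded_linear.has_derivative[OF assms(1)] Ck_on_SucD)
qed

lemma Ck_on_id: "open S \<Longrightarrow> Ck_on k (\<lambda>x. x) S"
proof (cases k)
  case (Suc j)
  assume "open S"
  then show ?thesis unfolding Suc
    by (intro Ck_on_SucI[where h'="\<lambda>x v. v"]) (auto intro: Ck_on_const)
qed simp

lemma Ck_on_add: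
  assumes "open S" "Ck_on k f S" "Ck_on k g S"
  shows "Ck_on k (\<lambda>x. f x + g x) S"
  using assms(2,3)
proof (induction k arbitrary: f g)
  case 0
  then show ?case by (auto intro: continuous_intros)
next
  case (Suc k)
  then have "\<And>v. Ck_on k (\<lambda>x. frechet_derivative f (at x) v) S"
     "\<And>v. Ck_on k (\<lambda>x. frechet_derivative g (at x) v) S" by auto
  with Suc.IH show ?case
    using assms(1) Suc.prems
    by (intro Ck_on_SucI[where h'="\<lambda>x v. frechet_derivative f (at x) v + frechet_derivative g (at x) v"])
       (auto intro!: has_derivative_add Ck_on_SucD)
qed

lemma Ck_on_sum:
  assumes "open S" "\<And>i. i \<in> I \<Longrightarrow> Ck_on k (f i) S"
  shows "Ck_on k (\<lambda>x. \<Sum>i\<in>I. f i x) S"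
  using assms(2)
  by (induction I rule: infinite_finite_induct) (auto intro: Ck_on_const Ck_on_add assms(1))

lemma Ck_on_mult:
  fixes f g :: "'e::euclidean_space \<Rightarrow> real"
  assumes "open S" "Ck_on k f S" "Ck_on k g S"
  shows "Ck_on k (\<lambda>x. f x * g x) S"
  using assms(2,3)
proof (induction k arbitrary: f g)
  case 0
  then show ?case by (auto intro: continuous_intros)
next
  case (Suc k)
  then have "\<And>v. Ck_on k (\<lambda>x. frechet_derivative f (at x) v) S"
     "\<And>v. Ck_on k (\<lambda>x. frechet_derivative g (at x) v) S" by auto
  \<comment> \<open>The Leibniz rule leaves \<open>f\<close> and \<open>g\<close> undifferentiated
    in its summands, so their order has to be lowered to \<open>k\<close> before the induction
    hypothesis applies.\<close>
  with Suc.IH Suc.prems[THEN Ck_on_Suc_imp] show ?case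
    using assms(1) Suc.prems
    by (intro Ck_on_SucI[where h'="\<lambda>x v. f x * frechet_derivative g (at x) v + frechet_derivative f (at x) v * g x"])
       (auto intro!: has_derivative_mult Ck_on_SucD Ck_on_add)
qed

lemma Ck_on_local:
  assumes "open S" "\<And>x. x \<in> S \<Longrightarrow> \<exists>T. open T \<and> x \<in> T \<and> Ck_on k h T"
  shows "Ck_on k h S"
  using assms(2)
proof (induction k arbitrary: h)
  case 0
  then show ?case
    by (fastforce simp: continuous_on_eq_continuous_at intro!: continuous_at_imp_continuous_on)
next
  case (Suc k)
  have "(h has_derivative frechet_derivative h (at x)) (at x)" if "x \<in> S" for x
    using Suc.prems[OF that] Ck_on_SucD by blast
  moreover have "Ck_on k (\<lambda>x. frechet_derivative h (at x) v) S" for v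
    by (rule Suc.IH) (use Suc.prems in fastforce)
  ultimately show ?case
    by (intro Ck_on_SucI[OF assms(1)])
qed

text \<open>By the chain rule a directional derivative of the composition is a sum of products of a
  component of the derivative of \<open>\<tau>\<close> and a partial derivative of \<open>h\<close>
  composed with \<open>\<tau>\<close>. With \<open>Cinf_on\<close> as hypothesis these partial
  derivatives satisfy the same assumption as \<open>h\<close>, which makes the induction go
  through.\<close>

lemma Ck_on_compose:
  fixes \<tau> :: "'e::euclidean_space \<Rightarrow> 'f::euclidean_space" and h :: "'f \<Rightarrow> real"
  assumes "open S" "open T" "\<tau> ` S \<subseteq> T" "Cinf_on h T" "Cinf_on \<tau> S"
  shows "Ck_on k (\<lambda>x. h (\<tau> x)) S"
  using assms(4)
proof (induction k arbitrary: h)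
  case 0
  have "continuous_on T h" "continuous_on S \<tau>"
    using 0 assms(5) by (metis Cinf_on_def Ck_on.simps(1))+
  then show ?case
    using assms(3) by (auto intro: continuous_on_compose2)
next
  case (Suc k)
  have \<tau>: "(\<tau> has_derivative frechet_derivative \<tau> (at x)) (at x)" if "x \<in> S" for x
    using Ck_on_SucD[of 0] assms(1,5) that unfolding Cinf_on_def by blast
  have h: "(h has_derivative frechet_derivative h (at x)) (at x)" if "x \<in> T" for x
    using Ck_on_SucD[of 0] assms(2) Suc.prems that unfolding Cinf_on_def by blast
  \<comment> \<open>The direction in which \<open>h\<close> is differentiated varies with
    \<open>x\<close>. Expanding it over \<open>Basis\<close> leaves only fixed directions
    \<open>i\<close>, the form in which \<open>Ck_on\<close> speaks about derivatives.\<close>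
  define h' where "h' x v = (\<Sum>i\<in>Basis. (frechet_derivative \<tau> (at x) v \<bullet> i) *
      frechet_derivative h (at (\<tau> x)) i)" for x v
  have "((\<lambda>x. h (\<tau> x)) has_derivative h' x) (at x)" if "x \<in> S" for x
  proof -
    have "\<tau> x \<in> T" using that assms(3) by auto
    note d = h[OF this]
    interpret linear "frechet_derivative h (at (\<tau> x))"
      using d has_derivative_linear by blast
    have "frechet_derivative h (at (\<tau> x)) (frechet_derivative \<tau> (at x) v) = h' x v" for v
      unfolding h'_def
      by (subst euclidean_representation[symmetric, of "frechet_derivative \<tau> (at x) v"])
         (simp add: sum scale)
    then show ?thesis
      using has_derivative_compose[OF \<tau>[OF that] d] by simp
  qed
  moreover have "Ck_on k (\<lambda>x. h' x v) S" for v
    unfolding h'_def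
  proof (intro Ck_on_sum Ck_on_mult assms(1))
    fix i :: 'f
    have "Ck_on k (\<lambda>x. frechet_derivative \<tau> (at x) v) S"
      using assms(5) unfolding Cinf_on_def by (metis Ck_on.simps(2))
    from Ck_on_bounded_linear[OF bounded_linear_inner_left assms(1) this]
    show "Ck_on k (\<lambda>x. frechet_derivative \<tau> (at x) v \<bullet> i) S" .
    have "Cinf_on (\<lambda>x. frechet_derivative h (at x) i) T"
      using Suc.prems unfolding Cinf_on_def by (metis Ck_on.simps(2))
    from Suc.IH[OF this] show "Ck_on k (\<lambda>x. frechet_derivative h (at (\<tau> x)) i) S" .
  qed
  ultimately show ?case
    by (intro Ck_on_SucI[OF assms(1)])
qed

lemma Cinf_on_compose:
  fixes \<tau> :: "'e::euclidean_space \<Rightarrow> 'f::euclidean_space" and h :: "'f \<Rightarrow> real"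
  assumes "open S" "open T" "\<tau> ` S \<subseteq> T" "Cinf_on h T" "Cinf_on \<tau> S"
  shows "Cinf_on (\<lambda>x. h (\<tau> x)) S"
  using Ck_on_compose[OF assms] by (auto simp: Cinf_on_def)

lemma Cinf_on_deriv:
  "Cinf_on h S \<Longrightarrow> Cinf_on (\<lambda>x. frechet_derivative h (at x) v) S"
  unfolding Cinf_on_def by (metis Ck_on.simps(2))

lemma Cinf_on_has_derivative:
  "Cinf_on h S \<Longrightarrow> open S \<Longrightarrow> x \<in> S \<Longrightarrow> (h has_derivative frechet_derivative h (at x)) (at x)"
  unfolding Cinf_on_def using Ck_on_SucD by blast

text \<open>The multiples \<open>c * x powr a\<close> form a family closed under differentiation,
  hence the generalization over \<open>c\<close> and \<open>a\<close>; the direction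
  \<open>v\<close> is absorbed into the factor \<open>c\<close>.\<close>

lemma Cinf_on_powr: "Cinf_on (\<lambda>x::real. x powr a) {0<..}"
proof -
  have "Ck_on k (\<lambda>x. c * x powr a) {0<..}" for k and c a :: real
  proof (induction k arbitrary: a c)
    case 0
    then show ?case by (auto intro!: continuous_intros)
  next
    case (Suc k)
    show ?case
    proof (intro Ck_on_SucI[where h'="\<lambda>x v. (v * c * a) * x powr (a - 1)"] Suc.IH)
      show "((\<lambda>x. c * x powr a) has_derivative (\<lambda>v. (v * c * a) * x powr (a - 1))) (at x)"
        if "x \<in> {0<..}" for x
        using that by (auto intro!: derivative_eq_intros simp: fun_eq_iff powr_diff)
    qed auto
  qed
  from this[of _ 1] show ?thesis by (simp add: Cinf_on_def)
qed

section \<open>A smooth cut-off function on the real line\<close>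

definition flat :: "real \<Rightarrow> real"
  where "flat x = (if x > 0 then exp (- (1 / x)) else 0)"

lemma flat_nonneg: "flat x \<ge> 0" and flat_pos: "x > 0 \<Longrightarrow> flat x > 0" and flat_0: "x \<le> 0 \<Longrightarrow> flat x = 0"
  by (auto simp: flat_def)

text \<open>The products of \<open>flat\<close> with powers of 1/x, extended by 0, are closed under
  differentiation: the derivative of \<open>F m\<close> is \<open>F (m + 2) - m * F (m + 1)\<close>.
  All of them tend to 0 at the origin, because the exponential beats every power.\<close>

lemma Cinf_on_flat: "Cinf_on flat UNIV"
proof -
  define F where "F m x = (if x > 0 then exp (- (1 / x)) * (1 / x) ^ m else 0)" for m :: nat and x :: real
  have lim: "(F m \<longlongrightarrow> 0) (at 0)" for m
  proof -
    have "((\<lambda>x::real. exp (- (1 / x)) * (1 / x) ^ m) \<longlongrightarrow> 0) (at_right 0)"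
      by (rule filterlim_compose[OF _ filterlim_inverse_at_top_right, of "\<lambda>x. exp (- x) * x ^ m" , simplified field_class.field_inverse_zero inverse_eq_divide])
         (use tendsto_power_div_exp_0[of m] in \<open>simp add: exp_minus field_simps\<close>)
    then have "(F m \<longlongrightarrow> 0) (at_right 0)"
      by (rule Lim_transform_eventually) (auto simp: F_def eventually_at_right_less eventually_at_filter)
    moreover have "(F m \<longlongrightarrow> 0) (at_left 0)"
      by (rule Lim_transform_eventually[of "\<lambda>_. 0"]) (auto simp: F_def eventually_at_filter)
    ultimately show ?thesis by (simp add: filterlim_split_at)
  qed
  have der: "(F m has_real_derivative F (m + 2) x - m * F (m + 1) x) (at x)" for m x
  proof -
    consider "x < 0" | "x = 0" | "x > 0" by linarith
    then show ?thesis
    proof cases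
      case 1
      have "((\<lambda>_. 0) has_real_derivative 0) (at x)" by simp
      then show ?thesis
        using 1 by (subst DERIV_cong_ev[where g="\<lambda>_. 0", OF refl _ refl])
          (auto simp: F_def eventually_nhds intro!: exI[of _ "{..<0}"])
    next
      case 2
      \<comment> \<open>The difference quotient of \<open>F m\<close> at the origin is
        \<open>F (Suc m)\<close>, so the limit for the next index gives derivative 0 there.\<close>
      have "((\<lambda>h. (F m (0 + h) - F m 0) / h) \<longlongrightarrow> 0) (at 0)"
        by (rule Lim_transform_eventually[OF lim[of "Suc m"]]) (auto simp: F_def eventually_at_filter)
      then show ?thesis
        unfolding 2 has_field_derivative_def[symmetric] DERIV_def by (simp add: F_def)
    next
      case 3
      have pw: "x ^ j = x * x ^ (j - Suc 0)" if "j \<noteq> 0" for j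
        using that by (cases j) auto
      have "((\<lambda>x. exp (- (1 / x)) * (1 / x) ^ m) has_real_derivative F (m + 2) x - m * F (m + 1) x) (at x)"
        using 3 pw by (cases m; cases "m - 1")
          (force intro!: derivative_eq_intros simp: F_def field_simps power2_eq_square)+
      then show ?thesis
        using 3 by (subst DERIV_cong_ev[where g="\<lambda>x. exp (- (1 / x)) * (1 / x) ^ m", OF refl _ refl])
          (auto simp: F_def eventually_nhds intro!: exI[of _ "{0<..}"])
    qed
  qed
  have "Ck_on k (F m) UNIV" for k m
  proof (induction k arbitrary: m)
    case 0
    then show ?case
      by (auto intro!: continuous_at_imp_continuous_on DERIV_isCont[OF der])
  next
    case (Suc k)
    have "Ck_on k (\<lambda>x. (F (m + 2) x + (- real m) * F (m + 1) x) * v) UNIV" for v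
      by (intro Ck_on_mult Ck_on_add Ck_on_const Suc.IH) auto
    then show ?case
      using der by (intro Ck_on_SucI[where h'="\<lambda>x v. (F (m + 2) x - m * F (m + 1) x) * v"])
        (auto simp: has_field_derivative_def)
  qed
  moreover have "F 0 = flat" by (auto simp: flat_def F_def)
  ultimately show ?thesis unfolding Cinf_on_def by metis
qed

section \<open>Hadamard's lemma\<close>

lemma Cinf_on_parameter_integral:
  fixes F :: "'e::euclidean_space \<Rightarrow> real"
  assumes "open S" "convex S" "a \<in> S" "Cinf_on F S"
  shows "Cinf_on (\<lambda>x. integral {0..1} (\<lambda>t. F (a + t *\<^sub>R (x - a)))) S"
proof -
  have inS: "a + t *\<^sub>R (x - a) \<in> S" if "x \<in> S" "t \<in> {0..1}" for x t
  proof -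
    have "(1 - t) *\<^sub>R a + t *\<^sub>R x \<in> S"
      using assms(2,3) that by (auto simp: convex_alt)
    then show ?thesis by (simp add: algebra_simps)
  qed
  have line: "continuous_on (S \<times> cbox 0 1) (\<lambda>y. a + snd y *\<^sub>R (fst y - a))"
    by (intro continuous_intros)
  \<comment> \<open>Differentiating under the integral sign brings out a factor \<open>t\<close>.
    The weight \<open>t ^ m\<close> collects these factors, so that a derivative of
    \<open>I G m\<close> is again of the form \<open>I\<close> with a partial derivative of
    \<open>G\<close> and exponent \<open>Suc m\<close>.\<close>
  define I where "I G m x = integral (cbox 0 1) (\<lambda>t. t ^ m * G (a + t *\<^sub>R (x - a)))" for G m and x :: 'e
  \<comment> \<open>This is the gradient. It turns the derivative of the integrand into an inner
    product with a continuously varying vector, hence into a \<open>blinfun\<close>, as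
    \<open>leibniz_rule\<close> requires.\<close>
  define D where "D G x = (\<Sum>i\<in>Basis. frechet_derivative G (at x) i *\<^sub>R i)" for G :: "'e \<Rightarrow> real" and x :: 'e
  have D: "D G x \<bullet> v = frechet_derivative G (at x) v" if "Cinf_on G S" "x \<in> S" for G x v
  proof -
    interpret linear "frechet_derivative G (at x)"
      using Cinf_on_has_derivative[OF that(1) assms(1) that(2)] has_derivative_linear by blast
    show ?thesis
      by (subst (2) euclidean_representation[symmetric, of v])
        (simp add: D_def sum scale inner_sum_left inner_sum_right inner_commute mult.commute)
  qed
  have cont: "continuous_on (S \<times> cbox 0 1) (\<lambda>(x, t). t ^ m * G (a + t *\<^sub>R (x - a)))"
    if "continuous_on S G" for G :: "'e \<Rightarrow> real" and m
    unfolding split_beta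
    by (intro continuous_intros continuous_on_compose2[OF that line]) (use inS in auto)
  have cont1: "continuous_on (cbox 0 1) (\<lambda>t. t ^ m * G (a + t *\<^sub>R (x - a)))"
    if "continuous_on S G" "x \<in> S" for G :: "'e \<Rightarrow> real" and m x
    by (intro continuous_intros continuous_on_compose2[OF that(1)]) (use inS that in auto)
  have contG: "continuous_on S G" if "Cinf_on G S" for G :: "'e \<Rightarrow> real"
    using that by (metis Cinf_on_def Ck_on.simps(1))
  have der: "(I G m has_derivative (\<lambda>v. I (\<lambda>y. frechet_derivative G (at y) v) (Suc m) x)) (at x)"
    if G: "Cinf_on G S" and x: "x \<in> S" for G m x
  proof -
    let ?fx = "\<lambda>x t. blinfun_inner_left (t ^ Suc m *\<^sub>R D G (a + t *\<^sub>R (x - a)))"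
    have contD: "continuous_on S (D G)"
      unfolding D_def by (intro continuous_intros contG Cinf_on_deriv G)
    have cfx: "continuous_on (S \<times> cbox 0 1) (\<lambda>(x, t). ?fx x t)"
      unfolding split_beta
      by (intro bounded_linear.continuous_on[OF bounded_linear_blinfun_inner_left] continuous_intros
            continuous_on_compose2[OF contD line]) (use inS in auto)
    have cfx1: "continuous_on (cbox 0 1) (?fx x)"
      by (intro bounded_linear.continuous_on[OF bounded_linear_blinfun_inner_left] continuous_intros
            continuous_on_compose2[OF contD]) (use inS x in auto)
    have "(I G m has_derivative integral (cbox 0 1) (?fx x)) (at x within S)"
      unfolding I_def
    proof (rule leibniz_rule[OF _ _ cfx x assms(2)])
      fix y t assume y: "y \<in> S" and t: "t \<in> cbox 0 (1::real)"
      note d = Cinf_on_has_derivative[OF G assms(1) inS[OF y t[unfolded cbox_interval]]]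
      interpret linear "frechet_derivative G (at (a + t *\<^sub>R (y - a)))"
        using d has_derivative_linear by blast
      have "((\<lambda>y. a + t *\<^sub>R (y - a)) has_derivative (\<lambda>v. t *\<^sub>R v)) (at y)"
        by (auto intro!: derivative_eq_intros)
      from has_derivative_compose[OF this d]
      have "((\<lambda>y. t ^ m * G (a + t *\<^sub>R (y - a))) has_derivative
          (\<lambda>v. t ^ m * frechet_derivative G (at (a + t *\<^sub>R (y - a))) (t *\<^sub>R v))) (at y)"
        by (rule has_derivative_mult_right)
      moreover have "(\<lambda>v. t ^ m * frechet_derivative G (at (a + t *\<^sub>R (y - a))) (t *\<^sub>R v)) = ?fx y t"
        using D[OF G inS[OF y t[unfolded cbox_interval]]]
        by (auto simp: fun_eq_iff scale inner_commute)
      ultimately show "((\<lambda>y. t ^ m * G (a + t *\<^sub>R (y - a))) has_derivative ?fx y t) (at y within S)"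
        using has_derivative_at_withinI by fastforce
    next
      fix y assume "y \<in> S"
      then show "(\<lambda>t. t ^ m * G (a + t *\<^sub>R (y - a))) integrable_on cbox 0 1"
        by (intro integrable_continuous cont1 contG G)
    qed
    then have "(I G m has_derivative integral (cbox 0 1) (?fx x)) (at x)"
      using assms(1) x at_within_open by metis
    moreover have "blinfun_apply (integral (cbox 0 1) (?fx x)) =
        (\<lambda>v. I (\<lambda>y. frechet_derivative G (at y) v) (Suc m) x)"
    proof (rule ext)
      fix v
      have "blinfun_apply (integral (cbox 0 1) (?fx x)) v = integral (cbox 0 1) (\<lambda>t. blinfun_apply (?fx x t) v)"
        using integral_linear[OF integrable_continuous[OF cfx1] blinfun.bounded_linear_left, of v]
        by (simp add: o_def)
      also have "\<dots> = I (\<lambda>y. frechet_derivative G (at y) v) (Suc m) x"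
        unfolding I_def
        by (rule integral_cong) (use D[OF G inS[OF x]] in \<open>auto simp: inner_commute\<close>)
      finally show "blinfun_apply (integral (cbox 0 1) (?fx x)) v =
          I (\<lambda>y. frechet_derivative G (at y) v) (Suc m) x" .
    qed
    ultimately show ?thesis by simp
  qed
  have "Ck_on k (I G m) S" if "Cinf_on G S" for k G m
    using that
  proof (induction k arbitrary: G m)
    case 0
    have "isCont (I G m) x" if "x \<in> S" for x
      using has_derivative_continuous[OF der[OF 0 that]] .
    then show ?case by (auto intro!: continuous_at_imp_continuous_on)
  next
    case (Suc k)
    show ?case
      by (rule Ck_on_SucI[OF assms(1) der[OF Suc.prems] Suc.IH[OF Cinf_on_deriv[OF Suc.prems]]])
  qed
  from this[OF assms(4), of _ 0] show ?thesis
    unfolding I_def Cinf_on_def by simp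
qed

text \<open>The quotients \<open>G i\<close> are \<open>\<integral>\<^sub>0\<^sup>1 \<partial>\<^sub>i F (a + t (x - a)) dt\<close>.\<close>

lemma Hadamard:
  fixes F :: "'e::euclidean_space \<Rightarrow> real"
  assumes "open S" "convex S" "a \<in> S" "Cinf_on F S"
  obtains G where "\<And>i. Cinf_on (G i) S"
    and "\<And>x. x \<in> S \<Longrightarrow> F x - F a = (\<Sum>i\<in>Basis. ((x - a) \<bullet> i) * G i x)"
    and "\<And>i. G i a = frechet_derivative F (at a) i"
proof
  let ?G = "\<lambda>i x. integral {0..1} (\<lambda>t. frechet_derivative F (at (a + t *\<^sub>R (x - a))) i)"
  show "Cinf_on (?G i) S" for i
    by (intro Cinf_on_parameter_integral assms Cinf_on_deriv)
  show "?G i a = frechet_derivative F (at a) i" for i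
    by simp
  fix x assume x: "x \<in> S"
  have inS: "a + t *\<^sub>R (x - a) \<in> S" if "t \<in> {0..1}" for t
  proof -
    have "(1 - t) *\<^sub>R a + t *\<^sub>R x \<in> S"
      using assms(2,3) that x by (auto simp: convex_alt)
    then show ?thesis by (simp add: algebra_simps)
  qed
  have cont: "continuous_on {0..1} (\<lambda>t. frechet_derivative F (at (a + t *\<^sub>R (x - a))) i)" for i
  proof (rule continuous_on_compose2[of S])
    show "continuous_on S (\<lambda>y. frechet_derivative F (at y) i)"
      using Cinf_on_deriv[OF assms(4)] by (metis Cinf_on_def Ck_on.simps(1))
  qed (use inS in \<open>auto intro!: continuous_intros\<close>)
  have lin: "frechet_derivative F (at (a + t *\<^sub>R (x - a))) (x - a) =
      (\<Sum>i\<in>Basis. ((x - a) \<bullet> i) * frechet_derivative F (at (a + t *\<^sub>R (x - a))) i)"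
    if "t \<in> {0..1}" for t
  proof -
    interpret linear "frechet_derivative F (at (a + t *\<^sub>R (x - a)))"
      using Cinf_on_has_derivative[OF assms(4,1) inS[OF that]] has_derivative_linear by blast
    show ?thesis
      by (subst (2) euclidean_representation[symmetric, of "x - a"]) (simp only: sum scale real_scaleR_def)
  qed
  have "((\<lambda>t. F (a + t *\<^sub>R (x - a))) has_vector_derivative
      frechet_derivative F (at (a + t *\<^sub>R (x - a))) (x - a)) (at t within {0..1})"
    if "t \<in> {0..1}" for t
  proof -
    note d = Cinf_on_has_derivative[OF assms(4,1) inS[OF that]]
    interpret linear "frechet_derivative F (at (a + t *\<^sub>R (x - a)))"
      using d has_derivative_linear by blast
    have "((\<lambda>t. a + t *\<^sub>R (x - a)) has_derivative (\<lambda>s. s *\<^sub>R (x - a))) (at t)"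
      by (auto intro!: derivative_eq_intros)
    from has_derivative_compose[OF this d] show ?thesis
      by (auto simp: has_vector_derivative_def scale intro: has_derivative_at_withinI)
  qed
  then have "((\<lambda>t. frechet_derivative F (at (a + t *\<^sub>R (x - a))) (x - a)) has_integral
      F (a + 1 *\<^sub>R (x - a)) - F (a + 0 *\<^sub>R (x - a))) {0..1}"
    by (intro fundamental_theorem_of_calculus) auto
  then have "F x - F a = integral {0..1} (\<lambda>t. frechet_derivative F (at (a + t *\<^sub>R (x - a))) (x - a))"
    by (simp add: integral_unique)
  also have "\<dots> = integral {0..1} (\<lambda>t. \<Sum>i\<in>Basis. ((x - a) \<bullet> i) *
      frechet_derivative F (at (a + t *\<^sub>R (x - a))) i)"
    by (rule integral_cong) (rule lin)
  also have "\<dots> = (\<Sum>i\<in>Basis. ((x - a) \<bullet> i) * ?G i x)"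
    using cont by (subst integral_sum) (auto intro!: integrable_continuous_interval continuous_intros)
  finally show "F x - F a = (\<Sum>i\<in>Basis. ((x - a) \<bullet> i) * ?G i x)" .
qed

section \<open>Smooth functions and tangent vectors on manifolds\<close>

lemma scaleR_fun_apply [simp]: "(r *\<^sub>R f) x = r *\<^sub>R f x"
  by (simp add: scaleR_fun_def)

lemma sum_fun_apply [simp]: "(\<Sum>i\<in>I. f i) x = (\<Sum>i\<in>I. f i x)"
  by (induction I rule: infinite_finite_induct) auto

locale manifold =
  fixes A :: "('a::{t2_space, second_countable_topology}, 'e::euclidean_space) chart set"
  assumes smooth_manifold: "smooth_manifold A"
begin

abbreviation "SF \<equiv> smooth_functions A"
abbreviation "VF \<equiv> vector_fields A"

lemma chart:
  assumes "(U, \<phi>) \<in> A"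
  shows "open U" "open (\<phi> ` U)" "homeomorphism U (\<phi> ` U) \<phi> (inv_into U \<phi>)"
    "continuous_on U \<phi>" "inj_on \<phi> U"
    "continuous_on (\<phi> ` U) (inv_into U \<phi>)"
proof -
  show *: "open U" "open (\<phi> ` U)" "homeomorphism U (\<phi> ` U) \<phi> (inv_into U \<phi>)"
    using smooth_manifold assms unfolding smooth_manifold_def by auto
  show "continuous_on U \<phi>" "continuous_on (\<phi> ` U) (inv_into U \<phi>)" "inj_on \<phi> U"
    using *(3) unfolding homeomorphism_def by (auto intro: inj_on_inverseI)
qed

lemma inv_chart: "(U, \<phi>) \<in> A \<Longrightarrow> q \<in> U \<Longrightarrow> inv_into U \<phi> (\<phi> q) = q"
  by (simp add: chart inv_into_f_f)

lemma chart_open_image: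
  assumes "(U, \<phi>) \<in> A" "open W" "W \<subseteq> U"
  shows "open (\<phi> ` W)"
proof -
  have "openin (top_of_set (\<phi> ` U)) (\<phi> ` W)"
    by (rule homeomorphism_imp_open_map[OF chart(3)[OF assms(1)] open_subset[OF assms(3,2)]])
  then show ?thesis
    using chart(2)[OF assms(1)] openin_open_trans by blast
qed

lemma chart_exists: obtains U \<phi> where "(U, \<phi>) \<in> A" "p \<in> U"
proof -
  have "p \<in> (\<Union>(U, \<phi>)\<in>A. U)"
    using smooth_manifold unfolding smooth_manifold_def by simp
  then show thesis using that by auto
qed

lemma transition_smooth:
  "(U, \<phi>) \<in> A \<Longrightarrow> (V, \<psi>) \<in> A \<Longrightarrow> Cinf_on (\<psi> \<circ> inv_into U \<phi>) (\<phi> ` (U \<inter> V))"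
  using smooth_manifold unfolding smooth_manifold_def by fast

lemma SF_I: "(\<And>U \<phi> k. (U, \<phi>) \<in> A \<Longrightarrow> Ck_on k (\<lambda>x. h (inv_into U \<phi> x)) (\<phi> ` U)) \<Longrightarrow> h \<in> SF"
  by (auto simp: smooth_functions_def Cinf_on_def o_def)

lemma SF_D: "h \<in> SF \<Longrightarrow> (U, \<phi>) \<in> A \<Longrightarrow> Ck_on k (\<lambda>x. h (inv_into U \<phi> x)) (\<phi> ` U)"
  by (auto simp: smooth_functions_def Cinf_on_def o_def)

lemma SF_D_Cinf: "h \<in> SF \<Longrightarrow> (U, \<phi>) \<in> A \<Longrightarrow> Cinf_on (\<lambda>x. h (inv_into U \<phi> x)) (\<phi> ` U)"
  by (auto simp: Cinf_on_def dest: SF_D)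

lemma SF_const: "(\<lambda>_. c) \<in> SF"
  by (rule SF_I) (auto intro!: Ck_on_const chart(2))

lemma SF_zero: "0 \<in> SF" and SF_one: "1 \<in> SF"
  unfolding zero_fun_def one_fun_def by (rule SF_const)+

lemma SF_add: "h \<in> SF \<Longrightarrow> k \<in> SF \<Longrightarrow> h + k \<in> SF"
  unfolding plus_fun_def by (rule SF_I, rule Ck_on_add) (auto intro: SF_D chart(2))

lemma SF_mult: "h \<in> SF \<Longrightarrow> k \<in> SF \<Longrightarrow> h * k \<in> SF"
  unfolding times_fun_def by (rule SF_I, rule Ck_on_mult) (auto intro: SF_D chart(2))

lemma SF_scaleR: "h \<in> SF \<Longrightarrow> c *\<^sub>R h \<in> SF"
  using SF_mult[OF SF_const[of c]] by (simp add: times_fun_def scaleR_fun_def)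

lemma SF_uminus: "h \<in> SF \<Longrightarrow> - h \<in> SF"
  using SF_scaleR[of h "- 1"] by simp

lemma SF_diff: "h \<in> SF \<Longrightarrow> k \<in> SF \<Longrightarrow> h - k \<in> SF"
  using SF_add[of h "- k"] SF_uminus[of k] by simp

lemma SF_sum: "(\<And>i. i \<in> I \<Longrightarrow> h i \<in> SF) \<Longrightarrow> (\<Sum>i\<in>I. h i) \<in> SF"
  by (induction I rule: infinite_finite_induct) (auto intro: SF_zero SF_add)

lemmas SF_intros = SF_const SF_zero SF_one SF_add SF_mult SF_scaleR SF_uminus SF_diff SF_sum

lemma SF_compose:
  assumes "Cinf_on u S" "open S" "h \<in> SF" "\<And>q. h q \<in> S"
  shows "(\<lambda>q. u (h q)) \<in> SF"
proof (rule SF_I)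
  fix U \<phi> k assume UA: "(U, \<phi>) \<in> A"
  show "Ck_on k (\<lambda>x. u (h (inv_into U \<phi> x))) (\<phi> ` U)"
    by (rule Ck_on_compose[of _ S]) (use assms chart[OF UA] SF_D_Cinf[OF assms(3) UA] in auto)
qed

lemma SF_continuous:
  assumes "h \<in> SF"
  shows "continuous_on UNIV h"
proof -
  have "isCont h p" for p
  proof -
    obtain U \<phi> where UA: "(U, \<phi>) \<in> A" "p \<in> U" using chart_exists .
    have "continuous_on (\<phi> ` U) (\<lambda>x. h (inv_into U \<phi> x))"
      using SF_D[OF assms UA(1), of 0] by simp
    then have "continuous_on U (\<lambda>q. h (inv_into U \<phi> (\<phi> q)))"
      using chart(4)[OF UA(1)] by (rule continuous_on_compose2) auto
    then have "continuous_on U h"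
      using inv_chart[OF UA(1)] by (simp cong: continuous_on_cong)
    then show ?thesis
      using UA chart continuous_on_eq_continuous_at by blast
  qed
  then show ?thesis by (simp add: continuous_on_eq_continuous_at)
qed

text \<open>Smoothness is local, and two open sets suffice. On the part of the manifold that
  corresponds to \<open>S\<close>, the extension is \<open>F\<close> composed with a transition map.
  Off the part that corresponds to \<open>K\<close> it vanishes, and this complement is open because
  a compact subset of a Hausdorff space is closed.\<close>

lemma SF_extend_by_zero:
  assumes UA: "(U, \<phi>) \<in> A" and S: "open S" "S \<subseteq> \<phi> ` U" and F: "Cinf_on F S"
    and K: "compact K" "K \<subseteq> S" "\<And>y. y \<in> S - K \<Longrightarrow> F y = 0"
  shows "(\<lambda>q. if q \<in> U \<and> \<phi> q \<in> S then F (\<phi> q) else 0) \<in> SF" (is "?h \<in> SF")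
proof (rule SF_I)
  fix V \<psi> k assume VA: "(V, \<psi>) \<in> A"
  define S' where "S' = U \<inter> \<phi> -` S"
  define K' where "K' = inv_into U \<phi> ` K"
  have "open S'"
    unfolding S'_def using chart[OF UA] S by (auto intro: continuous_open_preimage)
  have "compact K'"
    unfolding K'_def
    by (intro compact_continuous_image K continuous_on_subset[OF chart(6)[OF UA]]) (use K S in auto)
  then have "closed K'" by (rule compact_imp_closed)
  have K'S': "K' \<subseteq> S'"
    using K(2) S(2) by (auto simp: K'_def S'_def f_inv_into_f inv_into_into subset_iff)
  have zero: "?h q = 0" if "q \<notin> K'" for q
  proof (cases "q \<in> U \<and> \<phi> q \<in> S")
    case True
    then have "\<phi> q \<notin> K"
      using that inv_chart[OF UA, of q] unfolding K'_def by (metis image_eqI)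
    with True K(3) show ?thesis by auto
  qed auto
  show "Ck_on k (\<lambda>x. ?h (inv_into V \<psi> x)) (\<psi> ` V)"
  proof (rule Ck_on_local[OF chart(2)[OF VA]])
    fix x assume "x \<in> \<psi> ` V"
    then obtain q where q: "q \<in> V" "x = \<psi> q" by auto
    show "\<exists>T. open T \<and> x \<in> T \<and> Ck_on k (\<lambda>x. ?h (inv_into V \<psi> x)) T"
    proof (cases "q \<in> K'")
      case True
      let ?T = "\<psi> ` (V \<inter> S')"
      have T: "open ?T"
        using \<open>open S'\<close> chart[OF VA] by (intro chart_open_image[OF VA]) auto
      have "Cinf_on (\<lambda>x. \<phi> (inv_into V \<psi> x)) ?T"
        using transition_smooth[OF VA UA]
        unfolding Cinf_on_def o_def
        by (auto intro: Ck_on_subset simp: S'_def)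
      then have "Ck_on k (\<lambda>x. F (\<phi> (inv_into V \<psi> x))) ?T"
        by (intro Ck_on_compose[OF T S(1) _ F]) (auto simp: S'_def inv_chart[OF VA])
      then have "Ck_on k (\<lambda>x. ?h (inv_into V \<psi> x)) ?T"
        by (rule Ck_on_cong[OF _ T]) (auto simp: S'_def inv_chart[OF VA])
      then show ?thesis
        using T q True K'S' by blast
    next
      case False
      let ?T = "\<psi> ` (V - K')"
      have T: "open ?T"
        using \<open>closed K'\<close> chart[OF VA] by (intro chart_open_image[OF VA]) auto
      have "Ck_on k (\<lambda>x. ?h (inv_into V \<psi> x)) ?T"
        by (rule Ck_on_cong[OF Ck_on_const[OF T, of _ 0] T]) (subst zero, auto simp: inv_chart[OF VA])
      then show ?thesis
        using T q False by blast
    qed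
  qed
qed

section \<open>Vector fields and tangent vectors as derivations\<close>

lemma VF_I:
  assumes "\<And>h. h \<notin> SF \<Longrightarrow> X h = 0" "\<And>h. h \<in> SF \<Longrightarrow> X h \<in> SF"
    "\<And>h k p. h \<in> SF \<Longrightarrow> k \<in> SF \<Longrightarrow> X (h + k) p = X h p + X k p"
    "\<And>h k p. h \<in> SF \<Longrightarrow> k \<in> SF \<Longrightarrow> X (h * k) p = X h p * k p + h p * X k p"
    "\<And>c h p. h \<in> SF \<Longrightarrow> X (c *\<^sub>R h) p = c * X h p"
  shows "X \<in> VF"
  using assms by (auto simp: vector_fields_def fun_eq_iff)

lemma VF_simps:
  assumes "X \<in> VF"
  shows VF_outside: "h \<notin> SF \<Longrightarrow> X h = 0"
    and VF_apply: "h \<in> SF \<Longrightarrow> X h \<in> SF"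
    and VF_plus: "h \<in> SF \<Longrightarrow> k \<in> SF \<Longrightarrow> X (h + k) = X h + X k"
    and VF_times: "h \<in> SF \<Longrightarrow> k \<in> SF \<Longrightarrow> X (h * k) = X h * k + h * X k"
    and VF_scaleR: "h \<in> SF \<Longrightarrow> X (c *\<^sub>R h) = c *\<^sub>R X h"
  using assms by (auto simp: vector_fields_def)

lemma
  assumes "v \<in> tangent_space A p"
  shows tangent_outside: "h \<notin> SF \<Longrightarrow> v h = 0"
    and tangent_plus: "h \<in> SF \<Longrightarrow> k \<in> SF \<Longrightarrow> v (h + k) = v h + v k"
    and tangent_times: "h \<in> SF \<Longrightarrow> k \<in> SF \<Longrightarrow> v (h * k) = v h * k p + h p * v k"
    and tangent_scaleR: "h \<in> SF \<Longrightarrow> v (c *\<^sub>R h) = c * v h"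
  using assms by (auto simp: tangent_space_def)

lemma tangent_minus:
  assumes "v \<in> tangent_space A p" "h \<in> SF" "k \<in> SF"
  shows "v (h - k) = v h - v k"
  using tangent_plus[OF assms(1,2) SF_uminus[OF assms(3)]] tangent_scaleR[OF assms(1,3), of "- 1"]
  by simp

lemma tangent_sum:
  assumes "v \<in> tangent_space A p" "\<And>i. i \<in> I \<Longrightarrow> h i \<in> SF"
  shows "v (\<Sum>i\<in>I. h i) = (\<Sum>i\<in>I. v (h i))"
proof -
  have "v 0 = 0" using tangent_scaleR[OF assms(1) SF_zero, of 0] by simp
  then show ?thesis
    using assms(2) by (induction I rule: infinite_finite_induct)
      (auto simp: tangent_plus[OF assms(1)] SF_sum)
qed

lemma tangent_const:
  assumes "v \<in> tangent_space A p"
  shows "v (\<lambda>_. c) = 0"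
proof -
  have "v (1 * 1) = v 1 * 1 + 1 * v 1"
    using tangent_times[OF assms SF_one SF_one] by (simp add: one_fun_def)
  then have "v 1 = 0" by simp
  moreover have "(\<lambda>_. c) = c *\<^sub>R (1 :: 'a \<Rightarrow> real)"
    by (simp add: fun_eq_iff scaleR_fun_def)
  ultimately show ?thesis
    using tangent_scaleR[OF assms SF_one] by simp
qed

lemma value_at_tangent: "X \<in> VF \<Longrightarrow> value_at X p \<in> tangent_space A p"
  by (auto simp: value_at_def tangent_space_def VF_simps)

section \<open>Cut-off coordinate fields\<close>

text \<open>
  The fields \<open>B i\<close> are the coordinate fields cut off by a bump function \<open>b\<close>, and \<open>x i\<close> are the
  coordinates centred at \<open>p\<close> multiplied by \<open>b\<close>. Clearing the powers of \<open>b\<close> makes the expansion of a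
  tangent vector in coordinate vectors valid at every point of the manifold.
\<close>

definition coordinate_fields_at ::
    "'a \<Rightarrow> ('a \<Rightarrow> real) \<Rightarrow> ('e \<Rightarrow> 'a \<Rightarrow> real) \<Rightarrow> ('e \<Rightarrow> 'a vfield) \<Rightarrow> bool" where
  "coordinate_fields_at p b x B \<longleftrightarrow>
     b \<in> SF \<and> b p > 0 \<and> (\<forall>i. x i \<in> SF) \<and> (\<forall>i. B i \<in> VF) \<and> (\<forall>i. x i p = 0) \<and>
     (\<forall>q. \<forall>v\<in>tangent_space A q. \<forall>h\<in>SF.
        b q ^ 3 * v h = (\<Sum>i\<in>Basis. (b q * v (x i) - x i q * v b) * B i h q)) \<and>
     (\<forall>i\<in>Basis. \<forall>j\<in>Basis. B i (x j) p = (if i = j then (b p)\<^sup>2 else 0))"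

text \<open>For the expansion, Hadamard's lemma is centred at the moving point \<open>q\<close>: in
  the chart, \<open>h - h q\<close> is a sum of coordinate differences times smooth functions. Two
  factors \<open>b\<close> make both members of each product globally smooth, and a derivation at
  \<open>q\<close> only sees the derivative of the member that vanishes there.\<close>

lemma coordinate_fields_exist: "\<exists>b x B. coordinate_fields_at p b x B"
proof -
  obtain U \<phi> where UA: "(U, \<phi>) \<in> A" "p \<in> U" using chart_exists .
  define c where "c = \<phi> p"
  obtain R where R: "R > 0" "ball c R \<subseteq> \<phi> ` U"
    using chart(2)[OF UA(1)] UA(2) unfolding c_def by (meson imageI open_contains_ball)
  define S where "S = ball c R"
  define K where "K = cball c (R / 2)"
  \<comment> \<open>Positive exactly inside the ball of radius \<open>R / 2\<close>; the closed ball
    \<open>K\<close> is compact and still contained in \<open>S\<close>, as extension by zero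
    demands.\<close>
  define \<beta> where "\<beta> y = flat ((R / 2)\<^sup>2 - (y - c) \<bullet> (y - c))" for y
  have S: "open S" "convex S" "S \<subseteq> \<phi> ` U" "c \<in> S" and K: "compact K" "K \<subseteq> S"
    using R by (auto simp: S_def K_def)
  \<comment> \<open>The squared distance is spelled out as a sum of products of coordinates, and the
    difference as a sum, to match the closure rules for \<open>Ck_on\<close>.\<close>
  have quad: "Cinf_on (\<lambda>y::'e. (R / 2)\<^sup>2 + (-1) * (\<Sum>i\<in>Basis. (y - c) \<bullet> i * ((y - c) \<bullet> i))) UNIV"
    and coord: "Cinf_on (\<lambda>y. (y - c) \<bullet> i) UNIV" for i
  proof -
    show *: "Cinf_on (\<lambda>y. (y - c) \<bullet> i) UNIV" for i
      unfolding Cinf_on_def diff_conv_add_uminus[of _ c]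
      by (intro allI Ck_on_bounded_linear[OF bounded_linear_inner_left] Ck_on_add Ck_on_id Ck_on_const) auto
    show "Cinf_on (\<lambda>y::'e. (R / 2)\<^sup>2 + (-1) * (\<Sum>i\<in>Basis. (y - c) \<bullet> i * ((y - c) \<bullet> i))) UNIV"
      unfolding Cinf_on_def
      by (intro allI Ck_on_add Ck_on_mult Ck_on_const Ck_on_sum) (use * in \<open>auto simp: Cinf_on_def\<close>)
  qed
  have \<beta>: "Cinf_on \<beta> S"
  proof -
    have "Cinf_on (\<lambda>y. flat ((R / 2)\<^sup>2 + (-1) * (\<Sum>i\<in>Basis. (y - c) \<bullet> i * ((y - c) \<bullet> i)))) S"
      by (rule Cinf_on_compose[OF S(1) open_UNIV _ Cinf_on_flat])
        (use quad in \<open>auto simp: Cinf_on_def intro: Ck_on_subset\<close>)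
    moreover have "\<beta> = (\<lambda>y. flat ((R / 2)\<^sup>2 + (-1) * (\<Sum>i\<in>Basis. (y - c) \<bullet> i * ((y - c) \<bullet> i))))"
      unfolding \<beta>_def by (subst euclidean_inner) simp
    ultimately show ?thesis by simp
  qed
  have \<beta>0: "\<beta> y = 0" if "y \<notin> K" for y
  proof -
    have "(R / 2)\<^sup>2 \<le> (norm (y - c))\<^sup>2"
      using that R(1) by (intro power_mono) (auto simp: K_def dist_norm norm_minus_commute)
    then show ?thesis
      unfolding \<beta>_def by (intro flat_0) (simp add: power2_norm_eq_inner)
  qed
  have \<beta>c: "\<beta> c > 0"
    unfolding \<beta>_def using R(1) by (intro flat_pos) auto
  define ext where "ext F q = (if q \<in> U \<and> \<phi> q \<in> S then F (\<phi> q) else (0::real))" for F q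
  have ext: "ext (\<lambda>y. \<beta> y * F y) \<in> SF" if "Cinf_on F S" for F
    unfolding ext_def
    by (rule SF_extend_by_zero[OF UA(1) S(1,3) _ K])
      (use that \<beta> \<beta>0 S(1) in \<open>auto simp: Cinf_on_def intro: Ck_on_mult\<close>)
  define b where "b = ext (\<lambda>y. \<beta> y * 1)"
  define x where "x i = ext (\<lambda>y. \<beta> y * ((y - c) \<bullet> i))" for i
  define pd where "pd h y = frechet_derivative (\<lambda>y. h (inv_into U \<phi> y)) (at y)" for h :: "'a \<Rightarrow> real" and y
  \<comment> \<open>The value 0 on functions that are not smooth is forced by the definition of
    \<open>vector_fields\<close>.\<close>
  define B where "B i h = (if h \<in> SF then ext (\<lambda>y. \<beta> y * pd h y i) else 0)" for i h
  have hS: "Cinf_on (\<lambda>y. h (inv_into U \<phi> y)) S" if "h \<in> SF" for h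
    using SF_D_Cinf[OF that UA(1)] S(3) by (auto simp: Cinf_on_def intro: Ck_on_subset)
  have pd: "((\<lambda>y. h (inv_into U \<phi> y)) has_derivative pd h y) (at y)" if "h \<in> SF" "y \<in> S" for h y
    unfolding pd_def by (rule Cinf_on_has_derivative[OF hS[OF that(1)] S(1) that(2)])
  have pd_eq: "pd h y = D" if "h \<in> SF" "y \<in> S" "((\<lambda>y. h (inv_into U \<phi> y)) has_derivative D) (at y)" for h y D
    using has_derivative_unique[OF pd[OF that(1,2)] that(3)] .
  have pS: "p \<in> U" "\<phi> p \<in> S" using UA S(4) by (auto simp: c_def)
  have b_SF: "b \<in> SF"
    unfolding b_def by (rule ext) (auto simp: Cinf_on_def intro: Ck_on_const S)
  have x_SF: "x i \<in> SF" for i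
    unfolding x_def by (rule ext) (use coord in \<open>auto simp: Cinf_on_def intro: Ck_on_subset\<close>)
  have B_VF: "B i \<in> VF" for i
  proof (rule VF_I)
    show "B i h \<in> SF" if "h \<in> SF" for h
      unfolding B_def pd_def using that by (auto intro!: ext Cinf_on_deriv hS)
    show "B i (h + k) q = B i h q + B i k q" if "h \<in> SF" "k \<in> SF" for h k q
    proof -
      have "pd (h + k) y v = pd h y v + pd k y v" if "y \<in> S" for y v
        using has_derivative_add[OF pd[OF \<open>h \<in> SF\<close> that] pd[OF \<open>k \<in> SF\<close> that]]
          pd_eq[OF SF_add[OF \<open>h \<in> SF\<close> \<open>k \<in> SF\<close>] that] by auto
      then show ?thesis
        using that by (auto simp: B_def SF_intros ext_def algebra_simps)
    qed
    show "B i (h * k) q = B i h q * k q + h q * B i k q" if "h \<in> SF" "k \<in> SF" for h k q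
    proof -
      have "pd (h * k) y v = h (inv_into U \<phi> y) * pd k y v + pd h y v * k (inv_into U \<phi> y)" if "y \<in> S" for y v
        using has_derivative_mult[OF pd[OF \<open>h \<in> SF\<close> that] pd[OF \<open>k \<in> SF\<close> that]]
          pd_eq[OF SF_mult[OF \<open>h \<in> SF\<close> \<open>k \<in> SF\<close>] that] by auto
      then show ?thesis
        using that by (auto simp: B_def SF_intros ext_def inv_chart[OF UA(1)] algebra_simps)
    qed
    show "B i (r *\<^sub>R h) q = r * B i h q" if "h \<in> SF" for r h q
    proof -
      have "pd (r *\<^sub>R h) y v = r * pd h y v" if "y \<in> S" for y v
        using has_derivative_mult_right[OF pd[OF \<open>h \<in> SF\<close> that], of r]
          pd_eq[OF SF_scaleR[OF \<open>h \<in> SF\<close>] that] by auto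
      then show ?thesis
        using that by (auto simp: B_def SF_intros ext_def)
    qed
  qed (auto simp: B_def)
  have decomp: "b q ^ 3 * v h = (\<Sum>i\<in>Basis. (b q * v (x i) - x i q * v b) * B i h q)"
    if v: "v \<in> tangent_space A q" and h: "h \<in> SF" for q v h
  proof (cases "q \<in> U \<and> \<phi> q \<in> S")
    case False
    then show ?thesis by (auto simp: b_def x_def ext_def)
  next
    case True
    define a where "a = \<phi> q"
    have a: "a \<in> S" "inv_into U \<phi> a = q" using True inv_chart[OF UA(1)] by (auto simp: a_def)
    obtain G where G: "\<And>i. Cinf_on (G i) S"
      "\<And>y. y \<in> S \<Longrightarrow> h (inv_into U \<phi> y) - h q = (\<Sum>i\<in>Basis. ((y - a) \<bullet> i) * G i y)"
      "\<And>i. G i a = pd h a i"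
      using Hadamard[OF S(1,2) a(1) hS[OF h]] unfolding a(2) pd_def by metis
    \<comment> \<open>In the chart, \<open>k i\<close> is the cut-off times the coordinate
      difference from \<open>a\<close>, hence zero at \<open>q\<close>; \<open>w i\<close> is the
      cut-off times the Hadamard quotient, hence equal to \<open>B i h\<close> at
      \<open>q\<close>.\<close>
    define k where "k i = x i - ((a - c) \<bullet> i) *\<^sub>R b" for i
    define w where "w i = ext (\<lambda>y. \<beta> y * G i y)" for i
    have k_SF: "k i \<in> SF" and w_SF: "w i \<in> SF" for i
      unfolding k_def w_def by (auto intro!: SF_intros x_SF b_SF ext G)
    have kq: "k i q = 0" and wq: "w i q = B i h q" for i
      using True h G(3) by (auto simp: k_def w_def x_def b_def ext_def a_def B_def)
    have "b * b * (h - (\<lambda>_. h q)) = (\<Sum>i\<in>Basis. k i * w i)"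
    proof (rule HOL.ext)
      fix q'
      show "(b * b * (h - (\<lambda>_. h q))) q' = (\<Sum>i\<in>Basis. k i * w i) q'"
      proof (cases "q' \<in> U \<and> \<phi> q' \<in> S")
        case False
        then show ?thesis by (auto simp: b_def w_def ext_def sum_fun_apply)
      next
        case True
        then have "h q' - h q = (\<Sum>i\<in>Basis. ((\<phi> q' - a) \<bullet> i) * G i (\<phi> q'))"
          using G(2)[of "\<phi> q'"] inv_chart[OF UA(1)] by auto
        with True show ?thesis
          by (simp add: b_def w_def k_def x_def ext_def sum_fun_apply sum_distrib_left
              inner_diff_left algebra_simps)
      qed
    qed
    then have "v (b * b * (h - (\<lambda>_. h q))) = v (\<Sum>i\<in>Basis. k i * w i)" by simp
    also have "\<dots> = (\<Sum>i\<in>Basis. v (k i) * w i q)"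
      by (subst tangent_sum[OF v]) (auto simp: tangent_times[OF v] k_SF w_SF kq SF_intros)
    also have "v (b * b * (h - (\<lambda>_. h q))) = (b q)\<^sup>2 * v h"
      by (simp add: tangent_times[OF v] tangent_minus[OF v] tangent_const[OF v] SF_intros b_SF h power2_eq_square)
    moreover have "v (k i) = v (x i) - ((a - c) \<bullet> i) * v b" for i
      unfolding k_def
      using tangent_minus[OF v x_SF[of i] SF_scaleR[OF b_SF]] tangent_scaleR[OF v b_SF] by metis
    ultimately have "(b q)\<^sup>2 * v h = (\<Sum>i\<in>Basis. (v (x i) - ((a - c) \<bullet> i) * v b) * B i h q)"
      by (simp add: wq)
    \<comment> \<open>The third factor \<open>b q\<close> turns the coordinate
      \<open>(a - c) \<bullet> i\<close>, which only makes sense in the chart, into the value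
      \<open>x i q\<close> of a global function.\<close>
    then have "b q ^ 3 * v h = b q * (\<Sum>i\<in>Basis. (v (x i) - ((a - c) \<bullet> i) * v b) * B i h q)"
      by (simp add: power2_eq_square power3_eq_cube)
    also have "\<dots> = (\<Sum>i\<in>Basis. (b q * v (x i) - x i q * v b) * B i h q)"
      using True by (simp add: sum_distrib_left b_def x_def ext_def a_def algebra_simps)
    finally show ?thesis .
  qed
  have dual: "B i (x j) p = (if i = j then (b p)\<^sup>2 else 0)" if "i \<in> Basis" "j \<in> Basis" for i j
  proof -
    have "(\<beta> has_derivative frechet_derivative \<beta> (at c)) (at c)"
      by (rule Cinf_on_has_derivative[OF \<beta> S(1,4)])
    then have "((\<lambda>y. \<beta> y * ((y - c) \<bullet> j)) has_derivative
        (\<lambda>v. \<beta> c * (v \<bullet> j) + frechet_derivative \<beta> (at c) v * ((c - c) \<bullet> j))) (at c)"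
      by (intro has_derivative_mult) (auto intro!: derivative_eq_intros)
    \<comment> \<open>At the centre the derivative of the bump is multiplied by
      \<open>c - c\<close>, so its value does not matter.\<close>
    then have D: "((\<lambda>y. \<beta> y * ((y - c) \<bullet> j)) has_derivative (\<lambda>v. \<beta> c * (v \<bullet> j))) (at c)"
      by simp
    have "((\<lambda>y. x j (inv_into U \<phi> y)) has_derivative (\<lambda>v. \<beta> c * (v \<bullet> j))) (at c)"
    proof (rule has_derivative_transform_within_open[OF D S(1,4)])
      fix y assume "y \<in> S"
      then show "\<beta> y * ((y - c) \<bullet> j) = x j (inv_into U \<phi> y)"
        using S(3) by (auto simp: x_def ext_def f_inv_into_f inv_into_into subset_iff)
    qed
    from pd_eq[OF x_SF S(4) this] show ?thesis
      using that pS by (auto simp: B_def x_SF ext_def b_def power2_eq_square inner_Basis simp flip: c_def)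
  qed
  have "coordinate_fields_at p b x B"
    unfolding coordinate_fields_at_def
    using b_SF x_SF B_VF decomp dual \<beta>c pS by (auto simp: b_def x_def ext_def simp flip: c_def)
  then show ?thesis by blast
qed

end

section \<open>Traces and orthonormal frames\<close>

text \<open>Both sides equal the double sum of \<open>l i b * representation B (T (e i)) b\<close>:
  expanding \<open>b\<close> in the family \<open>e\<close> yields the trace, expanding
  \<open>T (e i)\<close> in the basis \<open>B\<close> yields the right-hand side. The family enters
  only through its reconstruction formula. The finite basis \<open>C\<close> guarantees that the
  basis chosen inside \<open>endo_trace\<close> is finite too.\<close>

lemma endo_trace_frame:
  fixes S :: "'v::real_vector set" and e :: "'i \<Rightarrow> 'v"
  assumes C: "finite C" "independent C" "span C = S" and I: "finite I"
    and e: "\<And>i. i \<in> I \<Longrightarrow> e i \<in> S"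
    and T: "\<And>v. v \<in> S \<Longrightarrow> T v \<in> S" "\<And>v w. v \<in> S \<Longrightarrow> w \<in> S \<Longrightarrow> T (v + w) = T v + T w"
      "\<And>c v. v \<in> S \<Longrightarrow> T (c *\<^sub>R v) = c *\<^sub>R T v"
    and l: "\<And>i v w. v \<in> S \<Longrightarrow> w \<in> S \<Longrightarrow> l i (v + w) = l i v + l i w"
      "\<And>i c v. v \<in> S \<Longrightarrow> l i (c *\<^sub>R v) = c * (l i v :: real)"
    and frame: "\<And>v. v \<in> S \<Longrightarrow> v = (\<Sum>i\<in>I. l i v *\<^sub>R e i)"
  shows "endo_trace S T = (\<Sum>i\<in>I. l i (T (e i)))"
proof -
  define B where "B = (SOME B. independent B \<and> span B = S)"
  have B: "independent B" "span B = S"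
    using someI[of "\<lambda>B. independent B \<and> span B = S" C] C unfolding B_def by auto
  have finB: "finite B"
    using independent_span_bound[OF C(1) B(1)] B(2) C(3) span_superset by blast
  have S: "subspace S" using B(2) subspace_span by blast
  have BS: "b \<in> S" if "b \<in> B" for b using that B(2) span_base by blast
  have "0 \<in> S" using S subspace_0 by blast
  then have 0: "T 0 = 0" "l i 0 = 0" for i using T(3)[of 0 0] l(2)[of 0 i 0] by auto
  have lin_T: "T (\<Sum>i\<in>J. c i *\<^sub>R v i) = (\<Sum>i\<in>J. c i *\<^sub>R T (v i))"
    if "\<And>i. i \<in> J \<Longrightarrow> v i \<in> S" for J :: "'i set" and c v
    using that
    by (induction J rule: infinite_finite_induct) (auto simp: 0 T S subspace_sum subspace_scale)
  have lin_l: "l i (\<Sum>b\<in>J. c b *\<^sub>R b) = (\<Sum>b\<in>J. c b * l i b)"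
    if "J \<subseteq> S" for i J c
    using that
    by (induction J rule: infinite_finite_induct) (auto simp: 0 l S subspace_sum subspace_scale subset_iff)
  have "representation B (T b) b = (\<Sum>i\<in>I. l i b * representation B (T (e i)) b)" if "b \<in> B" for b
  proof -
    have "T b = (\<Sum>i\<in>I. l i b *\<^sub>R T (e i))"
      using lin_T[where J=I and v=e and c="\<lambda>i. l i b"] e frame[OF BS[OF that]] by simp
    moreover have "representation B (\<Sum>i\<in>I. l i b *\<^sub>R T (e i)) b =
        (\<Sum>i\<in>I. representation B (l i b *\<^sub>R T (e i)) b)"
      using B T(1) e S by (subst representation_sum) (auto intro: subspace_scale)
    ultimately show ?thesis
      using B T(1) e by (simp add: representation_scale)
  qed
  then have "endo_trace S T = (\<Sum>b\<in>B. \<Sum>i\<in>I. l i b * representation B (T (e i)) b)"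
    unfolding endo_trace_def B_def[symmetric] Let_def by simp
  also have "\<dots> = (\<Sum>i\<in>I. \<Sum>b\<in>B. representation B (T (e i)) b * l i b)"
    by (subst sum.swap) (simp add: mult.commute)
  also have "\<dots> = (\<Sum>i\<in>I. l i (T (e i)))"
  proof (rule sum.cong[OF refl])
    fix i assume "i \<in> I"
    then have "(\<Sum>b\<in>B. representation B (T (e i)) b *\<^sub>R b) = T (e i)"
      using B T(1) e by (intro sum_representation_eq finB) auto
    then show "(\<Sum>b\<in>B. representation B (T (e i)) b * l i b) = l i (T (e i))"
      using lin_l[of B i "representation B (T (e i))"] BS by (metis subsetI)
  qed
  finally show ?thesis .
qed

lemma fscale_apply: "(\<phi> \<star> X) h = \<phi> * X h"
  by (simp add: fscale_def)

lemma value_at_simps: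
  "value_at (X + Y) p = value_at X p + value_at Y p"
  "value_at (X - Y) p = value_at X p - value_at Y p"
  "value_at (- X) p = - value_at X p"
  "value_at (\<phi> \<star> X) p = \<phi> p *\<^sub>R value_at X p"
  "value_at (c *\<^sub>R X) p = c *\<^sub>R value_at X p"
  "value_at 0 p = 0"
  "value_at (\<Sum>i\<in>I. f i) p = (\<Sum>i\<in>I. value_at (f i) p)"
  by (auto simp: value_at_def fun_eq_iff fscale_apply)

lemma vfield_eqI: "(\<And>p. value_at X p = value_at Y p) \<Longrightarrow> X = Y"
  by (simp add: value_at_def fun_eq_iff)

lemma const_fscale: "(\<lambda>_. c) \<star> X = c *\<^sub>R X"
  by (simp add: fun_eq_iff fscale_apply)

context manifold
begin

section \<open>The module of vector fields, and tensors acting pointwise\<close>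

lemma VF_add:
  assumes "X \<in> VF" "Y \<in> VF"
  shows "X + Y \<in> VF"
  by (rule VF_I)
    (auto simp: VF_simps[OF assms(1)] VF_simps[OF assms(2)] SF_intros algebra_simps)

lemma VF_fscale:
  assumes "\<phi> \<in> SF" "X \<in> VF"
  shows "\<phi> \<star> X \<in> VF"
  by (rule VF_I) (auto simp: assms VF_simps[OF assms(2)] SF_intros algebra_simps fscale_apply)

lemma VF_scaleR_closed: "X \<in> VF \<Longrightarrow> c *\<^sub>R X \<in> VF"
  using VF_fscale[OF SF_const[of c]] by (simp add: const_fscale)

lemma VF_uminus: "X \<in> VF \<Longrightarrow> - X \<in> VF"
  using VF_scaleR_closed[of X "- 1"] by simp

lemma VF_diff: "X \<in> VF \<Longrightarrow> Y \<in> VF \<Longrightarrow> X - Y \<in> VF"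
  using VF_add[of X "- Y"] VF_uminus[of Y] by simp

lemma VF_zero: "0 \<in> VF"
  by (rule VF_I) (auto simp: SF_zero)

lemma VF_sum: "(\<And>i. i \<in> I \<Longrightarrow> X i \<in> VF) \<Longrightarrow> (\<Sum>i\<in>I. X i) \<in> VF"
  by (induction I rule: infinite_finite_induct) (auto intro: VF_zero VF_add)

lemma VF_minus_apply: "X \<in> VF \<Longrightarrow> h \<in> SF \<Longrightarrow> k \<in> SF \<Longrightarrow> X (h - k) = X h - X k"
  using VF_plus[of X h "- k"] VF_scaleR[of X k "- 1"] SF_uminus by simp

lemma VF_lie_bracket:
  assumes "X \<in> VF" "Y \<in> VF"
  shows "lie_bracket X Y \<in> VF"
proof (rule VF_I)
  have 0: "Z 0 = 0" if "Z \<in> VF" for Z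
    using VF_scaleR[OF that SF_zero, of 0] by simp
  show "lie_bracket X Y h = 0" if "h \<notin> SF" for h
    by (simp only: lie_bracket_def VF_outside[OF _ that] assms 0 diff_self)
qed (auto simp: lie_bracket_def VF_simps[OF assms(1)] VF_simps[OF assms(2)] SF_intros algebra_simps)

lemmas VF_intros = VF_add VF_fscale VF_scaleR_closed VF_uminus VF_diff VF_zero VF_sum VF_lie_bracket

lemma
  assumes "one_form A \<omega>"
  shows one_form_SF: "X \<in> VF \<Longrightarrow> \<omega> X \<in> SF"
    and one_form_add: "X \<in> VF \<Longrightarrow> Y \<in> VF \<Longrightarrow> \<omega> (X + Y) = \<omega> X + \<omega> Y"
    and one_form_fscale: "\<phi> \<in> SF \<Longrightarrow> X \<in> VF \<Longrightarrow> \<omega> (\<phi> \<star> X) = \<phi> * \<omega> X"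
  using assms by (auto simp: one_form_def)

lemma one_form_scaleR:
  assumes "one_form A \<omega>" "X \<in> VF"
  shows "\<omega> (c *\<^sub>R X) = c *\<^sub>R \<omega> X"
  using one_form_fscale[OF assms(1) SF_const[of c] assms(2)]
  by (simp add: const_fscale fun_eq_iff)

lemma one_form_diff:
  assumes "one_form A \<omega>" "X \<in> VF" "Y \<in> VF"
  shows "\<omega> (X - Y) = \<omega> X - \<omega> Y"
  using one_form_add[OF assms(1,2) VF_uminus[OF assms(3)]] one_form_scaleR[OF assms(1,3), of "- 1"]
  by simp

lemma one_form_zero: "one_form A \<omega> \<Longrightarrow> \<omega> 0 = 0"
  using one_form_scaleR[OF _ VF_zero, of \<omega> 0] by simp

lemma one_form_sum:
  assumes "one_form A \<omega>" "\<And>i. i \<in> I \<Longrightarrow> X i \<in> VF"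
  shows "\<omega> (\<Sum>i\<in>I. X i) = (\<Sum>i\<in>I. \<omega> (X i))"
  using assms(2) by (induction I rule: infinite_finite_induct)
    (auto simp: one_form_zero[OF assms(1)] one_form_add[OF assms(1)] VF_sum)

text \<open>The expansion in cut-off coordinate fields is an identity of global fields,
  \<open>b ^ 3\<close> times \<open>X\<close> being the sum of the
  \<open>\<psi> i \<star> B i\<close>. Linearity over smooth functions applies to it, and at
  \<open>p\<close> every coefficient \<open>\<psi> i\<close> vanishes together with
  \<open>X\<close>, whereas \<open>b p\<close> does not.\<close>

lemma one_form_tensorial:
  assumes \<omega>: "one_form A \<omega>" and X: "X \<in> VF" and X0: "value_at X p = 0"
  shows "\<omega> X p = 0"
proof -
  obtain b x B where *: "coordinate_fields_at p b x B"
    using coordinate_fields_exist by blast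
  then have b: "b \<in> SF" "b p > 0" and x: "\<And>i. x i \<in> SF" and B: "\<And>i. B i \<in> VF"
    and x0: "\<And>i. x i p = 0"
    by (auto simp: coordinate_fields_at_def)
  have dec: "b q ^ 3 * v h = (\<Sum>i\<in>Basis. (b q * v (x i) - x i q * v b) * B i h q)"
    if "v \<in> tangent_space A q" "h \<in> SF" for q v h
    using * that by (auto simp: coordinate_fields_at_def)
  define \<psi> where "\<psi> i = b * X (x i) - x i * X b" for i
  have \<psi>: "\<psi> i \<in> SF" for i
    unfolding \<psi>_def by (intro SF_diff SF_mult VF_apply[OF X] b x)
  have "(b * b * b) \<star> X = (\<Sum>i\<in>Basis. \<psi> i \<star> B i)"
  proof (intro HOL.ext)
    fix h q
    show "((b * b * b) \<star> X) h q = (\<Sum>i\<in>Basis. \<psi> i \<star> B i) h q"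
    proof (cases "h \<in> SF")
      case True
      then show ?thesis
        using dec[OF value_at_tangent[OF X], of h q]
        by (simp add: fscale_apply \<psi>_def value_at_def power3_eq_cube)
    next
      case False
      then show ?thesis
        by (simp add: fscale_apply VF_outside[OF X] VF_outside[OF B])
    qed
  qed
  then have "\<omega> ((b * b * b) \<star> X) p = (\<Sum>i\<in>Basis. \<omega> (\<psi> i \<star> B i)) p"
    by (simp add: one_form_sum[OF \<omega>] VF_intros \<psi> B)
  then have "b p ^ 3 * \<omega> X p = (\<Sum>i\<in>Basis. \<psi> i p * \<omega> (B i) p)"
    by (simp add: one_form_fscale[OF \<omega>] SF_intros b X \<psi> B power3_eq_cube)
  moreover have "X h p = 0" for h
    using X0 by (simp add: value_at_def fun_eq_iff)
  ultimately show ?thesis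
    using b(2) by (simp add: \<psi>_def)
qed

lemma one_form_pointwise:
  assumes "one_form A \<omega>" "X \<in> VF" "Y \<in> VF" "value_at X p = value_at Y p"
  shows "\<omega> X p = \<omega> Y p"
  using one_form_tensorial[OF assms(1) VF_diff[OF assms(2,3)], of p] assms
  by (simp add: value_at_simps one_form_diff)

lemma tensor11_simps:
  assumes "tensor11 A T"
  shows tensor11_VF: "X \<in> VF \<Longrightarrow> T X \<in> VF"
    and tensor11_add: "X \<in> VF \<Longrightarrow> Y \<in> VF \<Longrightarrow> T (X + Y) = T X + T Y"
    and tensor11_fscale: "\<phi> \<in> SF \<Longrightarrow> X \<in> VF \<Longrightarrow> T (\<phi> \<star> X) = \<phi> \<star> T X"
  using assms by (auto simp: tensor11_def)

text \<open>Testing a (1,1)-tensor against a fixed smooth function yields a 1-form, so pointwise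
  dependence is inherited without a second localization argument.\<close>

lemma tensor11_one_form:
  assumes "tensor11 A T" "h \<in> SF"
  shows "one_form A (\<lambda>X. T X h)"
  using assms by (auto simp: one_form_def tensor11_simps VF_simps fscale_apply)

lemma tensor11_pointwise:
  assumes "tensor11 A T" "X \<in> VF" "Y \<in> VF" "value_at X p = value_at Y p"
  shows "value_at (T X) p = value_at (T Y) p"
proof (rule HOL.ext)
  fix h
  show "value_at (T X) p h = value_at (T Y) p h"
  proof (cases "h \<in> SF")
    case True
    then show ?thesis
      using one_form_pointwise[OF tensor11_one_form[OF assms(1)] assms(2-4)]
      by (simp add: value_at_def)
  qed (simp add: value_at_def VF_outside tensor11_VF assms)
qed

text \<open>The basis consists of the values at \<open>p\<close> of the cut-off coordinate fields.
  Evaluating a linear relation on the functions \<open>x j\<close> gives independence; the expansion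
  of tangent vectors, in which all \<open>x i p\<close> vanish, gives spanning.\<close>

lemma tangent_basis:
  obtains C where "finite C" "independent C" "span C = tangent_space A p" "card C = DIM('e)"
    "\<And>v. v \<in> C \<Longrightarrow> \<exists>V\<in>VF. value_at V p = v"
proof -
  obtain b x B where *: "coordinate_fields_at p b x B"
    using coordinate_fields_exist by blast
  then have b: "b \<in> SF" "b p > 0" and x: "\<And>i. x i \<in> SF" and B: "\<And>i. B i \<in> VF"
    and x0: "\<And>i. x i p = 0"
    by (auto simp: coordinate_fields_at_def)
  have dec: "b q ^ 3 * v h = (\<Sum>i\<in>Basis. (b q * v (x i) - x i q * v b) * B i h q)"
    if "v \<in> tangent_space A q" "h \<in> SF" for q v h
    using * that by (auto simp: coordinate_fields_at_def)
  have dual: "B i (x j) p = (if i = j then (b p)\<^sup>2 else 0)" if "i \<in> Basis" "j \<in> Basis" for i j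
    using * that unfolding coordinate_fields_at_def by blast
  let ?e = "\<lambda>i. value_at (B i) p"
  have inj: "inj_on ?e Basis"
  proof (rule inj_onI, rule ccontr)
    fix i j :: 'e assume "i \<in> Basis" "j \<in> Basis" "?e i = ?e j" "i \<noteq> j"
    then show False
      using dual[of i j] dual[of j j] b by (auto simp: value_at_def fun_eq_iff)
  qed
  have indep: "independent (?e ` Basis)"
  proof (rule ccontr)
    assume "\<not> independent (?e ` Basis)"
    then obtain u where u: "\<exists>v\<in>?e ` Basis. u v \<noteq> 0" "(\<Sum>v\<in>?e ` Basis. u v *\<^sub>R v) = 0"
      by (auto simp: dependent_finite)
    then have "(\<Sum>i\<in>Basis. u (?e i) *\<^sub>R ?e i) = 0"
      by (simp add: sum.reindex[OF inj] o_def)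
    then have "(\<Sum>i\<in>Basis. u (?e i) *\<^sub>R ?e i) (x j) = 0" for j by simp
    then have "(\<Sum>i\<in>Basis. u (?e i) * B i (x j) p) = 0" for j by (simp add: value_at_def)
    moreover have "(\<Sum>i\<in>Basis. u (?e i) * B i (x j) p) = (\<Sum>i\<in>Basis. if i = j then u (?e j) * (b p)\<^sup>2 else 0)"
      if "j \<in> Basis" for j
      by (rule sum.cong) (auto simp: dual that)
    ultimately have "u (?e j) * (b p)\<^sup>2 = 0" if "j \<in> Basis" for j
      using that by simp
    with u(1) b(2) show False by auto
  qed
  have sub: "subspace (tangent_space A p)"
    by (rule subspaceI) (auto simp: tangent_space_def distrib_left distrib_right algebra_simps)
  have "span (?e ` Basis) = tangent_space A p"
  proof
    show "span (?e ` Basis) \<subseteq> tangent_space A p"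
      using sub B by (intro span_minimal) (auto intro: value_at_tangent)
    show "tangent_space A p \<subseteq> span (?e ` Basis)"
    proof
      fix v assume v: "v \<in> tangent_space A p"
      \<comment> \<open>The denominator is what remains of \<open>b p ^ 3\<close> after cancelling
        the factor \<open>b p\<close> in each coefficient.\<close>
      have "v = (\<Sum>i\<in>Basis. (v (x i) / (b p)\<^sup>2) *\<^sub>R ?e i)"
      proof (rule HOL.ext)
        fix h
        show "v h = (\<Sum>i\<in>Basis. (v (x i) / (b p)\<^sup>2) *\<^sub>R ?e i) h"
        proof (cases "h \<in> SF")
          case True
          have "b p ^ 3 * v h = (\<Sum>i\<in>Basis. b p * v (x i) * B i h p)"
            using dec[OF v True] by (simp add: x0)
          also have "\<dots> = b p ^ 3 * (\<Sum>i\<in>Basis. (v (x i) / (b p)\<^sup>2) * B i h p)"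
            unfolding sum_distrib_left using b(2)
            by (intro sum.cong refl) (simp add: field_simps power2_eq_square power3_eq_cube)
          finally have "b p ^ 3 * v h = b p ^ 3 * (\<Sum>i\<in>Basis. (v (x i) / (b p)\<^sup>2) * B i h p)" .
          then show ?thesis using b(2) by (simp add: value_at_def)
        next
          case False
          then show ?thesis
            by (simp add: value_at_def tangent_outside[OF v] VF_outside[OF B])
        qed
      qed
      then show "v \<in> span (?e ` Basis)"
        by (rule ssubst[where P="\<lambda>w. w \<in> span (?e ` Basis)"])
          (intro span_sum span_scale span_base imageI)
    qed
  qed
  then show thesis
    using inj indep B by (intro that[of "?e ` Basis"]) (auto simp: card_image)
qed

text \<open>The values at \<open>p\<close> of global fields form a subspace, and it contains a
  basis.\<close>

lemma tangent_extend:
  assumes "v \<in> tangent_space A p"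
  shows "\<exists>V\<in>VF. value_at V p = v"
proof -
  obtain C where C: "span C = tangent_space A p" "\<And>v. v \<in> C \<Longrightarrow> \<exists>V\<in>VF. value_at V p = v"
    using tangent_basis[of p] by metis
  have "span C \<subseteq> (\<lambda>V. value_at V p) ` VF"
  proof (rule span_minimal)
    show "C \<subseteq> (\<lambda>V. value_at V p) ` VF" using C(2) by blast
    show "subspace ((\<lambda>V. value_at V p) ` VF)"
    proof (rule subspaceI)
      show "0 \<in> (\<lambda>V. value_at V p) ` VF"
        by (rule image_eqI[OF _ VF_zero]) (simp add: value_at_simps)
      fix v w c assume "v \<in> (\<lambda>V. value_at V p) ` VF"
      then obtain X where X: "X \<in> VF" "v = value_at X p" by blast
      show "c *\<^sub>R v \<in> (\<lambda>V. value_at V p) ` VF"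
        by (rule image_eqI[OF _ VF_scaleR_closed[OF X(1), of c]]) (simp add: value_at_simps X)
      assume "w \<in> (\<lambda>V. value_at V p) ` VF"
      then obtain Y where Y: "Y \<in> VF" "w = value_at Y p" by blast
      show "v + w \<in> (\<lambda>V. value_at V p) ` VF"
        by (rule image_eqI[OF _ VF_add[OF X(1) Y(1)]]) (simp add: value_at_simps X Y)
    qed
  qed
  with C(1) assms show ?thesis by blast
qed

lemma tangent_extension:
  assumes "v \<in> tangent_space A p"
  shows "(SOME V. V \<in> VF \<and> value_at V p = v) \<in> VF"
    "value_at (SOME V. V \<in> VF \<and> value_at V p = v) p = v"
  using someI_ex[of "\<lambda>V. V \<in> VF \<and> value_at V p = v"] tangent_extend[OF assms] by auto

text \<open>Tensoriality makes the choice of an extension inside \<open>tensor_at\<close>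
  harmless.\<close>

lemma tensor_at_value:
  assumes "tensor11 A T" "X \<in> VF"
  shows "tensor_at A T p (value_at X p) = value_at (T X) p"
  unfolding tensor_at_def
  by (rule tensor11_pointwise[OF assms(1) tangent_extension(1) assms(2) tangent_extension(2)];
      rule value_at_tangent[OF assms(2)])

lemma tensor_zero:
  assumes "tensor11 A T"
  shows "T 0 = 0"
proof -
  have "(\<lambda>_. 0 :: real) \<star> (0 :: 'a vfield) = 0" by (simp only: const_fscale scaleR_zero_left)
  moreover have "(\<lambda>_. 0) \<star> T 0 = 0" by (simp only: const_fscale scaleR_zero_left)
  ultimately show ?thesis
    using tensor11_fscale[OF assms SF_const[of 0] VF_zero] by metis
qed

lemma tensor_scaleR:
  assumes "tensor11 A T" "X \<in> VF"
  shows "T (c *\<^sub>R X) = c *\<^sub>R T X"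
  using tensor11_fscale[OF assms(1) SF_const[of c] assms(2)] by (simp only: const_fscale)

lemma tensor_diff:
  assumes "tensor11 A T" "X \<in> VF" "Y \<in> VF"
  shows "T (X - Y) = T X - T Y"
  using tensor11_add[OF assms(1,2) VF_uminus[OF assms(3)]] tensor_scaleR[OF assms(1,3), of "- 1"]
  by (simp only: scaleR_minus1_left add_uminus_conv_diff)

lemma tensor_sum:
  assumes "tensor11 A T" "finite I" "\<And>i. i \<in> I \<Longrightarrow> X i \<in> VF"
  shows "T (\<Sum>i\<in>I. X i) = (\<Sum>i\<in>I. T (X i))"
  using assms(2,3)
proof (induction I rule: finite_induct)
  case (insert i I)
  then have "T (X i + (\<Sum>i\<in>I. X i)) = T (X i) + T (\<Sum>i\<in>I. X i)"
    by (intro tensor11_add assms(1) VF_sum) auto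
  with insert show ?case
    by (simp only: sum.insert insert_iff simp_thms)
qed (simp only: sum.empty tensor_zero[OF assms(1)])

end

section \<open>Metrics and orthonormal frames\<close>

locale riemannian_manifold = manifold A
  for A :: "('a::{t2_space, second_countable_topology}, 'e::euclidean_space) chart set" +
  fixes g :: "'a metric"
  assumes riemannian_metric: "riemannian_metric A g"
begin

lemma g_one_form: "X \<in> VF \<Longrightarrow> one_form A (g X)"
  and g_sym: "X \<in> VF \<Longrightarrow> Y \<in> VF \<Longrightarrow> g X Y = g Y X"
  and g_pos: "X \<in> VF \<Longrightarrow> value_at X p \<noteq> 0 \<Longrightarrow> g X X p > 0"
  using riemannian_metric by (auto simp: riemannian_metric_def)

lemma g_SF: "X \<in> VF \<Longrightarrow> Y \<in> VF \<Longrightarrow> g X Y \<in> SF"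
  using g_one_form one_form_SF by blast

lemma g_right:
  assumes "Z \<in> VF"
  shows "X \<in> VF \<Longrightarrow> Y \<in> VF \<Longrightarrow> g Z (X + Y) p = g Z X p + g Z Y p"
    "X \<in> VF \<Longrightarrow> Y \<in> VF \<Longrightarrow> g Z (X - Y) p = g Z X p - g Z Y p"
    "X \<in> VF \<Longrightarrow> g Z (- X) p = - g Z X p"
    "X \<in> VF \<Longrightarrow> \<phi> \<in> SF \<Longrightarrow> g Z (\<phi> \<star> X) p = \<phi> p * g Z X p"
    "X \<in> VF \<Longrightarrow> g Z (c *\<^sub>R X) p = c * g Z X p"
    "g Z 0 p = 0"
    "(\<And>i. i \<in> I \<Longrightarrow> F i \<in> VF) \<Longrightarrow> g Z (\<Sum>i\<in>I. F i) p = (\<Sum>i\<in>I. g Z (F i) p)"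
  using g_one_form[OF assms] one_form_scaleR[OF g_one_form[OF assms], of X "- 1"]
  by (simp_all add: one_form_add one_form_diff one_form_fscale one_form_scaleR one_form_zero one_form_sum)

lemma g_left:
  assumes "Z \<in> VF"
  shows "X \<in> VF \<Longrightarrow> Y \<in> VF \<Longrightarrow> g (X + Y) Z p = g X Z p + g Y Z p"
    "X \<in> VF \<Longrightarrow> Y \<in> VF \<Longrightarrow> g (X - Y) Z p = g X Z p - g Y Z p"
    "X \<in> VF \<Longrightarrow> g (- X) Z p = - g X Z p"
    "X \<in> VF \<Longrightarrow> \<phi> \<in> SF \<Longrightarrow> g (\<phi> \<star> X) Z p = \<phi> p * g X Z p"
    "X \<in> VF \<Longrightarrow> g (c *\<^sub>R X) Z p = c * g X Z p"
    "g 0 Z p = 0"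
    "(\<And>i. i \<in> I \<Longrightarrow> F i \<in> VF) \<Longrightarrow> g (\<Sum>i\<in>I. F i) Z p = (\<Sum>i\<in>I. g (F i) Z p)"
  by (simp_all add: g_sym[OF _ assms] g_right[OF assms] VF_intros)

lemma g_pointwise:
  assumes "X \<in> VF" "Y \<in> VF" "Z \<in> VF" "value_at X p = value_at Y p"
  shows "g X Z p = g Y Z p"
  using one_form_pointwise[OF g_one_form[OF assms(3)] assms(1,2,4)] assms by (simp add: g_sym)

text \<open>Nondegeneracy: if the values differed, testing against \<open>X - Y\<close> itself would
  contradict positivity.\<close>

lemma value_at_eqI:
  assumes "X \<in> VF" "Y \<in> VF" "\<And>Z. Z \<in> VF \<Longrightarrow> g X Z p = g Y Z p"
  shows "value_at X p = value_at Y p"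
proof (rule ccontr)
  assume "value_at X p \<noteq> value_at Y p"
  then have "g (X - Y) (X - Y) p > 0"
    using assms by (intro g_pos) (auto simp: VF_intros value_at_simps)
  then show False
    using assms by (simp add: g_left VF_intros)
qed

lemma VF_eqI:
  assumes "X \<in> VF" "Y \<in> VF" "\<And>Z p. Z \<in> VF \<Longrightarrow> g X Z p = g Y Z p"
  shows "X = Y"
  using assms by (intro vfield_eqI value_at_eqI)

text \<open>Pairing a linear relation with \<open>F j\<close> isolates its j-th coefficient. The
  resulting bound on the number of orthogonal fields is what later shows that an orthonormal family
  of full size spans.\<close>

lemma orthogonal_independent:
  fixes F :: "nat \<Rightarrow> 'a vfield"
  assumes F: "\<And>i. i < k \<Longrightarrow> F i \<in> VF"
    and orth: "\<And>i j. i < k \<Longrightarrow> j < k \<Longrightarrow> i \<noteq> j \<Longrightarrow> g (F i) (F j) p = 0"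
    and pos: "\<And>i. i < k \<Longrightarrow> g (F i) (F i) p > 0"
  shows "k \<le> DIM('e)"
proof -
  let ?e = "\<lambda>i. value_at (F i) p"
  obtain C where C: "finite C" "span C = tangent_space A p" "card C = DIM('e)"
    using tangent_basis[of p] by metis
  have inj: "inj_on ?e {..<k}"
  proof (rule inj_onI, rule ccontr)
    fix i j assume *: "i \<in> {..<k}" "j \<in> {..<k}" "?e i = ?e j" "i \<noteq> j"
    then have "g (F i) (F i) p = g (F j) (F i) p"
      using F by (intro g_pointwise) auto
    with * orth[of j i] pos[of i] show False by auto
  qed
  have "independent (?e ` {..<k})"
  proof (rule ccontr)
    assume "\<not> independent (?e ` {..<k})"
    then obtain u where u: "\<exists>v\<in>?e ` {..<k}. u v \<noteq> 0" "(\<Sum>v\<in>?e ` {..<k}. u v *\<^sub>R v) = 0"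
      by (auto simp: dependent_finite)
    let ?W = "\<Sum>i<k. u (?e i) *\<^sub>R F i"
    have W: "?W \<in> VF" using F by (intro VF_intros) auto
    have W0: "value_at ?W p = value_at 0 p"
      using u(2) by (simp add: sum.reindex[OF inj] o_def value_at_simps)
    have "u (?e j) = 0" if j: "j < k" for j
    proof -
      have "0 = g ?W (F j) p"
        using g_pointwise[OF W VF_zero F[OF j] W0] F[OF j] by (simp add: g_left)
      also have "\<dots> = (\<Sum>i<k. g (u (?e i) *\<^sub>R F i) (F j) p)"
        using F j by (intro g_left VF_intros) auto
      also have "\<dots> = (\<Sum>i<k. u (?e i) * g (F i) (F j) p)"
        using F j by (intro sum.cong g_left) auto
      also have "\<dots> = (\<Sum>i<k. if i = j then u (?e j) * g (F j) (F j) p else 0)"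
        using orth j by (intro sum.cong) auto
      also have "\<dots> = u (?e j) * g (F j) (F j) p" using j by simp
      finally show ?thesis using pos[OF j] by simp
    qed
    with u(1) show False by auto
  qed
  moreover have "?e ` {..<k} \<subseteq> span C"
    using F C(2) by (auto intro: value_at_tangent)
  ultimately have "card (?e ` {..<k}) \<le> DIM('e)"
    using independent_span_bound C by metis
  then show ?thesis by (simp add: card_image[OF inj])
qed

text \<open>Global fields, orthonormal at a single point: traces are evaluated point by point and
  need no more. The length \<open>k\<close> is kept free for the Gram-Schmidt induction.\<close>

definition orthonormal_at :: "'a \<Rightarrow> nat \<Rightarrow> (nat \<Rightarrow> 'a vfield) \<Rightarrow> bool" where
  "orthonormal_at p k E \<longleftrightarrow> (\<forall>i<k. E i \<in> VF) \<and>
     (\<forall>i<k. \<forall>j<k. g (E i) (E j) p = (if i = j then 1 else 0))"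

lemma orthonormal_at_VF: "orthonormal_at p k E \<Longrightarrow> i < k \<Longrightarrow> E i \<in> VF"
  and orthonormal_at_g: "orthonormal_at p k E \<Longrightarrow> i < k \<Longrightarrow> j < k \<Longrightarrow> g (E i) (E j) p = (if i = j then 1 else 0)"
  by (auto simp: orthonormal_at_def)

text \<open>The coefficients \<open>\<phi> i\<close> are prescribed only at \<open>p\<close>. This
  covers constant coefficients, used for expansions at one point, as well as the functions
  \<open>g X (E i)\<close>, used for Gram-Schmidt on a neighbourhood.\<close>

lemma orthonormal_projection:
  assumes E: "orthonormal_at p k E" and X: "X \<in> VF" and j: "j < k"
    and \<phi>: "\<And>i. i < k \<Longrightarrow> \<phi> i \<in> SF" "\<And>i. i < k \<Longrightarrow> \<phi> i p = g X (E i) p"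
  shows "g (X - (\<Sum>i<k. \<phi> i \<star> E i)) (E j) p = 0"
proof -
  note VF = orthonormal_at_VF[OF E]
  have "g (X - (\<Sum>i<k. \<phi> i \<star> E i)) (E j) p = g X (E j) p - g (\<Sum>i<k. \<phi> i \<star> E i) (E j) p"
    using VF X j \<phi>(1) by (intro g_left VF_intros) auto
  also have "g (\<Sum>i<k. \<phi> i \<star> E i) (E j) p = (\<Sum>i<k. g (\<phi> i \<star> E i) (E j) p)"
    using VF j \<phi>(1) by (intro g_left VF_intros) auto
  also have "\<dots> = (\<Sum>i<k. \<phi> i p * g (E i) (E j) p)"
    using VF j \<phi>(1) by (intro sum.cong g_left) auto
  also have "(\<Sum>i<k. \<phi> i p * g (E i) (E j) p) = (\<Sum>i<k. if i = j then g X (E j) p else 0)"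
    using orthonormal_at_g[OF E _ j] \<phi>(2) by (intro sum.cong) auto
  also have "\<dots> = g X (E j) p" using j by simp
  finally show ?thesis by (simp only: diff_self)
qed

text \<open>The remainder \<open>Y\<close> is orthogonal to all \<open>E i\<close> at
  \<open>p\<close>. If it did not vanish there, it would extend them to \<open>DIM('e) + 1\<close>
  orthogonal vectors, one more than the tangent space admits.\<close>

lemma orthonormal_expand:
  assumes E: "orthonormal_at p DIM('e) E" and X: "X \<in> VF"
  shows "value_at X p = (\<Sum>i<DIM('e). g X (E i) p *\<^sub>R value_at (E i) p)"
proof -
  note VF = orthonormal_at_VF[OF E]
  define Y where "Y = X - (\<Sum>i<DIM('e). (\<lambda>_. g X (E i) p) \<star> E i)"
  have Y: "Y \<in> VF" unfolding Y_def using VF X by (intro VF_intros SF_intros) auto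
  have Y0: "g Y (E j) p = 0" if "j < DIM('e)" for j
    unfolding Y_def by (rule orthonormal_projection[OF E X that]) (auto intro: SF_intros)
  have "value_at Y p = 0"
  proof (rule ccontr)
    assume "value_at Y p \<noteq> 0"
    then have "g Y Y p > 0" by (rule g_pos[OF Y])
    moreover have "g (E j) Y p = 0" if "j < DIM('e)" for j
      using Y0[OF that] g_sym[OF Y VF[OF that]] by simp
    ultimately have "Suc DIM('e) \<le> DIM('e)"
      using Y0 Y VF orthonormal_at_g[OF E]
      by (intro orthogonal_independent[where F="E(DIM('e) := Y)" and p=p])
        (auto simp: less_Suc_eq)
    then show False by simp
  qed
  then show ?thesis
    by (simp add: Y_def value_at_simps)
qed

lemma one_form_expand:
  assumes E: "orthonormal_at p DIM('e) E" and X: "X \<in> VF" and \<omega>: "one_form A \<omega>"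
  shows "\<omega> X p = (\<Sum>i<DIM('e). g X (E i) p * \<omega> (E i) p)"
proof -
  note VF = orthonormal_at_VF[OF E]
  have "\<omega> X p = \<omega> (\<Sum>i<DIM('e). g X (E i) p *\<^sub>R E i) p"
    using VF X orthonormal_expand[OF E X]
    by (intro one_form_pointwise[OF \<omega>] VF_intros) (auto simp: value_at_simps)
  also have "\<omega> (\<Sum>i<DIM('e). g X (E i) p *\<^sub>R E i) = (\<Sum>i<DIM('e). \<omega> (g X (E i) p *\<^sub>R E i))"
    using VF by (intro one_form_sum[OF \<omega>] VF_intros) auto
  also have "\<dots> p = (\<Sum>i<DIM('e). g X (E i) p * \<omega> (E i) p)"
    using VF by (simp add: one_form_scaleR[OF \<omega>])
  finally show ?thesis .
qed

lemma tensor11_compose: "tensor11 A S \<Longrightarrow> tensor11 A T \<Longrightarrow> tensor11 A (\<lambda>X. S (T X))"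
  unfolding tensor11_def by metis

lemma tensor11_g_one_form:
  assumes T: "tensor11 A T" and W: "W \<in> VF"
  shows "one_form A (\<lambda>Z. g (T Z) W)"
  unfolding one_form_def
proof (intro conjI ballI)
  fix X assume X: "X \<in> VF"
  note TX = tensor11_VF[OF T X]
  show "g (T X) W \<in> SF" using g_SF[OF TX W] .
  show "g (T (X + Y)) W = g (T X) W + g (T Y) W" if "Y \<in> VF" for Y
    using g_left(1)[OF W TX tensor11_VF[OF T that]]
    by (simp add: fun_eq_iff tensor11_add[OF T X that])
  show "g (T (\<phi> \<star> X)) W = \<phi> * g (T X) W" if "\<phi> \<in> SF" for \<phi>
    using g_left(4)[OF W TX that] by (simp add: fun_eq_iff tensor11_fscale[OF T that X])
qed

lemma tensor_trace_orthonormal: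
  assumes E: "orthonormal_at p DIM('e) E" and T: "tensor11 A T"
  shows "tensor_trace A T p = (\<Sum>i<DIM('e). g (T (E i)) (E i) p)"
proof -
  note VF = orthonormal_at_VF[OF E]
  obtain C where C: "finite C" "independent C" "span C = tangent_space A p"
    using tangent_basis[of p] by metis
  \<comment> \<open>The component along \<open>E i\<close>, computed with a chosen extension of
    \<open>v\<close>; \<open>g_pointwise\<close> makes it independent of the choice.\<close>
  define l where "l i v = g (SOME V. V \<in> VF \<and> value_at V p = v) (E i) p" for i v
  have l: "l i (value_at X p) = g X (E i) p" if "X \<in> VF" "i < DIM('e)" for i X
    unfolding l_def
    using tangent_extension[OF value_at_tangent[OF that(1)], of p] that VF
    by (intro g_pointwise) auto
  have "endo_trace (tangent_space A p) (tensor_at A T p) =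
      (\<Sum>i\<in>{..<DIM('e)}. (if i < DIM('e) then l i else (\<lambda>_. 0)) (tensor_at A T p (value_at (E i) p)))"
  proof (rule endo_trace_frame[OF C finite_lessThan])
    fix v w c i assume "v \<in> tangent_space A p"
    then obtain X where X: "X \<in> VF" "v = value_at X p" using tangent_extend by blast
    show "tensor_at A T p v \<in> tangent_space A p"
      using X T by (simp add: tensor_at_value value_at_tangent tensor11_VF)
    have c: "T (c *\<^sub>R X) = c *\<^sub>R T X"
      using tensor11_fscale[OF T SF_const[of c] X(1)] by (simp add: const_fscale)
    show "tensor_at A T p (c *\<^sub>R v) = c *\<^sub>R tensor_at A T p v"
      using tensor_at_value[OF T, of "c *\<^sub>R X" p] X T
      by (simp add: value_at_simps VF_intros c tensor_at_value)
    show "(if i < DIM('e) then l i else (\<lambda>_. 0)) (c *\<^sub>R v) = c * (if i < DIM('e) then l i else (\<lambda>_. 0)) v"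
      using l[of "c *\<^sub>R X" i] X VF by (simp add: value_at_simps VF_intros g_left l)
    have "(\<Sum>i<DIM('e). l i v *\<^sub>R value_at (E i) p) = (\<Sum>i<DIM('e). g X (E i) p *\<^sub>R value_at (E i) p)"
      using X by (intro sum.cong) (auto simp: l)
    then have "v = (\<Sum>i<DIM('e). l i v *\<^sub>R value_at (E i) p)"
      using orthonormal_expand[OF E X(1)] X(2) by simp
    then show "v = (\<Sum>i<DIM('e). (if i < DIM('e) then l i else (\<lambda>_. 0)) v *\<^sub>R value_at (E i) p)"
      by simp
    assume "w \<in> tangent_space A p"
    then obtain Y where Y: "Y \<in> VF" "w = value_at Y p" using tangent_extend by blast
    show "tensor_at A T p (v + w) = tensor_at A T p v + tensor_at A T p w"
      using tensor_at_value[OF T, of "X + Y" p] X Y T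
      by (simp add: value_at_simps VF_intros tensor11_add[OF T] tensor_at_value)
    show "(if i < DIM('e) then l i else (\<lambda>_. 0)) (v + w) =
        (if i < DIM('e) then l i else (\<lambda>_. 0)) v + (if i < DIM('e) then l i else (\<lambda>_. 0)) w"
      using l[of "X + Y" i] X Y VF by (simp add: value_at_simps VF_intros g_left l)
  next
    fix i assume "i \<in> {..<DIM('e)}"
    then show "value_at (E i) p \<in> tangent_space A p"
      using VF by (simp add: value_at_tangent)
  qed
  also have "\<dots> = (\<Sum>i<DIM('e). g (T (E i)) (E i) p)"
    using VF T by (intro sum.cong) (auto simp: tensor_at_value l tensor11_VF)
  finally show ?thesis by (simp add: tensor_trace_def)
qed

text \<open>Gram-Schmidt on a shrinking neighbourhood. The difficulty is that frame members must be
  global fields, whereas the remainder \<open>W\<close> may vanish away from \<open>p\<close>, so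
  that dividing by its length is impossible. Multiplication by the globally smooth function
  \<open>u (g Z Z)\<close> normalizes only where \<open>g Z Z\<close> exceeds 3/4, which is
  enough.\<close>

lemma local_orthonormal_basis_exists:
  "\<exists>E. local_orthonormal_basis A g p E"
proof -
  text \<open>A globally smooth function that agrees with \<open>x powr (-1/2)\<close> for \<open>x > 3/4\<close>: the base
    \<open>x\<^sup>2 + flat (3/4 - x)\<close> is positive everywhere.\<close>
  define u where "u x = (x * x + flat (3/4 + (-1) * x)) powr (-1/4)" for x :: real
  have base: "x * x + flat (3/4 + (-1) * x) > 0" for x
  proof (cases "x = 0")
    case False
    then have "x * x > 0" by (metis not_real_square_gt_zero)
    then show ?thesis
      using flat_nonneg[of "3/4 + (-1) * x"] by linarith
  qed (simp add: flat_pos)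
  have "Cinf_on (\<lambda>x::real. 3/4 + (-1) * x) UNIV"
    unfolding Cinf_on_def by (intro allI Ck_on_add Ck_on_mult Ck_on_const Ck_on_id open_UNIV)
  then have "Cinf_on (\<lambda>x. flat (3/4 + (-1) * x)) UNIV"
    by (rule Cinf_on_compose[OF open_UNIV open_UNIV _ Cinf_on_flat, rotated]) blast
  then have "Cinf_on (\<lambda>x. x * x + flat (3/4 + (-1) * x)) UNIV"
    unfolding Cinf_on_def by (intro allI Ck_on_add Ck_on_mult Ck_on_id open_UNIV) blast
  then have u: "Cinf_on u UNIV"
    unfolding u_def by (rule Cinf_on_compose[OF open_UNIV open_greaterThan _ Cinf_on_powr, rotated])
      (use base in auto)
  have u_eq: "u x * u x * x = 1" if "x > 3/4" for x
  proof -
    have "u x = (x powr 2) powr (-1/4)"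
      using that by (simp add: u_def flat_0 powr_numeral power2_eq_square)
    then have "u x = x powr (-1/2)"
      by (simp add: powr_powr)
    then have "u x * u x = x powr (-1)" by (simp flip: powr_add)
    then show ?thesis using that by (simp add: powr_minus)
  qed
  have "\<exists>E U. open U \<and> p \<in> U \<and> (\<forall>q\<in>U. orthonormal_at q k E)" if "k \<le> DIM('e)" for k
    using that
  proof (induction k)
    case 0
    then show ?case by (auto simp: orthonormal_at_def intro: exI[of _ UNIV])
  next
    case (Suc k)
    then obtain E U where U: "open U" "p \<in> U" and E: "\<And>q. q \<in> U \<Longrightarrow> orthonormal_at q k E"
      by auto
    note VF = orthonormal_at_VF[OF E[OF U(2)]]
    obtain C where C: "independent C" "span C = tangent_space A p" "card C = DIM('e)"
      using tangent_basis[of p] by metis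
    have "\<exists>v \<in> tangent_space A p. v \<notin> span ((\<lambda>i. value_at (E i) p) ` {..<k})"
    proof (rule ccontr)
      assume "\<not> ?thesis"
      then have "C \<subseteq> span ((\<lambda>i. value_at (E i) p) ` {..<k})"
        using C(2) span_superset[of C] by blast
      then have "card C \<le> card ((\<lambda>i. value_at (E i) p) ` {..<k})"
        using independent_span_bound[OF _ C(1)] by blast
      also have "\<dots> \<le> k" using card_image_le[of "{..<k}"] by auto
      finally show False using C(3) Suc.prems by simp
    qed
    then obtain V where V: "V \<in> VF" "value_at V p \<notin> span ((\<lambda>i. value_at (E i) p) ` {..<k})"
      using tangent_extend by blast
    define W where "W = V - (\<Sum>i<k. g V (E i) \<star> E i)"
    have W: "W \<in> VF" unfolding W_def using VF V by (intro VF_intros g_SF) auto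
    have "value_at W p \<noteq> 0"
    proof
      assume "value_at W p = 0"
      then have "value_at V p = (\<Sum>i<k. g V (E i) p *\<^sub>R value_at (E i) p)"
        by (simp add: W_def value_at_simps)
      then show False
        using V(2) by (auto intro!: span_sum span_scale intro: span_base)
    qed
    then have pos: "g W W p > 0" by (rule g_pos[OF W])
    \<comment> \<open>A constant rescaling makes \<open>g Z Z\<close> equal to 1 at
      \<open>p\<close>, hence larger than 3/4 near \<open>p\<close>.\<close>
    define Z where "Z = (1 / sqrt (g W W p)) *\<^sub>R W"
    have Z: "Z \<in> VF" unfolding Z_def using W by (intro VF_intros)
    have Zp: "g Z Z p = 1"
      unfolding Z_def using W pos by (simp add: g_left g_right VF_intros)
    define Y where "Y = (\<lambda>q. u (g Z Z q)) \<star> Z"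
    have uSF: "(\<lambda>q. u (g Z Z q)) \<in> SF"
      by (rule SF_compose[OF u]) (use Z g_SF in auto)
    have Y: "Y \<in> VF" unfolding Y_def using uSF Z by (intro VF_intros)
    define U' where "U' = U \<inter> {q. g Z Z q > 3/4}"
    have "open {q. g Z Z q > 3/4}"
      by (intro open_Collect_less continuous_on_const SF_continuous g_SF Z)
    then have U': "open U'" "p \<in> U'"
      using U Zp by (auto simp: U'_def)
    have "orthonormal_at q (Suc k) (E(k := Y))" if q: "q \<in> U'" for q
    proof -
      have Eq: "orthonormal_at q k E" and gq: "g Z Z q > 3/4" using q E by (auto simp: U'_def)
      have YY: "g Y Y q = 1"
        using u_eq[OF gq] uSF Z by (simp add: Y_def g_left g_right VF_intros mult.assoc)
      have "g W (E j) q = 0" if "j < k" for j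
        unfolding W_def by (rule orthonormal_projection[OF Eq V(1) that]) (use VF V g_SF in auto)
      then have YE: "g Y (E j) q = 0" if "j < k" for j
        using that uSF Z W VF by (simp add: Y_def Z_def g_left VF_intros)
      then have "g (E j) Y q = 0" if "j < k" for j
        using that g_sym[OF Y VF] by simp
      with YY YE Eq Y show ?thesis
        by (auto simp: orthonormal_at_def less_Suc_eq)
    qed
    with U' show ?case by blast
  qed
  then obtain E U where U: "open U" "p \<in> U" and E: "\<And>q. q \<in> U \<Longrightarrow> orthonormal_at q DIM('e) E"
    by (meson order_refl)
  have "local_orthonormal_basis A g p E"
    unfolding local_orthonormal_basis_def
    using U orthonormal_at_VF[OF E[OF U(2)]] orthonormal_at_g[OF E] by blast
  then show ?thesis by blast
qed

lemma local_orthonormal_basis_at: "local_orthonormal_basis A g p E \<Longrightarrow> orthonormal_at p DIM('e) E"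
  by (auto simp: local_orthonormal_basis_def orthonormal_at_def)

end

section \<open>Curvature\<close>

locale levi_civita_manifold = riemannian_manifold A g
  for A :: "('a::{t2_space, second_countable_topology}, 'e::euclidean_space) chart set"
    and g :: "'a metric" +
  fixes N :: "'a vfield \<Rightarrow> 'a vfield \<Rightarrow> 'a vfield"
  assumes levi_civita: "levi_civita A g N"
begin

lemma N_tensor11: "Y \<in> VF \<Longrightarrow> tensor11 A (\<lambda>X. N X Y)"
  and N_right_add: "X \<in> VF \<Longrightarrow> Y \<in> VF \<Longrightarrow> Z \<in> VF \<Longrightarrow> N X (Y + Z) = N X Y + N X Z"
  and N_right_fscale: "\<phi> \<in> SF \<Longrightarrow> X \<in> VF \<Longrightarrow> Y \<in> VF \<Longrightarrow> N X (\<phi> \<star> Y) = X \<phi> \<star> Y + \<phi> \<star> N X Y"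
  and N_torsion: "X \<in> VF \<Longrightarrow> Y \<in> VF \<Longrightarrow> lie_bracket X Y = N X Y - N Y X"
  and N_metric: "X \<in> VF \<Longrightarrow> Y \<in> VF \<Longrightarrow> Z \<in> VF \<Longrightarrow> X (g Y Z) = g (N X Y) Z + g Y (N X Z)"
  using levi_civita unfolding levi_civita_def by (blast, blast, blast, metis, blast)

lemma N_VF: "X \<in> VF \<Longrightarrow> Y \<in> VF \<Longrightarrow> N X Y \<in> VF"
  using tensor11_VF[OF N_tensor11] .

lemma N_left_add: "X \<in> VF \<Longrightarrow> Y \<in> VF \<Longrightarrow> Z \<in> VF \<Longrightarrow> N (X + Y) Z = N X Z + N Y Z"
  and N_left_fscale: "\<phi> \<in> SF \<Longrightarrow> X \<in> VF \<Longrightarrow> Z \<in> VF \<Longrightarrow> N (\<phi> \<star> X) Z = \<phi> \<star> N X Z"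
  using tensor11_add[OF N_tensor11[of Z], of X Y] tensor11_fscale[OF N_tensor11[of Z], of \<phi> X]
  by blast+

lemma N_left_scaleR: "X \<in> VF \<Longrightarrow> Z \<in> VF \<Longrightarrow> N (c *\<^sub>R X) Z = c *\<^sub>R N X Z"
  using N_left_fscale[OF SF_const[of c]] by (simp only: const_fscale)

lemma N_left_diff:
  assumes "X \<in> VF" "Y \<in> VF" "Z \<in> VF"
  shows "N (X - Y) Z = N X Z - N Y Z"
  using N_left_add[OF assms(1) VF_uminus[OF assms(2)] assms(3)] N_left_scaleR[OF assms(2,3), of "- 1"]
  by (simp only: scaleR_minus1_left add_uminus_conv_diff)

lemma VF_const:
  assumes "X \<in> VF"
  shows "X (\<lambda>_. c) = 0"
  using tangent_const[OF value_at_tangent[OF assms]]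
  by (simp only: value_at_def fun_eq_iff zero_fun_apply simp_thms)

lemma N_right_scaleR:
  assumes "X \<in> VF" "Y \<in> VF"
  shows "N X (c *\<^sub>R Y) = c *\<^sub>R N X Y"
proof -
  have "N X (c *\<^sub>R Y) = X (\<lambda>_. c) \<star> Y + c *\<^sub>R N X Y"
    using N_right_fscale[OF SF_const[of c] assms] by (simp only: const_fscale)
  also have "X (\<lambda>_. c) \<star> Y = 0"
    by (simp add: VF_const[OF assms(1)] fun_eq_iff fscale_apply)
  finally show ?thesis by (simp only: add_0_left)
qed

lemma N_right_diff:
  assumes "X \<in> VF" "Y \<in> VF" "Z \<in> VF"
  shows "N X (Y - Z) = N X Y - N X Z"
  using N_right_add[OF assms(1,2) VF_uminus[OF assms(3)]] N_right_scaleR[OF assms(1,3), of "- 1"]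
  by (simp only: scaleR_minus1_left add_uminus_conv_diff)

lemma N_right_zero: "X \<in> VF \<Longrightarrow> N X 0 = 0"
  using N_right_scaleR[OF _ VF_zero, of X 0] by (simp only: scaleR_zero_left)

lemma N_right_sum:
  assumes "X \<in> VF" "\<And>i. i \<in> I \<Longrightarrow> Y i \<in> VF"
  shows "N X (\<Sum>i\<in>I. Y i) = (\<Sum>i\<in>I. N X (Y i))"
  using assms(2)
proof (induction I rule: infinite_finite_induct)
  case (insert i I)
  then have "N X (Y i + (\<Sum>i\<in>I. Y i)) = N X (Y i) + N X (\<Sum>i\<in>I. Y i)"
    by (intro N_right_add assms(1) VF_sum) auto
  with insert show ?case
    by (simp only: sum.insert insert_iff simp_thms)
qed (simp_all only: sum.infinite sum.empty N_right_zero[OF assms(1)] not_False_eq_True)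

lemma lie_bracket_fscale:
  assumes "X \<in> VF" "Y \<in> VF" "\<phi> \<in> SF"
  shows "lie_bracket (\<phi> \<star> X) Y = \<phi> \<star> lie_bracket X Y - Y \<phi> \<star> X"
proof (rule HOL.ext)
  fix h
  show "lie_bracket (\<phi> \<star> X) Y h = (\<phi> \<star> lie_bracket X Y - Y \<phi> \<star> X) h"
  proof (cases "h \<in> SF")
    case True
    have "Y (\<phi> * X h) = Y \<phi> * X h + \<phi> * Y (X h)"
      by (rule VF_times[OF assms(2,3) VF_apply[OF assms(1) True]])
    then show ?thesis
      by (simp add: fun_eq_iff lie_bracket_def fscale_apply algebra_simps)
  next
    case False
    show ?thesis
      using VF_outside[OF VF_lie_bracket[OF VF_fscale[OF assms(3,1)] assms(2)] False]
        VF_outside[OF VF_lie_bracket[OF assms(1,2)] False] VF_outside[OF assms(1) False]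
      by (simp add: fun_eq_iff fscale_apply)
  qed
qed

text \<open>Obtained from the torsion-free identity and additivity of the connection, without
  evaluating on functions.\<close>

lemma lie_bracket_add:
  assumes "X \<in> VF" "Y \<in> VF" "Z \<in> VF"
  shows "lie_bracket (X + Y) Z = lie_bracket X Z + lie_bracket Y Z"
  by (simp only: N_torsion VF_add assms N_left_add N_right_add) (simp add: algebra_simps)

lemma Jacobi:
  assumes "X \<in> VF" "Y \<in> VF" "Z \<in> VF"
  shows "lie_bracket X (lie_bracket Y Z) + lie_bracket Y (lie_bracket Z X)
     + lie_bracket Z (lie_bracket X Y) = 0"
proof (rule HOL.ext)
  fix h
  show "(lie_bracket X (lie_bracket Y Z) + lie_bracket Y (lie_bracket Z X)
     + lie_bracket Z (lie_bracket X Y)) h = 0 h"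
  proof (cases "h \<in> SF")
    case True
    then have "U (V (W h) - W (V h)) = U (V (W h)) - U (W (V h))"
      if "U \<in> VF" "V \<in> VF" "W \<in> VF" for U V W
      using that by (intro VF_minus_apply VF_apply[of V] VF_apply[of W])
    note 1 = this[OF assms] this[OF assms(2,3,1)] this[OF assms(3,1,2)]
    show ?thesis
      by (simp add: lie_bracket_def 1)
  next
    case False
    show ?thesis
      by (simp only: plus_fun_apply VF_outside[OF VF_lie_bracket[OF _ VF_lie_bracket] False] assms
          zero_fun_apply add_0_left)
  qed
qed

section \<open>Symmetries of the curvature tensor\<close>

abbreviation "R \<equiv> curvature N"

lemma R_VF: "X \<in> VF \<Longrightarrow> Y \<in> VF \<Longrightarrow> Z \<in> VF \<Longrightarrow> R X Y Z \<in> VF"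
  unfolding curvature_def by (intro VF_diff N_VF VF_lie_bracket)

lemma R_skew12:
  assumes "X \<in> VF" "Y \<in> VF" "Z \<in> VF"
  shows "R X Y Z = - R Y X Z"
proof -
  have "lie_bracket Y X = (- 1) *\<^sub>R lie_bracket X Y"
    by (simp add: fun_eq_iff lie_bracket_def)
  then have "N (lie_bracket Y X) Z = - N (lie_bracket X Y) Z"
    using N_left_scaleR[OF VF_lie_bracket[OF assms(1,2)] assms(3), of "- 1"] by (simp only: scaleR_minus1_left)
  then show ?thesis
    by (simp only: curvature_def) (simp only: minus_diff_eq diff_minus_eq_add diff_diff_eq2 algebra_simps)
qed

text \<open>The term \<open>Y \<phi> \<star> N X Z\<close> arises twice, from differentiating
  \<open>\<phi>\<close> and from the bracket of \<open>\<phi> \<star> X\<close> with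
  \<open>Y\<close>, and cancels.\<close>

lemma R_left_tensor11:
  assumes "Y \<in> VF" "Z \<in> VF"
  shows "tensor11 A (\<lambda>X. R X Y Z)"
  unfolding tensor11_def
proof (intro conjI ballI)
  fix X assume X: "X \<in> VF"
  then show "R X Y Z \<in> VF" using assms by (rule R_VF)
  show "R (X + X') Y Z = R X Y Z + R X' Y Z" if X': "X' \<in> VF" for X'
    using X X' assms
    by (simp only: curvature_def lie_bracket_add N_left_add N_right_add N_VF VF_lie_bracket)
      (simp only: algebra_simps)
  show "R (\<phi> \<star> X) Y Z = \<phi> \<star> R X Y Z" if \<phi>: "\<phi> \<in> SF" for \<phi>
  proof -
    have "Y \<phi> \<in> SF" using VF_apply[OF assms(1) \<phi>] .
    then have "R (\<phi> \<star> X) Y Z = \<phi> \<star> N X (N Y Z) - (Y \<phi> \<star> N X Z + \<phi> \<star> N Y (N X Z))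
        - (\<phi> \<star> N (lie_bracket X Y) Z - Y \<phi> \<star> N X Z)"
      using X assms \<phi>
      by (simp only: curvature_def lie_bracket_fscale N_left_diff N_left_fscale N_right_fscale
          N_VF VF_lie_bracket VF_fscale)
    also have "\<dots> = \<phi> \<star> R X Y Z"
      by (simp add: fun_eq_iff curvature_def fscale_apply algebra_simps)
    finally show ?thesis .
  qed
qed

text \<open>Apply the bracket of \<open>X\<close> and \<open>Y\<close> to the function
  \<open>g Z W\<close> and expand by metric compatibility. The mixed first-order terms are symmetric
  in \<open>X\<close> and \<open>Y\<close> and drop out of the commutator.\<close>

lemma R_skew34:
  assumes "X \<in> VF" "Y \<in> VF" "Z \<in> VF" "W \<in> VF"
  shows "g (R X Y Z) W p = - g (R X Y W) Z p"
proof -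
  have second: "U (V (g Z W)) p = g (N U (N V Z)) W p + g (N V Z) (N U W) p
      + g (N U Z) (N V W) p + g Z (N U (N V W)) p" if "U \<in> VF" "V \<in> VF" for U V
  proof -
    have "U (V (g Z W)) = U (g (N V Z) W) + U (g Z (N V W))"
      unfolding N_metric[OF that(2) assms(3,4)]
      using that assms by (intro VF_plus[OF that(1)] g_SF N_VF)
    then show ?thesis
      using that assms by (simp add: N_metric N_VF)
  qed
  have "lie_bracket X Y (g Z W) p = g (N (lie_bracket X Y) Z) W p + g Z (N (lie_bracket X Y) W) p"
    using N_metric[OF VF_lie_bracket[OF assms(1,2)] assms(3,4)] by simp
  then have "g (N (lie_bracket X Y) Z) W p + g Z (N (lie_bracket X Y) W) p =
      X (Y (g Z W)) p - Y (X (g Z W)) p"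
    by (simp add: lie_bracket_def)
  then show ?thesis
    using assms second[OF assms(1,2)] second[OF assms(2,1)]
    by (simp add: curvature_def g_left N_VF VF_diff VF_lie_bracket g_sym[OF assms(3)])
qed

text \<open>Regrouped by the outer derivative, each triple of terms is an iterated bracket because
  the torsion vanishes; the sum is then the Jacobi identity.\<close>

lemma R_Bianchi:
  assumes "X \<in> VF" "Y \<in> VF" "Z \<in> VF"
  shows "R X Y Z + R Y Z X + R Z X Y = 0"
proof -
  have 1: "N U (N V W) - N U (N W V) - N (lie_bracket V W) U = lie_bracket U (lie_bracket V W)"
    if "U \<in> VF" "V \<in> VF" "W \<in> VF" for U V W
  proof -
    have "N U (lie_bracket V W) = N U (N V W) - N U (N W V)"
      using that by (simp only: N_torsion[of V W] N_right_diff N_VF)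
    then show ?thesis
      using N_torsion[OF that(1) VF_lie_bracket[OF that(2,3)]] by (simp only:)
  qed
  have "R X Y Z + R Y Z X + R Z X Y =
      (N X (N Y Z) - N X (N Z Y) - N (lie_bracket Y Z) X)
      + (N Y (N Z X) - N Y (N X Z) - N (lie_bracket Z X) Y)
      + (N Z (N X Y) - N Z (N Y X) - N (lie_bracket X Y) Z)"
    by (simp only: curvature_def algebra_simps)
  also have "\<dots> = 0"
    using assms by (simp only: 1 Jacobi)
  finally show ?thesis .
qed

lemma R_Bianchi_g:
  assumes "X \<in> VF" "Y \<in> VF" "Z \<in> VF" "W \<in> VF"
  shows "g (R X Y Z) W p + g (R Y Z X) W p + g (R Z X Y) W p = 0"
proof -
  have "g (R X Y Z + R Y Z X + R Z X Y) W p = 0"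
    using R_Bianchi[OF assms(1-3)] assms(4) by (simp only: g_left)
  then show ?thesis
    using assms by (simp only: g_left R_VF VF_add)
qed

lemma R_skew12_g:
  assumes "X \<in> VF" "Y \<in> VF" "Z \<in> VF" "W \<in> VF"
  shows "g (R X Y Z) W p = - g (R Y X Z) W p"
  using assms by (simp only: R_skew12[of X Y Z] g_left R_VF)

text \<open>The classical octahedron argument: the four Bianchi identities obtained by cycling the
  arguments, combined with skewness in each pair. What remains is linear arithmetic.\<close>

lemma R_pair_symmetry:
  assumes "X \<in> VF" "Y \<in> VF" "Z \<in> VF" "W \<in> VF"
  shows "g (R X Y Z) W p = g (R Z W X) Y p"
proof -
  note V = assms
  note b = R_Bianchi_g[OF V(1,2,3,4), of p] R_Bianchi_g[OF V(2,3,4,1), of p]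
    R_Bianchi_g[OF V(3,4,1,2), of p] R_Bianchi_g[OF V(4,1,2,3), of p]
  show ?thesis
    using b R_skew34[OF V(1,2,3,4), of p] R_skew34[OF V(2,3,1,4), of p] R_skew34[OF V(3,1,2,4), of p]
      R_skew34[OF V(3,4,2,1), of p] R_skew34[OF V(4,2,3,1), of p] R_skew34[OF V(4,1,3,2), of p]
      R_skew12_g[OF V(2,4,3,1), of p] R_skew12_g[OF V(1,3,2,4), of p] R_skew12_g[OF V(1,3,4,2), of p]
      R_skew12_g[OF V(4,2,1,3), of p] R_skew12_g[OF V(4,2,3,1), of p]
      R_skew34[OF V(2,4,1,3), of p] R_skew34[OF V(1,3,4,2), of p] R_skew34[OF V(1,2,4,3), of p]
    by linarith
qed

text \<open>Linearity over functions is transferred from the metric slot by skewness in the last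
  pair, which avoids second derivatives of \<open>\<phi>\<close>.\<close>

lemma R_right_tensor11:
  assumes "X \<in> VF" "Y \<in> VF"
  shows "tensor11 A (\<lambda>Z. R X Y Z)"
  unfolding tensor11_def
proof (intro conjI ballI)
  fix Z assume Z: "Z \<in> VF"
  then show "R X Y Z \<in> VF" using assms by (intro R_VF)
  show "R X Y (Z + Z') = R X Y Z + R X Y Z'" if "Z' \<in> VF" for Z'
    using Z that assms
    by (simp only: curvature_def N_right_add N_VF VF_lie_bracket) (simp only: algebra_simps)
  show "R X Y (\<phi> \<star> Z) = \<phi> \<star> R X Y Z" if "\<phi> \<in> SF" for \<phi>
  proof (rule VF_eqI)
    show "R X Y (\<phi> \<star> Z) \<in> VF" "\<phi> \<star> R X Y Z \<in> VF"
      using assms Z that by (intro R_VF VF_fscale; simp)+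
    fix W p assume W: "W \<in> VF"
    have "g (R X Y (\<phi> \<star> Z)) W p = - g (R X Y W) (\<phi> \<star> Z) p"
      using R_skew34[OF assms VF_fscale[OF that Z] W] .
    also have "\<dots> = g (\<phi> \<star> R X Y Z) W p"
      using assms Z that W R_skew34[OF assms Z W, of p] by (simp add: g_left g_right R_VF)
    finally show "g (R X Y (\<phi> \<star> Z)) W p = g (\<phi> \<star> R X Y Z) W p" .
  qed
qed

end

section \<open>Weak Kenmotsu structures\<close>

locale weak_Kenmotsu = manifold A
  for A :: "('a::{t2_space, second_countable_topology}, 'e::euclidean_space) chart set" +
  fixes n s :: nat and \<beta> :: real and f Q :: "'a vfield \<Rightarrow> 'a vfield"
    and \<xi> :: "nat \<Rightarrow> 'a vfield" and \<eta> :: "nat \<Rightarrow> 'a vfield \<Rightarrow> 'a \<Rightarrow> real"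
    and g :: "'a metric" and N :: "'a vfield \<Rightarrow> 'a vfield \<Rightarrow> 'a vfield"
  assumes Kenmotsu: "weak_beta_f_Kenmotsu A n s \<beta> f Q \<xi> \<eta> g N"
begin

sublocale levi_civita_manifold A g N
  using Kenmotsu
  by unfold_locales (auto simp: weak_beta_f_Kenmotsu_def weak_metric_f_structure_def)

section \<open>Algebra of the structure tensors\<close>

definition J :: "nat set" where "J = {1..s}"

lemma finite_J: "finite J" and card_J: "card J = s"
  by (simp_all add: J_def)

lemma dim: "DIM('e) = 2 * n + s"
  and f_tensor: "tensor11 A f" and Q_tensor: "tensor11 A Q"
  and f_skew: "X \<in> VF \<Longrightarrow> Y \<in> VF \<Longrightarrow> g (f X) Y = - g X (f Y)"
  and Q_sym: "X \<in> VF \<Longrightarrow> Y \<in> VF \<Longrightarrow> g (Q X) Y = g X (Q Y)"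
  and Q_bij: "bij_betw (tensor_at A Q p) (tangent_space A p) (tangent_space A p)"
  and \<xi>_VF: "i \<in> J \<Longrightarrow> \<xi> i \<in> VF" and \<eta>_one_form: "i \<in> J \<Longrightarrow> one_form A (\<eta> i)"
  and g_\<xi>: "i \<in> J \<Longrightarrow> j \<in> J \<Longrightarrow> g (\<xi> i) (\<xi> j) = (if i = j then 1 else 0)"
  and f_f: "X \<in> VF \<Longrightarrow> f (f X) = - Q X + (\<Sum>i\<in>J. \<eta> i X \<star> \<xi> i)"
  and \<eta>_\<xi>: "i \<in> J \<Longrightarrow> j \<in> J \<Longrightarrow> \<eta> i (\<xi> j) = (if i = j then 1 else 0)"
  and Q_\<xi>: "i \<in> J \<Longrightarrow> Q (\<xi> i) = \<xi> i"
  and g_f_f: "X \<in> VF \<Longrightarrow> Y \<in> VF \<Longrightarrow> g (f X) (f Y) = g X (Q Y) - (\<Sum>i\<in>J. \<eta> i X * \<eta> i Y)"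
  using Kenmotsu unfolding weak_beta_f_Kenmotsu_def weak_metric_f_structure_def J_def
  by blast+

lemma normal: "X \<in> VF \<Longrightarrow> Y \<in> VF \<Longrightarrow>
    nijenhuis f X Y + 2 *\<^sub>R (\<Sum>i\<in>J. ext_deriv (\<eta> i) X Y \<star> \<xi> i) = 0"
  using Kenmotsu unfolding weak_beta_f_Kenmotsu_def normal_f_structure_def J_def by blast

lemma N_f: "X \<in> VF \<Longrightarrow> Y \<in> VF \<Longrightarrow>
    N X (f Y) - f (N X Y) = \<beta> *\<^sub>R (g (f X) Y \<star> xi_bar s \<xi> - eta_bar s \<eta> Y \<star> f X)"
  using Kenmotsu unfolding weak_beta_f_Kenmotsu_def by blast

lemma f_VF: "X \<in> VF \<Longrightarrow> f X \<in> VF" and Q_VF: "X \<in> VF \<Longrightarrow> Q X \<in> VF"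
  using tensor11_VF f_tensor Q_tensor by blast+

lemma f_skew_at: "X \<in> VF \<Longrightarrow> Y \<in> VF \<Longrightarrow> g (f X) Y p = - g X (f Y) p"
  by (simp add: f_skew)

text \<open>The squared length of \<open>f (\<xi> i)\<close> is g(\<xi>_i, Q \<xi>_i) minus the sum
  of the squares \<eta>^j(\<xi>_i)^2, that is, 1 - 1.\<close>

lemma f_\<xi>:
  assumes "i \<in> J"
  shows "f (\<xi> i) = 0"
proof (rule vfield_eqI)
  fix p
  have "g (f (\<xi> i)) (f (\<xi> i)) p = 1 - (\<Sum>j\<in>J. \<eta> j (\<xi> i) p * \<eta> j (\<xi> i) p)"
    using assms by (simp add: g_f_f \<xi>_VF Q_\<xi> g_\<xi>)
  also have "(\<Sum>j\<in>J. \<eta> j (\<xi> i) p * \<eta> j (\<xi> i) p) = (\<Sum>j\<in>J. if j = i then 1 else 0)"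
    using assms by (intro sum.cong) (auto simp: \<eta>_\<xi>)
  also have "\<dots> = 1" using assms finite_J by simp
  finally have "g (f (\<xi> i)) (f (\<xi> i)) p = 0" by simp
  then have "value_at (f (\<xi> i)) p = 0"
    using g_pos[OF f_VF[OF \<xi>_VF[OF assms]], of p] by fastforce
  then show "value_at (f (\<xi> i)) p = value_at 0 p" by (simp only: value_at_simps)
qed

text \<open>Put \<open>\<xi> i\<close> into the second slot of the compatibility condition: the
  left-hand side vanishes with \<open>f (\<xi> i)\<close>, and Q fixes
  \<open>\<xi> i\<close>.\<close>

lemma \<eta>_eq_g:
  assumes "i \<in> J" "X \<in> VF"
  shows "\<eta> i X p = g X (\<xi> i) p"
proof -
  have "0 = g (f X) (f (\<xi> i)) p"
    using assms by (simp only: f_\<xi> g_right f_VF)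
  also have "\<dots> = g X (\<xi> i) p - (\<Sum>j\<in>J. \<eta> j X p * \<eta> j (\<xi> i) p)"
    using assms by (simp add: g_f_f \<xi>_VF Q_\<xi>)
  also have "(\<Sum>j\<in>J. \<eta> j X p * \<eta> j (\<xi> i) p) = (\<Sum>j\<in>J. if j = i then \<eta> i X p else 0)"
    using assms by (intro sum.cong) (auto simp: \<eta>_\<xi>)
  also have "\<dots> = \<eta> i X p" using assms finite_J by simp
  finally show ?thesis by simp
qed

lemma \<eta>_SF: "i \<in> J \<Longrightarrow> X \<in> VF \<Longrightarrow> \<eta> i X \<in> SF"
  using one_form_SF[OF \<eta>_one_form] .

lemma \<eta>_f: "i \<in> J \<Longrightarrow> X \<in> VF \<Longrightarrow> \<eta> i (f X) p = 0"
  by (simp only: \<eta>_eq_g f_VF f_skew_at \<xi>_VF f_\<xi> g_right minus_zero)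

text \<open>The orthogonal projection onto the span of the fields \<open>\<xi> i\<close>. In terms
  of it, f^2 = P - Q, and id - P projects onto the orthogonal complement of the
  \<open>\<xi> i\<close>.\<close>

definition P :: "'a vfield \<Rightarrow> 'a vfield"
  where "P X = (\<Sum>i\<in>J. \<eta> i X \<star> \<xi> i)"

lemma P_VF: "X \<in> VF \<Longrightarrow> P X \<in> VF"
  unfolding P_def by (intro VF_sum VF_fscale \<eta>_SF \<xi>_VF)

lemma g_P:
  assumes "X \<in> VF" "Y \<in> VF"
  shows "g (P X) Y p = (\<Sum>i\<in>J. \<eta> i X p * \<eta> i Y p)"
proof -
  have "g (P X) Y p = (\<Sum>i\<in>J. g (\<eta> i X \<star> \<xi> i) Y p)"
    unfolding P_def using assms by (intro g_left VF_fscale \<eta>_SF \<xi>_VF)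
  also have "\<dots> = (\<Sum>i\<in>J. \<eta> i X p * \<eta> i Y p)"
    using assms
    by (intro sum.cong refl) (simp add: g_left \<eta>_SF \<xi>_VF \<eta>_eq_g[of _ Y] g_sym[of Y])
  finally show ?thesis .
qed

lemma g_P_sym: "X \<in> VF \<Longrightarrow> Y \<in> VF \<Longrightarrow> g X (P Y) p = g (P X) Y p"
  by (simp add: g_sym[of X "P Y"] P_VF g_P mult.commute)

lemma g_P_\<xi>:
  assumes "i \<in> J" "X \<in> VF"
  shows "g (P X) (\<xi> i) p = g X (\<xi> i) p"
proof -
  have "g (P X) (\<xi> i) p = (\<Sum>j\<in>J. if j = i then \<eta> i X p else 0)"
    unfolding g_P[OF assms(2) \<xi>_VF[OF assms(1)]]
    using assms by (intro sum.cong) (auto simp: \<eta>_\<xi>)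
  then show ?thesis using assms finite_J by (simp add: \<eta>_eq_g)
qed

lemma P_f: "X \<in> VF \<Longrightarrow> Y \<in> VF \<Longrightarrow> g (P X) (f Y) p = 0"
  by (simp add: g_P f_VF \<eta>_f)

lemma f_f_P: "X \<in> VF \<Longrightarrow> f (f X) = P X - Q X"
  by (simp only: f_f P_def uminus_add_conv_diff)

lemma g_f_f_P: "X \<in> VF \<Longrightarrow> Y \<in> VF \<Longrightarrow> g (f X) (f Y) p = g (Q X) Y p - g (P X) Y p"
  by (simp add: g_f_f g_P Q_sym)

lemma Q_P:
  assumes "X \<in> VF"
  shows "Q (P X) = P X"
proof -
  have "Q (P X) = (\<Sum>i\<in>J. Q (\<eta> i X \<star> \<xi> i))"
    unfolding P_def using assms
    by (intro tensor_sum[OF Q_tensor finite_J] VF_fscale \<eta>_SF \<xi>_VF)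
  also have "\<dots> = P X"
    unfolding P_def using assms
    by (intro sum.cong refl) (simp only: tensor11_fscale[OF Q_tensor] \<eta>_SF \<xi>_VF Q_\<xi>)
  finally show ?thesis .
qed

lemma Q_injective:
  assumes "X \<in> VF" "Q X = 0"
  shows "X = 0"
proof (rule vfield_eqI)
  fix p
  have "tensor_at A Q p (value_at X p) = tensor_at A Q p (value_at 0 p)"
    by (simp only: tensor_at_value[OF Q_tensor] assms VF_zero tensor_zero[OF Q_tensor])
  then show "value_at X p = value_at 0 p"
    using Q_bij[of p] value_at_tangent[OF assms(1)] value_at_tangent[OF VF_zero]
    by (auto simp: bij_betw_def dest: inj_onD)
qed

text \<open>If fX = 0 then f^2 = P - Q gives QX = PX, and PX = Q(PX) because Q fixes the
  \<open>\<xi> i\<close>; injectivity of Q finishes. This is where nonsingularity of Q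
  enters.\<close>

lemma f_kernel:
  assumes "X \<in> VF" "f X = 0"
  shows "X = P X"
proof -
  have "P X - Q X = 0"
    using f_f_P[OF assms(1)] assms(2) tensor_zero[OF f_tensor] by metis
  then have "P X = Q X" by (rule right_minus_eq[THEN iffD1])
  moreover have "Q (X - P X) = Q X - P X"
    using assms(1) by (simp only: tensor_diff[OF Q_tensor] P_VF Q_P)
  ultimately have "Q (X - P X) = 0" by (simp only: diff_self)
  then have "X - P X = 0"
    by (rule Q_injective[OF VF_diff[OF assms(1) P_VF[OF assms(1)]]])
  then show ?thesis by (rule right_minus_eq[THEN iffD1])
qed

section \<open>The sum of the characteristic fields and the covariant derivatives of the
  structure\<close>

definition "\<zeta> = xi_bar s \<xi>"

lemma \<zeta>_eq: "\<zeta> = (\<Sum>i\<in>J. \<xi> i)"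
  by (simp add: \<zeta>_def xi_bar_def J_def)

lemma \<zeta>_VF: "\<zeta> \<in> VF"
  unfolding \<zeta>_eq by (intro VF_sum \<xi>_VF)

lemma g_\<zeta>: "X \<in> VF \<Longrightarrow> g X \<zeta> p = (\<Sum>i\<in>J. g X (\<xi> i) p)"
  unfolding \<zeta>_eq by (intro g_right \<xi>_VF)

lemma eta_bar_eq: "X \<in> VF \<Longrightarrow> eta_bar s \<eta> X p = g X \<zeta> p"
  unfolding eta_bar_def J_def[symmetric] by (simp add: g_\<zeta> \<eta>_eq_g)

lemma eta_bar_SF:
  assumes "X \<in> VF"
  shows "eta_bar s \<eta> X \<in> SF"
proof -
  have "eta_bar s \<eta> X = g X \<zeta>" using eta_bar_eq[OF assms] by (intro HOL.ext)
  then show ?thesis using g_SF[OF assms \<zeta>_VF] by (simp only:)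
qed

lemma g_\<zeta>_\<xi>:
  assumes "i \<in> J"
  shows "g \<zeta> (\<xi> i) p = 1"
proof -
  have "g \<zeta> (\<xi> i) p = g (\<xi> i) \<zeta> p" using assms by (simp add: g_sym[of \<zeta>] \<zeta>_VF \<xi>_VF)
  also have "\<dots> = (\<Sum>j\<in>J. if j = i then 1 else 0)"
    unfolding g_\<zeta>[OF \<xi>_VF[OF assms]] using assms by (intro sum.cong) (auto simp: g_\<xi>)
  finally show ?thesis using assms finite_J by simp
qed

lemma g_\<zeta>_\<zeta>: "g \<zeta> \<zeta> p = s"
  by (simp add: g_\<zeta>[OF \<zeta>_VF] g_\<zeta>_\<xi> card_J)

lemma g_P_\<zeta>: "X \<in> VF \<Longrightarrow> g (P X) \<zeta> p = g X \<zeta> p"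
  by (simp add: g_\<zeta> P_VF g_P_\<xi>)

lemma g_f_\<xi>: "i \<in> J \<Longrightarrow> X \<in> VF \<Longrightarrow> g (f X) (\<xi> i) p = 0"
  using \<eta>_f[of i X p] by (simp add: \<eta>_eq_g f_VF)

lemma g_f_\<zeta>: "X \<in> VF \<Longrightarrow> g (f X) \<zeta> p = 0"
  by (simp add: g_\<zeta> f_VF g_f_\<xi>)

text \<open>The covariant derivative of \<open>f\<close>, that is (\<nabla>_X f) Y, as prescribed by
  the Kenmotsu equation.\<close>

definition F :: "'a vfield \<Rightarrow> 'a vfield \<Rightarrow> 'a vfield"
  where "F X Y = \<beta> *\<^sub>R (g (f X) Y \<star> \<zeta> - eta_bar s \<eta> Y \<star> f X)"

lemma F_VF: "X \<in> VF \<Longrightarrow> Y \<in> VF \<Longrightarrow> F X Y \<in> VF"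
  unfolding F_def by (intro VF_scaleR_closed VF_diff VF_fscale g_SF eta_bar_SF f_VF \<zeta>_VF)

lemma N_f_eq: "X \<in> VF \<Longrightarrow> Y \<in> VF \<Longrightarrow> N X (f Y) = f (N X Y) + F X Y"
  using N_f[of X Y] unfolding F_def \<zeta>_def by (simp only: diff_eq_eq add.commute)

lemma g_F:
  assumes "X \<in> VF" "Y \<in> VF" "Z \<in> VF"
  shows "g (F X Y) Z p = \<beta> * (g (f X) Y p * g \<zeta> Z p - g Y \<zeta> p * g (f X) Z p)"
  using assms unfolding F_def
  by (simp add: g_left VF_diff VF_fscale g_SF eta_bar_SF f_VF \<zeta>_VF eta_bar_eq)

text \<open>Differentiate f \<xi>_i = 0. The covariant derivative of f at \<open>\<xi> i\<close>
  reduces to -\<beta> fX, since fX is orthogonal to \<open>\<xi> i\<close> and \<xi>_i has inner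
  product 1 with \<open>\<zeta>\<close>.\<close>

lemma f_N_\<xi>:
  assumes "i \<in> J" "X \<in> VF"
  shows "f (N X (\<xi> i)) = \<beta> *\<^sub>R f X"
proof (rule VF_eqI)
  note V = assms(2) \<xi>_VF[OF assms(1)]
  show "f (N X (\<xi> i)) \<in> VF" "\<beta> *\<^sub>R f X \<in> VF"
    using V by (intro f_VF N_VF VF_scaleR_closed; simp)+
  fix Z p assume Z: "Z \<in> VF"
  have "f (N X (\<xi> i)) + F X (\<xi> i) = 0"
    using N_f_eq[OF V] V by (simp only: f_\<xi>[OF assms(1)] N_right_zero)
  then have "g (f (N X (\<xi> i)) + F X (\<xi> i)) Z p = 0" using Z by (simp only: g_left)
  then show "g (f (N X (\<xi> i))) Z p = g (\<beta> *\<^sub>R f X) Z p"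
    using V Z assms(1)
    by (simp add: g_left f_VF N_VF F_VF g_F g_f_\<xi> g_sym[of "\<xi> i" \<zeta>] \<zeta>_VF g_\<zeta>_\<xi>)
qed

text \<open>The difference \<open>N X (\<xi> i) - \<beta> *\<^sub>R X\<close> lies in the kernel of
  f and hence equals its own projection. This determines the derivative of \<open>\<xi> i\<close>
  except for its components along the \<open>\<xi> j\<close>.\<close>

lemma g_N_\<xi>_kernel:
  assumes "i \<in> J" "X \<in> VF" "Z \<in> VF"
  shows "g (N X (\<xi> i)) Z p = \<beta> * (g X Z p - g (P X) Z p) + g (P (N X (\<xi> i))) Z p"
proof -
  note V = assms \<xi>_VF[OF assms(1)]
  define K where "K = N X (\<xi> i) - \<beta> *\<^sub>R X"
  have K: "K \<in> VF" unfolding K_def using V by (intro VF_diff N_VF VF_scaleR_closed)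
  have "f K = 0"
    unfolding K_def using V
    by (simp only: tensor_diff[OF f_tensor] tensor_scaleR[OF f_tensor] f_N_\<xi> N_VF VF_scaleR_closed diff_self)
  then have "g K Z p = g (P K) Z p" using f_kernel[OF K] by metis
  moreover have "g (P K) Z p = g (P (N X (\<xi> i))) Z p - \<beta> * g (P X) Z p"
  proof -
    have "\<eta> j K p = \<eta> j (N X (\<xi> i)) p - \<beta> * \<eta> j X p" if "j \<in> J" for j
      using V that K unfolding \<eta>_eq_g[OF that K] K_def
      by (simp add: g_left N_VF VF_scaleR_closed \<eta>_eq_g \<xi>_VF)
    then have "(\<Sum>j\<in>J. \<eta> j K p * \<eta> j Z p) =
        (\<Sum>j\<in>J. (\<eta> j (N X (\<xi> i)) p - \<beta> * \<eta> j X p) * \<eta> j Z p)"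
      by (intro sum.cong refl) (simp only:)
    then show ?thesis
      using V K by (simp add: g_P N_VF sum_distrib_left sum_subtractf left_diff_distrib mult.assoc)
  qed
  moreover have "g K Z p = g (N X (\<xi> i)) Z p - \<beta> * g X Z p"
    unfolding K_def using V by (simp add: g_left N_VF VF_scaleR_closed)
  ultimately show ?thesis by (simp add: algebra_simps)
qed

text \<open>Normality is only needed for this: the bracket \<open>[f,f]\<close> has no \<open>\<xi> k\<close>-component.\<close>

lemma \<eta>_closed:
  assumes "k \<in> J" "X \<in> VF" "Y \<in> VF"
  shows "X (\<eta> k Y) p - Y (\<eta> k X) p = \<eta> k (lie_bracket X Y) p"
proof -
  note V = assms \<xi>_VF[OF assms(1)]
  have d_SF: "ext_deriv (\<eta> i) X Y \<in> SF" if "i \<in> J" for i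
    unfolding ext_deriv_def using V(2,3) that
    by (intro SF_scaleR SF_diff VF_apply[OF V(2)] VF_apply[OF V(3)] \<eta>_SF VF_lie_bracket)
  \<comment> \<open>The right-hand side is symmetric in \<open>U\<close> and \<open>W\<close>,
    because the square of the skew tensor f is self-adjoint. Hence the bracket of fX and fY has no
    component along \<open>\<xi> k\<close>; the other terms of the Nijenhuis tensor lie in the image
    of f, which is orthogonal to \<open>\<xi> k\<close>.\<close>
  have br: "g (N (f U) (f W)) (\<xi> k) p = \<beta> * g (f (f U)) W p" if "U \<in> VF" "W \<in> VF" for U W
    using that V
    by (simp add: N_f_eq f_VF g_left N_VF F_VF g_f_\<xi> g_F g_\<zeta>_\<xi>)
  have "g (nijenhuis f X Y) (\<xi> k) p = g (lie_bracket (f X) (f Y)) (\<xi> k) p"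
    using V unfolding nijenhuis_def
    by (simp add: g_left f_VF VF_lie_bracket VF_add VF_diff g_f_\<xi>)
  also have "\<dots> = 0"
    using V br[of X Y] br[of Y X] f_skew_at[of "f X" Y p] f_skew_at[of X "f Y" p] g_sym[of "f X" "f Y"]
      f_skew_at[of "f Y" X p]
    by (simp add: N_torsion f_VF g_left N_VF)
  finally have 1: "g (nijenhuis f X Y) (\<xi> k) p = 0" .
  have nVF: "nijenhuis f X Y \<in> VF"
    unfolding nijenhuis_def using V by (intro VF_diff VF_add f_VF VF_lie_bracket)
  have sVF: "(\<Sum>i\<in>J. ext_deriv (\<eta> i) X Y \<star> \<xi> i) \<in> VF"
    by (intro VF_sum VF_fscale d_SF \<xi>_VF)
  have "g (nijenhuis f X Y + 2 *\<^sub>R (\<Sum>i\<in>J. ext_deriv (\<eta> i) X Y \<star> \<xi> i)) (\<xi> k) p = 0"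
    using normal[OF V(2,3)] V(4) by (simp only: g_left)
  then have "g (\<Sum>i\<in>J. ext_deriv (\<eta> i) X Y \<star> \<xi> i) (\<xi> k) p = 0"
    using V(4) nVF sVF 1 by (simp add: g_left VF_scaleR_closed)
  also have "g (\<Sum>i\<in>J. ext_deriv (\<eta> i) X Y \<star> \<xi> i) (\<xi> k) p =
      (\<Sum>i\<in>J. g (ext_deriv (\<eta> i) X Y \<star> \<xi> i) (\<xi> k) p)"
    using V by (intro g_left VF_fscale d_SF \<xi>_VF)
  also have "\<dots> = (\<Sum>i\<in>J. if i = k then ext_deriv (\<eta> k) X Y p else 0)"
    using V by (intro sum.cong refl) (simp add: g_left d_SF \<xi>_VF g_\<xi>)
  also have "\<dots> = ext_deriv (\<eta> k) X Y p"
    using V finite_J by simp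
  finally show ?thesis
    by (simp add: ext_deriv_def)
qed

lemma deriv_\<eta>:
  assumes "k \<in> J" "X \<in> VF" "Y \<in> VF"
  shows "X (\<eta> k Y) p = g (N X Y) (\<xi> k) p + g Y (N X (\<xi> k)) p"
proof -
  have "\<eta> k Y = g Y (\<xi> k)" using \<eta>_eq_g[OF assms(1,3)] by (intro HOL.ext)
  then show ?thesis
    using N_metric[OF assms(2,3) \<xi>_VF[OF assms(1)]] by (simp only: plus_fun_apply)
qed

text \<open>Closedness of \<open>\<eta> k\<close>, rewritten with metric compatibility and vanishing
  torsion: the covariant derivative of \<open>\<xi> k\<close> is a self-adjoint
  endomorphism.\<close>

lemma N_\<xi>_sym:
  assumes "k \<in> J" "X \<in> VF" "Y \<in> VF"
  shows "g Y (N X (\<xi> k)) p = g X (N Y (\<xi> k)) p"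
  using \<eta>_closed[OF assms, of p] deriv_\<eta>[OF assms, of p] deriv_\<eta>[OF assms(1,3,2), of p]
    assms \<xi>_VF[OF assms(1)]
  by (simp add: \<eta>_eq_g VF_lie_bracket) (simp add: N_torsion g_left N_VF)

lemma N_\<xi>_skew:
  assumes "i \<in> J" "j \<in> J" "X \<in> VF"
  shows "g (N X (\<xi> i)) (\<xi> j) p = - g (N X (\<xi> j)) (\<xi> i) p"
proof -
  note V = assms(3) \<xi>_VF[OF assms(1)] \<xi>_VF[OF assms(2)]
  have "g (\<xi> i) (\<xi> j) = (\<lambda>_. if i = j then 1 else 0)"
    using assms by (auto simp: g_\<xi>)
  then have "g (N X (\<xi> i)) (\<xi> j) p + g (\<xi> i) (N X (\<xi> j)) p = 0"
    using N_metric[OF V] VF_const[OF V(1)] by (metis plus_fun_apply zero_fun_apply)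
  then show ?thesis
    using g_sym[OF V(2) N_VF[OF V(1,3)]] by simp
qed

text \<open>A tensor that is skew in the first two and symmetric in the last two indices vanishes.\<close>

lemma N_\<xi>_\<xi>:
  assumes "i \<in> J" "j \<in> J" "k \<in> J"
  shows "g (N (\<xi> k) (\<xi> i)) (\<xi> j) p = 0"
proof -
  define t where "t i j k = g (N (\<xi> k) (\<xi> i)) (\<xi> j) p" for i j k
  have skew: "t a b c = - t b a c" if "a \<in> J" "b \<in> J" "c \<in> J" for a b c
    unfolding t_def using N_\<xi>_skew[OF that(1,2) \<xi>_VF[OF that(3)]] .
  have sym: "t a b c = t a c b" if "a \<in> J" "b \<in> J" "c \<in> J" for a b c
    unfolding t_def using N_\<xi>_sym[OF that(1) \<xi>_VF[OF that(3)] \<xi>_VF[OF that(2)], of p] that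
    by (simp add: g_sym[OF N_VF] \<xi>_VF)
  have "t i j k = - t i j k"
    using skew[OF assms] sym[OF assms(2,1,3)] skew[OF assms(2,3,1)] sym[OF assms(3,2,1)]
      skew[OF assms(3,1,2)] sym[OF assms(1,3,2)]
    by linarith
  then show ?thesis by (simp add: t_def)
qed

text \<open>The undetermined components vanish. By symmetry the component of
  \<open>N X (\<xi> i)\<close> along \<open>\<xi> j\<close> equals g(\<nabla>_{\<xi>_j} \<xi>_i, X);
  there the explicit part cancels, since P fixes \<open>\<xi> j\<close>, and the projected part is
  zero by \<open>N_\<xi>_\<xi>\<close>.\<close>

lemma N_\<xi>:
  assumes "i \<in> J" "X \<in> VF" "Z \<in> VF"
  shows "g (N X (\<xi> i)) Z p = \<beta> * (g X Z p - g (P X) Z p)"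
proof -
  note V = assms \<xi>_VF[OF assms(1)]
  have "g (N X (\<xi> i)) (\<xi> j) p = 0" if j: "j \<in> J" for j
  proof -
    have "g (N X (\<xi> i)) (\<xi> j) p = g (N (\<xi> j) (\<xi> i)) X p"
      using N_\<xi>_sym[OF assms(1,2) \<xi>_VF[OF j], of p] V j by (simp add: g_sym[OF N_VF] \<xi>_VF)
    also have "\<dots> = \<beta> * (g (\<xi> j) X p - g (P (\<xi> j)) X p) + g (P (N (\<xi> j) (\<xi> i))) X p"
      using j V by (intro g_N_\<xi>_kernel \<xi>_VF)
    also have "g (P (\<xi> j)) X p = g (P X) (\<xi> j) p"
      using j V g_P_sym[of X "\<xi> j" p] by (simp add: g_sym[of X] P_VF \<xi>_VF)
    also have "\<dots> = g (\<xi> j) X p"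
      using j V by (simp add: g_P_\<xi> g_sym[of X] \<xi>_VF)
    also have "g (P (N (\<xi> j) (\<xi> i))) X p = 0"
      using j V by (simp add: g_P N_VF \<xi>_VF \<eta>_eq_g N_\<xi>_\<xi>)
    finally show ?thesis by simp
  qed
  then have "g (P (N X (\<xi> i))) Z p = 0"
    using V by (simp add: g_P N_VF \<eta>_eq_g)
  then show ?thesis
    using g_N_\<xi>_kernel[OF assms] by simp
qed

lemma N_\<zeta>:
  assumes "X \<in> VF" "Z \<in> VF"
  shows "g (N X \<zeta>) Z p = s * \<beta> * (g X Z p - g (P X) Z p)"
proof -
  have "N X \<zeta> = (\<Sum>i\<in>J. N X (\<xi> i))"
    unfolding \<zeta>_eq by (intro N_right_sum assms \<xi>_VF)
  then have "g (N X \<zeta>) Z p = (\<Sum>i\<in>J. g (N X (\<xi> i)) Z p)"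
    using assms \<xi>_VF by (simp only:) (intro g_left N_VF; simp)
  also have "\<dots> = s * \<beta> * (g X Z p - g (P X) Z p)"
    using assms by (simp add: N_\<xi> card_J)
  finally show ?thesis .
qed

text \<open>The derivatives of the functions \<open>\<eta> j Y\<close> are left as they are: after
  antisymmetrization in \<open>X\<close> and \<open>Y\<close>, closedness turns them into the
  projection of the Lie bracket.\<close>

lemma N_P:
  assumes "X \<in> VF" "Y \<in> VF" "Z \<in> VF"
  shows "g (N X (P Y)) Z p = (\<Sum>j\<in>J. X (\<eta> j Y) p * \<eta> j Z p) + \<beta> * g Y \<zeta> p * (g X Z p - g (P X) Z p)"
proof -
  have X\<eta>: "X (\<eta> j Y) \<in> SF" if "j \<in> J" for j
    using VF_apply[OF assms(1) \<eta>_SF[OF that assms(2)]] .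
  have "N X (P Y) = (\<Sum>j\<in>J. X (\<eta> j Y) \<star> \<xi> j + \<eta> j Y \<star> N X (\<xi> j))"
    unfolding P_def using assms
    by (subst N_right_sum) (auto intro!: VF_fscale \<eta>_SF \<xi>_VF sum.cong N_right_fscale)
  then have "g (N X (P Y)) Z p = (\<Sum>j\<in>J. g (X (\<eta> j Y) \<star> \<xi> j + \<eta> j Y \<star> N X (\<xi> j)) Z p)"
    using assms by (simp only:) (intro g_left VF_add VF_fscale X\<eta> \<eta>_SF N_VF \<xi>_VF; simp)
  also have "\<dots> = (\<Sum>j\<in>J. X (\<eta> j Y) p * \<eta> j Z p + g Y (\<xi> j) p * (\<beta> * (g X Z p - g (P X) Z p)))"
    using assms by (intro sum.cong refl)
      (simp add: g_left VF_fscale X\<eta> \<eta>_SF N_VF \<xi>_VF N_\<xi> \<eta>_eq_g[of _ Z] \<eta>_eq_g[of _ Y] g_sym[of Z])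
  also have "\<dots> = (\<Sum>j\<in>J. X (\<eta> j Y) p * \<eta> j Z p) + \<beta> * g Y \<zeta> p * (g X Z p - g (P X) Z p)"
    using assms by (simp add: sum.distrib g_\<zeta> sum_distrib_left sum_distrib_right sum_subtractf algebra_simps)
  finally show ?thesis .
qed

section \<open>Curvature on the characteristic fields and the Ricci identity for
  \<open>f\<close>\<close>

lemma N_\<xi>_eq:
  assumes "i \<in> J" "X \<in> VF"
  shows "N X (\<xi> i) = \<beta> *\<^sub>R (X - P X)"
proof (rule VF_eqI)
  show "N X (\<xi> i) \<in> VF" "\<beta> *\<^sub>R (X - P X) \<in> VF"
    using assms \<xi>_VF by (intro N_VF VF_scaleR_closed VF_diff P_VF; simp)+
  show "g (N X (\<xi> i)) Z p = g (\<beta> *\<^sub>R (X - P X)) Z p" if "Z \<in> VF" for Z p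
    using assms that by (simp add: N_\<xi> g_left VF_diff P_VF)
qed

text \<open>Since \<nabla>_X \<xi>_i = \<beta> (X - PX), the torsion-free identity and closedness of
  the \<eta>^j cancel everything except the terms in which P has been differentiated through the
  \<open>\<xi> j\<close>. Those no longer depend on \<open>i\<close>.\<close>

lemma R_\<xi>:
  assumes "i \<in> J" "X \<in> VF" "Y \<in> VF" "Z \<in> VF"
  shows "g (R X Y (\<xi> i)) Z p = \<beta>\<^sup>2 *
    (g X \<zeta> p * (g Y Z p - g (P Y) Z p) - g Y \<zeta> p * (g X Z p - g (P X) Z p))"
proof -
  note V = assms(2-4) \<xi>_VF[OF assms(1)]
  have 1: "g (N U (N W (\<xi> i))) Z p = \<beta> * (g (N U W) Z p - g (N U (P W)) Z p)"
    if "U \<in> VF" "W \<in> VF" for U W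
    using that V
    by (simp add: N_\<xi>_eq[OF assms(1)] N_right_scaleR N_right_diff VF_diff P_VF g_left N_VF)
  have "(\<Sum>j\<in>J. X (\<eta> j Y) p * \<eta> j Z p) - (\<Sum>j\<in>J. Y (\<eta> j X) p * \<eta> j Z p) =
      (\<Sum>j\<in>J. \<eta> j (lie_bracket X Y) p * \<eta> j Z p)"
    unfolding sum_subtractf[symmetric] left_diff_distrib[symmetric]
    using V by (intro sum.cong refl) (simp add: \<eta>_closed)
  also have "\<dots> = g (P (lie_bracket X Y)) Z p"
    using V by (simp add: g_P VF_lie_bracket)
  finally have 2: "(\<Sum>j\<in>J. X (\<eta> j Y) p * \<eta> j Z p) =
      g (P (lie_bracket X Y)) Z p + (\<Sum>j\<in>J. Y (\<eta> j X) p * \<eta> j Z p)" by linarith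
  have 3: "g (lie_bracket X Y) Z p = g (N X Y) Z p - g (N Y X) Z p"
    using V by (simp add: N_torsion g_left N_VF)
  have "g (R X Y (\<xi> i)) Z p = g (N X (N Y (\<xi> i))) Z p - g (N Y (N X (\<xi> i))) Z p
      - g (N (lie_bracket X Y) (\<xi> i)) Z p"
    unfolding curvature_def using V by (simp add: g_left VF_diff N_VF VF_lie_bracket)
  also have "\<dots> = \<beta>\<^sup>2 * (g X \<zeta> p * (g Y Z p - g (P Y) Z p) - g Y \<zeta> p * (g X Z p - g (P X) Z p))"
    using V by (simp add: 1 N_P N_\<xi>[OF assms(1)] VF_lie_bracket 2 3) (simp add: algebra_simps power2_eq_square)
  finally show ?thesis .
qed

lemma g_N_F:
  assumes "X \<in> VF" "Y \<in> VF" "Z \<in> VF" "W \<in> VF"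
  shows "g (N X (F Y Z)) W p = \<beta> *
    ((g (N X (f Y)) Z p + g (f Y) (N X Z) p) * g \<zeta> W p + g (f Y) Z p * g (N X \<zeta>) W p
     - (g (N X Z) \<zeta> p + g Z (N X \<zeta>) p) * g (f Y) W p - g Z \<zeta> p * g (N X (f Y)) W p)"
proof -
  note V = assms \<zeta>_VF
  have e: "eta_bar s \<eta> Z = g Z \<zeta>" using eta_bar_eq[OF V(3)] by (intro HOL.ext)
  have S: "g (f Y) Z \<in> SF" "g Z \<zeta> \<in> SF" "X (g (f Y) Z) \<in> SF" "X (g Z \<zeta>) \<in> SF"
    using V by (auto intro!: g_SF f_VF VF_apply[OF V(1)])
  have "N X (F Y Z) = \<beta> *\<^sub>R ((X (g (f Y) Z) \<star> \<zeta> + g (f Y) Z \<star> N X \<zeta>)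
      - (X (g Z \<zeta>) \<star> f Y + g Z \<zeta> \<star> N X (f Y)))"
    using V S unfolding F_def e
    by (simp only: N_right_scaleR N_right_diff N_right_fscale VF_diff VF_fscale f_VF)
  then have "g (N X (F Y Z)) W p = \<beta> * ((X (g (f Y) Z) p * g \<zeta> W p + g (f Y) Z p * g (N X \<zeta>) W p)
      - (X (g Z \<zeta>) p * g (f Y) W p + g Z \<zeta> p * g (N X (f Y)) W p))"
    using V S by (simp add: g_left VF_diff VF_add VF_fscale f_VF N_VF)
  moreover have "X (g (f Y) Z) p = g (N X (f Y)) Z p + g (f Y) (N X Z) p"
    "X (g Z \<zeta>) p = g (N X Z) \<zeta> p + g Z (N X \<zeta>) p"
    using V by (simp_all add: N_metric f_VF)
  ultimately show ?thesis by (simp add: algebra_simps)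
qed

text \<open>The metric of the distribution orthogonal to all \<open>\<xi> i\<close>, extended by
  zero.\<close>

definition h :: "'a metric"
  where "h X Y p = g X Y p - g (P X) Y p"

text \<open>The Ricci identity for f, paired with \<open>W\<close>; skewness of f has moved it onto
  \<open>W\<close> in the second term. The right-hand side is the antisymmetrized second covariant
  derivative of f. Its terms with factor \<open>s\<close> come from differentiating
  \<open>\<zeta>\<close>, the others from differentiating f once more.\<close>

lemma R_f:
  assumes "X \<in> VF" "Y \<in> VF" "Z \<in> VF" "W \<in> VF"
  shows "g (R X Y (f Z)) W p + g (R X Y Z) (f W) p = \<beta>\<^sup>2 *
    ((g X \<zeta> p * g (f Y) Z p - g Y \<zeta> p * g (f X) Z p) * g W \<zeta> p
     + g Z \<zeta> p * (g Y \<zeta> p * g (f X) W p - g X \<zeta> p * g (f Y) W p)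
     + real s * (g (f Y) Z p * h X W p - g (f X) Z p * h Y W p - h X Z p * g (f Y) W p + h Y Z p * g (f X) W p))"
proof -
  note V = assms(1-4) \<zeta>_VF
  have second: "g (N U (N V (f Z))) W p = - g (N U (N V Z)) (f W) p + g (F U (N V Z)) W p + g (N U (F V Z)) W p"
    if "U \<in> VF" "V \<in> VF" for U V
    using that V
    by (simp add: N_f_eq N_right_add f_VF N_VF F_VF g_left VF_add f_skew_at)
  have first: "g (N U (f V)) K p = g (f (N U V)) K p + g (F U V) K p"
    if "U \<in> VF" "V \<in> VF" "K \<in> VF" for U V K
    using that by (simp add: N_f_eq g_left f_VF N_VF F_VF)
  have br: "g (N (lie_bracket X Y) (f Z)) W p = - g (N (lie_bracket X Y) Z) (f W) p + g (F (lie_bracket X Y) Z) W p"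
    using V by (simp add: N_f_eq VF_lie_bracket g_left f_VF N_VF F_VF f_skew_at)
  have fbr: "g (f (lie_bracket X Y)) K p = g (f (N X Y)) K p - g (f (N Y X)) K p" if "K \<in> VF" for K
    using V that by (simp add: N_torsion tensor_diff[OF f_tensor] N_VF g_left f_VF)
  have "g (R X Y (f Z)) W p + g (R X Y Z) (f W) p =
      g (F X (N Y Z)) W p + g (N X (F Y Z)) W p - g (F Y (N X Z)) W p - g (N Y (F X Z)) W p
      - g (F (lie_bracket X Y) Z) W p"
    unfolding curvature_def using V
    by (simp add: g_left VF_diff N_VF VF_lie_bracket f_VF second br)
  also have "\<dots> = \<beta>\<^sup>2 *
    ((g X \<zeta> p * g (f Y) Z p - g Y \<zeta> p * g (f X) Z p) * g W \<zeta> p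
     + g Z \<zeta> p * (g Y \<zeta> p * g (f X) W p - g X \<zeta> p * g (f Y) W p)
     + real s * (g (f Y) Z p * h X W p - g (f X) Z p * h Y W p - h X Z p * g (f Y) W p + h Y Z p * g (f X) W p))"
  proof -
    have sy: "g \<zeta> W p = g W \<zeta> p" "g \<zeta> Z p = g Z \<zeta> p" "g Z (N X \<zeta>) p = g (N X \<zeta>) Z p"
      "g Z (N Y \<zeta>) p = g (N Y \<zeta>) Z p" "g (f X) Y p = - g (f Y) X p"
      using V g_sym[of \<zeta> W] g_sym[of \<zeta> Z] g_sym[of Z "N X \<zeta>"] g_sym[of Z "N Y \<zeta>"] g_sym[of X "f Y"] f_skew_at[of X Y p]
      by (auto simp: N_VF f_VF)
    show ?thesis
      using V
      by (simp add: g_N_F first g_F fbr f_VF N_VF VF_lie_bracket N_\<zeta> sy h_def)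
        (simp add: algebra_simps power2_eq_square)
  qed
  finally show ?thesis .
qed

end

section \<open>The star-Ricci tensor\<close>

context weak_Kenmotsu
begin

lemma Parseval:
  assumes "orthonormal_at p DIM('e) E" "X \<in> VF" "Y \<in> VF"
  shows "(\<Sum>i<DIM('e). g X (E i) p * g Y (E i) p) = g X Y p"
  using one_form_expand[OF assms(1,2) g_one_form[OF assms(3)]] assms by (simp add: g_sym)

text \<open>Cyclicity of the trace, tr(Tf) = tr(fT), combined with skewness of f; in the frame it
  amounts to swapping a double sum.\<close>

lemma trace_f_swap:
  assumes E: "orthonormal_at p DIM('e) E" and T: "tensor11 A T"
  shows "(\<Sum>i<DIM('e). g (T (f (E i))) (E i) p) = - (\<Sum>i<DIM('e). g (T (E i)) (f (E i)) p)"
proof -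
  note VF = orthonormal_at_VF[OF E]
  have "(\<Sum>i<DIM('e). g (T (f (E i))) (E i) p) =
      (\<Sum>i<DIM('e). \<Sum>j<DIM('e). g (f (E i)) (E j) p * g (T (E j)) (E i) p)"
    using one_form_expand[OF E f_VF tensor11_g_one_form[OF T]] VF by simp
  also have "\<dots> = (\<Sum>j<DIM('e). \<Sum>i<DIM('e). g (f (E i)) (E j) p * g (T (E j)) (E i) p)"
    by (rule sum.swap)
  also have "\<dots> = (\<Sum>j<DIM('e). - (\<Sum>i<DIM('e). g (f (E j)) (E i) p * g (T (E j)) (E i) p))"
    unfolding sum_negf[symmetric]
  proof (intro sum.cong refl)
    fix i j assume "j \<in> {..<DIM('e)}" "i \<in> {..<DIM('e)}"
    then have V: "E i \<in> VF" "E j \<in> VF" using VF by auto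
    show "g (f (E i)) (E j) p * g (T (E j)) (E i) p = - (g (f (E j)) (E i) p * g (T (E j)) (E i) p)"
      using f_skew_at[OF V, of p] g_sym[OF V(1) f_VF[OF V(2)]] by simp
  qed
  also have "\<dots> = (\<Sum>j<DIM('e). - g (T (E j)) (f (E j)) p)"
    using one_form_expand[OF E f_VF g_one_form[OF tensor11_VF[OF T]]] VF by simp
  finally show ?thesis by (simp add: sum_negf)
qed

lemma ricci_frame:
  assumes "orthonormal_at p DIM('e) E" "X \<in> VF" "Y \<in> VF"
  shows "ricci A N X Y p = (\<Sum>i<DIM('e). g (R (E i) X Y) (E i) p)"
  unfolding ricci_def using assms by (intro tensor_trace_orthonormal R_left_tensor11)

lemma g_P_frame:
  assumes E: "orthonormal_at p DIM('e) E"
  shows "(\<Sum>i<DIM('e). g (P (E i)) (E i) p) = s"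
proof -
  note VF = orthonormal_at_VF[OF E]
  have "(\<Sum>i<DIM('e). g (P (E i)) (E i) p) = (\<Sum>i<DIM('e). \<Sum>j\<in>J. g (\<xi> j) (E i) p * g (\<xi> j) (E i) p)"
    using VF by (intro sum.cong refl) (simp add: g_P \<eta>_eq_g g_sym[OF _ \<xi>_VF])
  also have "\<dots> = (\<Sum>j\<in>J. \<Sum>i<DIM('e). g (\<xi> j) (E i) p * g (\<xi> j) (E i) p)"
    by (rule sum.swap)
  also have "\<dots> = s"
    by (simp add: Parseval[OF E] \<xi>_VF g_\<xi> card_J)
  finally show ?thesis .
qed

text \<open>Trace the formula for the curvature on \<open>\<xi> j\<close> over its first argument.
  One part contracts to the inner product of X - PX with \<open>\<zeta>\<close> and vanishes; the
  other gives the trace of id - P, which is 2n.\<close>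

lemma ricci_\<xi>:
  assumes E: "orthonormal_at p DIM('e) E" and j: "j \<in> J" and X: "X \<in> VF"
  shows "ricci A N X (\<xi> j) p = - 2 * n * \<beta>\<^sup>2 * g X \<zeta> p"
proof -
  note VF = orthonormal_at_VF[OF E]
  have "ricci A N X (\<xi> j) p = (\<Sum>i<DIM('e). \<beta>\<^sup>2 *
      ((g X (E i) p * g \<zeta> (E i) p - g (P X) (E i) p * g \<zeta> (E i) p)
       - g X \<zeta> p * (g (E i) (E i) p - g (P (E i)) (E i) p)))"
    unfolding ricci_frame[OF E X \<xi>_VF[OF j]] using VF X j
    by (intro sum.cong refl) (simp add: R_\<xi> g_sym[of \<zeta>] \<zeta>_VF algebra_simps)
  also have "\<dots> = \<beta>\<^sup>2 * ((g X \<zeta> p - g (P X) \<zeta> p)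
      - g X \<zeta> p * ((\<Sum>i<DIM('e). g (E i) (E i) p) - (\<Sum>i<DIM('e). g (P (E i)) (E i) p)))"
    unfolding sum_distrib_left[symmetric] sum_subtractf
    using X \<zeta>_VF P_VF by (simp only: Parseval[OF E])
  also have "(\<Sum>i<DIM('e). g (E i) (E i) p) = 2 * n + s"
    using orthonormal_at_g[OF E] dim by simp
  finally show ?thesis
    using X by (simp add: g_P_frame[OF E] g_P_\<zeta>)
qed

lemma star_ricci_eq:
  assumes X: "X \<in> VF" and Y: "Y \<in> VF"
  shows "star_ricci A N f X Y p = ricci A N X (Q Y) p + \<beta>\<^sup>2 *
    (real s * (2 * real n - 1) * g (Q X) Y p + 2 * real n * g X \<zeta> p * g Y \<zeta> p
      - real s * (2 * real n - 1) * g (P X) Y p)"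
proof -
  obtain E where E: "orthonormal_at p DIM('e) E"
    using local_orthonormal_basis_exists local_orthonormal_basis_at by blast
  define D where "D = {..<DIM('e)}"
  have VF: "E i \<in> VF" if "i \<in> D" for i
    using orthonormal_at_VF[OF E] that by (simp add: D_def)
  note V = X Y f_VF[OF X] f_VF[OF Y] f_VF[OF f_VF[OF Y]] \<zeta>_VF P_VF[OF X] P_VF[OF Y] Q_VF[OF Y]
  note Pars = Parseval[OF E, folded D_def]
  \<comment> \<open>By skewness of f this is minus the trace of Z \<mapsto> f R_{Z,X} fY.\<close>
  define M where "M = (\<Sum>i\<in>D. g (R (E i) X (f Y)) (f (E i)) p)"
  have M': "(\<Sum>i\<in>D. g (R (f (E i)) X (f Y)) (E i) p) = - M"
    unfolding M_def D_def by (rule trace_f_swap[OF E R_left_tensor11[OF V(1,4)]])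
  have "tensor_trace A (\<lambda>Z. R X (f Y) (f Z)) p = (\<Sum>i\<in>D. g (R X (f Y) (f (E i))) (E i) p)"
    unfolding D_def by (rule tensor_trace_orthonormal[OF E tensor11_compose[OF R_right_tensor11[OF V(1,4)] f_tensor]])
  also have "\<dots> = (\<Sum>i\<in>D. g (R (E i) X (f Y)) (f (E i)) p - g (R (f (E i)) X (f Y)) (E i) p)"
  proof (intro sum.cong refl)
    fix i assume i: "i \<in> D"
    note W = VF[OF i] f_VF[OF VF[OF i]]
    \<comment> \<open>This is the middle term of the Bianchi sum for X, fY and f(E i). Pair symmetry
      turns it into a summand of \<open>M\<close>; the remaining term contributes another
      \<open>M\<close> after \<open>trace_f_swap\<close>, which cancels the factor one half.\<close>
    have "g (R (f Y) (f (E i)) X) (E i) p = - g (R (E i) X (f Y)) (f (E i)) p"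
      using R_pair_symmetry[OF V(4) W(2) V(1) W(1), of p] R_skew12_g[OF V(1) W(1) V(4) W(2), of p] by simp
    then show "g (R X (f Y) (f (E i))) (E i) p = g (R (E i) X (f Y)) (f (E i)) p - g (R (f (E i)) X (f Y)) (E i) p"
      using R_Bianchi_g[OF V(1,4) W(2,1), of p] by simp
  qed
  also have "\<dots> = 2 * M"
    by (simp add: sum_subtractf M' flip: M_def)
  finally have star: "star_ricci A N f X Y p = M"
    by (simp add: star_ricci_def)
  define G where "G = g (f X) (f Y) p"
  \<comment> \<open>The Ricci identity for f, applied to fY and paired with \<open>E i\<close>; f^2
    Y = PY - QY supplies the two curvature terms. Apart from the traces of g and P, the rest is
    arranged as products of two components along \<open>E i\<close>, ready for Parseval.\<close>
  have summand: "g (R (E i) X (f Y)) (f (E i)) p = g (R (E i) X (Q Y)) (E i) p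
      - (\<Sum>j\<in>J. \<eta> j Y p * g (R (E i) X (\<xi> j)) (E i) p)
      + \<beta>\<^sup>2 * (G * (g \<zeta> (E i) p * g \<zeta> (E i) p) - g X \<zeta> p * (g (f (f Y)) (E i) p * g \<zeta> (E i) p) * (-1)
        + s * (G * (g (E i) (E i) p - g (P (E i)) (E i) p)
          + (g (f (f Y)) (E i) p * g X (E i) p - g (f (f Y)) (E i) p * g (P X) (E i) p)
          - (g (f Y) (E i) p * g (f X) (E i) p)))"
    if i: "i \<in> D" for i
  proof -
    note W = VF[OF i] f_VF[OF VF[OF i]]
    have "f (f Y) = P Y - Q Y" by (rule f_f_P[OF Y])
    then have "R (E i) X (f (f Y)) = R (E i) X (P Y) - R (E i) X (Q Y)"
      using W V by (simp only: tensor_diff[OF R_right_tensor11])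
    then have 1: "g (R (E i) X (f (f Y))) (E i) p = g (R (E i) X (P Y)) (E i) p - g (R (E i) X (Q Y)) (E i) p"
      using W V by (simp only: g_left R_VF)
    have "R (E i) X (P Y) = (\<Sum>j\<in>J. \<eta> j Y \<star> R (E i) X (\<xi> j))"
      unfolding P_def
      using W V by (subst tensor_sum[OF R_right_tensor11 finite_J])
        (auto intro!: VF_fscale \<eta>_SF \<xi>_VF sum.cong tensor11_fscale[OF R_right_tensor11])
    then have "g (R (E i) X (P Y)) (E i) p = (\<Sum>j\<in>J. g (\<eta> j Y \<star> R (E i) X (\<xi> j)) (E i) p)"
      using W V by (simp only:) (intro g_left VF_fscale \<eta>_SF R_VF \<xi>_VF; simp)
    also have "\<dots> = (\<Sum>j\<in>J. \<eta> j Y p * g (R (E i) X (\<xi> j)) (E i) p)"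
      using W V by (intro sum.cong refl g_left R_VF \<xi>_VF \<eta>_SF)
    finally have 2: "g (R (E i) X (P Y)) (E i) p = (\<Sum>j\<in>J. \<eta> j Y p * g (R (E i) X (\<xi> j)) (E i) p)" .
    have fEi: "g (f (E i)) (E i) p = 0"
      using f_skew_at[OF W(1,1), of p] g_sym[OF W(1,2)] by simp
    have fEY: "g (f (E i)) (f Y) p = - g (f (f Y)) (E i) p"
      using f_skew_at[OF W(1) V(4), of p] g_sym[OF W(1) V(5)] by simp
    have Ps: "g (P (E i)) (f Y) p = 0" "g (P X) (f Y) p = 0"
      using W V by (simp_all add: P_f)
    have sy: "g (E i) \<zeta> p = g \<zeta> (E i) p" "g (E i) (f Y) p = g (f Y) (E i) p" "g X (f Y) p = g (f Y) X p"
      using W V by (simp_all add: g_sym[of "E i"] g_sym[of X])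
    show ?thesis
      using R_f[OF W(1) V(1) V(4) W(1), of p] 1 2 W V
      by (simp add: G_def h_def fEi fEY Ps sy g_f_\<zeta>) (simp add: algebra_simps)
  qed
  have "M = (\<Sum>i\<in>D. g (R (E i) X (Q Y)) (E i) p)
      - (\<Sum>j\<in>J. \<eta> j Y p * (\<Sum>i\<in>D. g (R (E i) X (\<xi> j)) (E i) p))
      + \<beta>\<^sup>2 * (G * (\<Sum>i\<in>D. g \<zeta> (E i) p * g \<zeta> (E i) p)
         - g X \<zeta> p * (\<Sum>i\<in>D. g (f (f Y)) (E i) p * g \<zeta> (E i) p) * (-1)
        + s * (G * ((\<Sum>i\<in>D. g (E i) (E i) p) - (\<Sum>i\<in>D. g (P (E i)) (E i) p))
          + ((\<Sum>i\<in>D. g (f (f Y)) (E i) p * g X (E i) p) - (\<Sum>i\<in>D. g (f (f Y)) (E i) p * g (P X) (E i) p))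
          - (\<Sum>i\<in>D. g (f Y) (E i) p * g (f X) (E i) p)))"
    unfolding M_def
    by (simp add: summand sum.distrib sum_subtractf flip: sum_distrib_left sum_distrib_right)
      (subst sum.swap, simp add: sum_distrib_left)
  moreover have "(\<Sum>i\<in>D. g (R (E i) X (Q Y)) (E i) p) = ricci A N X (Q Y) p"
    unfolding D_def by (rule ricci_frame[OF E X V(9), symmetric])
  moreover have "(\<Sum>j\<in>J. \<eta> j Y p * (\<Sum>i\<in>D. g (R (E i) X (\<xi> j)) (E i) p)) =
      - 2 * n * \<beta>\<^sup>2 * g X \<zeta> p * g Y \<zeta> p"
  proof -
    have "(\<Sum>j\<in>J. \<eta> j Y p * (\<Sum>i\<in>D. g (R (E i) X (\<xi> j)) (E i) p)) =
        (\<Sum>j\<in>J. g Y (\<xi> j) p * (- 2 * n * \<beta>\<^sup>2 * g X \<zeta> p))"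
      unfolding D_def
      by (intro sum.cong refl) (simp add: Y \<eta>_eq_g ricci_frame[OF E X \<xi>_VF, symmetric] ricci_\<xi>[OF E _ X])
    then show ?thesis by (simp add: g_\<zeta>[OF Y] sum_negf flip: sum_distrib_right)
  qed
  moreover have "(\<Sum>i\<in>D. g (E i) (E i) p) = 2 * n + s"
    using orthonormal_at_g[OF E] dim by (simp add: D_def)
  moreover have "(\<Sum>i\<in>D. g (P (E i)) (E i) p) = s"
    unfolding D_def by (rule g_P_frame[OF E])
  moreover have "g (f (f Y)) X p = - G"
    using f_skew_at[OF V(4,1), of p] g_sym[OF V(3,4)] by (simp add: G_def)
  moreover have "g (f (f Y)) (P X) p = 0"
    using P_f[OF X V(4), of p] g_sym[OF V(7) V(5)] by simp
  moreover have "g (f Y) (f X) p = G"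
    using g_sym[OF V(3,4)] by (simp add: G_def)
  \<comment> \<open>The coefficient of \<open>G\<close> adds up to s + s (2n - 1 - 1) = s (2n - 1):
    the first s is the squared length of \<open>\<zeta>\<close>, 2n is the trace of id - P, and each
    -1 comes from one Parseval sum.\<close>
  ultimately have "M = ricci A N X (Q Y) p + 2 * n * \<beta>\<^sup>2 * g X \<zeta> p * g Y \<zeta> p
      + \<beta>\<^sup>2 * (G * s + s * (G * (2 * n) - G - G))"
    using V by (simp add: Pars g_\<zeta>_\<zeta> g_f_\<zeta>)
  then show ?thesis
    using g_f_f_P[OF X Y, of p] unfolding star G_def by (simp add: algebra_simps)
qed

text \<open>The trace of the preceding formula. Self-adjointness of Q turns the sum of the Ric(e_i,
  Q e_i) into the trace of Q composed with the Ricci operator. The argument works in the very basis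
  that \<open>star_scalar_curvature\<close> chooses.\<close>

lemma star_scalar_curvature_eq:
  assumes S: "ricci_operator A g N S"
  shows "star_scalar_curvature A g N f p = tensor_trace A (\<lambda>X. Q (S X)) p +
    \<beta>\<^sup>2 * (4 * s * (real n)\<^sup>2 + s * (2 * real n - 1) * tensor_trace A (\<lambda>X. Q X - X) p)"
proof -
  define E where "E = (SOME E. local_orthonormal_basis A g p E)"
  have "local_orthonormal_basis A g p E"
    unfolding E_def by (rule someI_ex[OF local_orthonormal_basis_exists])
  then have E: "orthonormal_at p DIM('e) E" by (rule local_orthonormal_basis_at)
  note VF = orthonormal_at_VF[OF E]
  have ST: "tensor11 A S" and Sg: "\<And>X Y. X \<in> VF \<Longrightarrow> Y \<in> VF \<Longrightarrow> g (S X) Y = ricci A N X Y"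
    using S by (auto simp: ricci_operator_def)
  have QT: "tensor11 A (\<lambda>X. Q X - X)"
    unfolding tensor11_def
  proof (intro conjI ballI)
    fix X assume X: "X \<in> VF"
    then show "Q X - X \<in> VF" by (intro VF_diff Q_VF)
    show "Q (X + Y) - (X + Y) = Q X - X + (Q Y - Y)" if "Y \<in> VF" for Y
      by (simp only: tensor11_add[OF Q_tensor X that]) (simp only: algebra_simps)
    show "Q (\<phi> \<star> X) - \<phi> \<star> X = \<phi> \<star> (Q X - X)" if "\<phi> \<in> SF" for \<phi>
      by (simp only: tensor11_fscale[OF Q_tensor that X]) (simp add: fun_eq_iff fscale_apply algebra_simps)
  qed
  have dimsum: "(\<Sum>i<DIM('e). g (E i) (E i) p) = 2 * n + s"
    using orthonormal_at_g[OF E] dim by simp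
  have "tensor_trace A (\<lambda>X. Q X - X) p = (\<Sum>i<DIM('e). g (Q (E i)) (E i) p - g (E i) (E i) p)"
    unfolding tensor_trace_orthonormal[OF E QT]
    using VF by (intro sum.cong refl) (simp add: g_left Q_VF)
  then have trQ: "(\<Sum>i<DIM('e). g (Q (E i)) (E i) p) = tensor_trace A (\<lambda>X. Q X - X) p + (2 * n + s)"
    by (simp add: sum_subtractf dimsum)
  have "tensor_trace A (\<lambda>X. Q (S X)) p = (\<Sum>i<DIM('e). g (Q (S (E i))) (E i) p)"
    by (rule tensor_trace_orthonormal[OF E tensor11_compose[OF Q_tensor ST]])
  also have "\<dots> = (\<Sum>i<DIM('e). ricci A N (E i) (Q (E i)) p)"
    using VF Q_VF tensor11_VF[OF ST] by (intro sum.cong refl) (simp add: Q_sym Sg)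
  finally have trS: "(\<Sum>i<DIM('e). ricci A N (E i) (Q (E i)) p) = tensor_trace A (\<lambda>X. Q (S X)) p" ..
  have tr\<zeta>: "(\<Sum>i<DIM('e). g (E i) \<zeta> p * g (E i) \<zeta> p) = s"
    using Parseval[OF E \<zeta>_VF \<zeta>_VF] VF by (simp add: g_sym[OF _ \<zeta>_VF] g_\<zeta>_\<zeta>)
  have "star_scalar_curvature A g N f p = (\<Sum>i<DIM('e). star_ricci A N f (E i) (E i) p)"
    by (simp add: star_scalar_curvature_def E_def Let_def)
  also have "\<dots> = (\<Sum>i<DIM('e). ricci A N (E i) (Q (E i)) p + \<beta>\<^sup>2 *
      (s * (2 * real n - 1) * g (Q (E i)) (E i) p + 2 * real n * (g (E i) \<zeta> p * g (E i) \<zeta> p)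
      - s * (2 * real n - 1) * g (P (E i)) (E i) p))"
    using VF by (intro sum.cong refl) (simp add: star_ricci_eq mult.assoc)
  \<comment> \<open>The trace of Q is that of Q - id plus 2n + s, while P has trace s and
    \<open>\<zeta>\<close> has squared length s. The constant therefore collapses to s (2n - 1) 2n +
    2ns = 4 s n^2.\<close>
  also have "\<dots> = tensor_trace A (\<lambda>X. Q (S X)) p + \<beta>\<^sup>2 *
      (s * (2 * real n - 1) * (tensor_trace A (\<lambda>X. Q X - X) p + (2 * n + s)) + 2 * real n * real s
      - s * (2 * real n - 1) * s)"
    unfolding sum.distrib sum_subtractf sum_distrib_left[symmetric]
    by (simp only: trS trQ tr\<zeta> g_P_frame[OF E])
  finally show ?thesis
    by (simp add: algebra_simps power2_eq_square)
qed

end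

theorem theorem4:
  fixes A :: "('a::{t2_space, second_countable_topology}, 'e::euclidean_space) chart set"
    and n s :: nat and \<beta> :: real
    and f Q :: "'a vfield \<Rightarrow> 'a vfield"
    and \<xi> :: "nat \<Rightarrow> 'a vfield" and \<eta> :: "nat \<Rightarrow> 'a vfield \<Rightarrow> 'a \<Rightarrow> real"
    and g :: "'a metric" and N :: "'a vfield \<Rightarrow> 'a vfield \<Rightarrow> 'a vfield"
  assumes "smooth_manifold A"
    and "weak_beta_f_Kenmotsu A n s \<beta> f Q \<xi> \<eta> g N"
    and "\<beta> \<noteq> 0"
  shows "(\<forall>X\<in>vector_fields A. \<forall>Y\<in>vector_fields A. \<forall>p.
            star_ricci A N f X Y p =
              ricci A N X (Q Y) p +
              \<beta>\<^sup>2 * (real s * (2 * real n - 1) * g (Q X) Y p + 2 * real n * eta_bar s \<eta> X p * eta_bar s \<eta> Y p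
                   - real s * (2 * real n - 1) * (\<Sum>j\<in>{1..s}. \<eta> j X p * \<eta> j Y p))) \<and>
         (\<forall>RicS. ricci_operator A g N RicS \<longrightarrow> (\<forall>p.
            star_scalar_curvature A g N f p =
              tensor_trace A (\<lambda>X. Q (RicS X)) p +
              \<beta>\<^sup>2 * (4 * real s * (real n)\<^sup>2 + real s * (2 * real n - 1) * tensor_trace A (\<lambda>X. Q X - X) p)))"
proof -
  interpret weak_Kenmotsu A n s \<beta> f Q \<xi> \<eta> g N
    using assms by unfold_locales
  show ?thesis
  proof (intro conjI ballI allI impI)
    fix X Y p assume XY: "X \<in> VF" "Y \<in> VF"
    show "star_ricci A N f X Y p = ricci A N X (Q Y) p +
        \<beta>\<^sup>2 * (real s * (2 * real n - 1) * g (Q X) Y p + 2 * real n * eta_bar s \<eta> X p * eta_bar s \<eta> Y p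
          - real s * (2 * real n - 1) * (\<Sum>j\<in>{1..s}. \<eta> j X p * \<eta> j Y p))"
      unfolding star_ricci_eq[OF XY] eta_bar_eq[OF XY(1)] eta_bar_eq[OF XY(2)] g_P[OF XY] J_def ..
  qed (simp add: star_scalar_curvature_eq)
qed

end
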